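(* Let $G=(V,E)$ be a graph with $n=|V|$ vertices and maximum degree $\Delta$, and let $q\ge \alpha\Delta$ for an arbitrary constant $\alpha>0$. Let $(X^{\mathsf{col}}_t)_{t\ge 0}$ be the single-site Metropolis chain for uniform proper $q$-colorings of $G$: from an initial configuration $X^{\mathsf{col}}_0\in[q]^V$, at each step a vertex $v\in V$ is picked uniformly at random, a color $c'\in[q]$ is picked uniformly at random, and $X(v)$ is changed to $c'$ if $c'\notin\{X(u): u\in N(v)\}$ (otherwise the configuration is unchanged). Then there is a fully-asynchronous distributed algorithm on the network $G$ such that: (1) each node $v\in V$ receives an arbitrary $T\ge 0$ and its initial color $X^{\mathsf{col}}_0(v)\in[q]$ as inputs; (2) upon termination the algorithm outputs $X^{\mathsf{col}}_N\in[q]^V$ for some $N\ge nT$, each node $v$ returning $X^{\mathsf{col}}_N(v)$, where $X^{\mathsf{col}}_N$ is the $N$-th step of the chain $(X^{\mathsf{col}}_t)_{t\ge 0}$; (3) with high probability the algorithm terminates within $O(T+\log n)$ time units, where the $O(\cdot)$ hides a dependence on $\alpha$; and each message contains $O(\log n+\log\lceil T\rceil+\log q)$ bits.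
   Context: Model of computation (fully-asynchronous message passing): the network is the simple undirected graph $G=(V,E)$, nodes are processors and edges are bidirectional channels. There are no synchronized rounds: each message sent along a channel is delivered after a finite but unpredictable delay chosen by an adversarial scheduler that may adapt to the entire input, and messages on each channel are delivered reliably in FIFO order. A time unit is the maximum time elapsed between sending and delivery of any message in the execution; the time complexity is the number of time units from the start to termination. Each node may perform arbitrary local computation and use private randomness. $N(v)$ denotes the set of neighbors of $v$ in $G$.
   Formalization: In (2), N is a random number of steps independent of the chain and N ≥ nT holds only with high probability, since for a fixed or independent N the sure bound N ≥ nT fails, e.g. for two isolated vertices with q ≥ 2 and T > 0. *)

theory Defs
  imports "HOL-Probability.Probability"
begin

section \<open>Graphs\<close>

text \<open>Vertices are natural numbers. This loses no finite graph, and it lets an algorithm and the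
  constants in its guarantees be chosen before the graph, which a type variable for vertices
  would not allow.\<close>

definition simple_graph :: "nat set \<Rightarrow> nat set set \<Rightarrow> bool" where
  "simple_graph V E \<longleftrightarrow> finite V \<and> V \<noteq> {} \<and> (\<forall>e\<in>E. e \<subseteq> V \<and> card e = 2)"

definition nbhd :: "nat set set \<Rightarrow> nat \<Rightarrow> nat set" where
  "nbhd E v = {u. {u, v} \<in> E}"

definition max_degree :: "nat set \<Rightarrow> nat set set \<Rightarrow> nat" where
  "max_degree V E = Max ((\<lambda>v. card (nbhd E v)) ` V)"


section \<open>The Metropolis chain\<close>

text \<open>The colors are 1, ..., q, and a configuration is an element of
  \<open>V \<rightarrow>\<^sub>E {1..q}\<close>; it need not be a proper coloring.\<close>

definition metropolis_step ::
  "nat set \<Rightarrow> nat set set \<Rightarrow> nat \<Rightarrow> (nat \<Rightarrow> nat) \<Rightarrow> (nat \<Rightarrow> nat) pmf" where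
  "metropolis_step V E q x =
     map_pmf (\<lambda>(v, c). if c \<notin> x ` nbhd E v then x(v := c) else x)
       (pair_pmf (pmf_of_set V) (pmf_of_set {1..q}))"

definition markov_chain_from ::
  "'w measure \<Rightarrow> ('s \<Rightarrow> 's pmf) \<Rightarrow> 's \<Rightarrow> (nat \<Rightarrow> 'w \<Rightarrow> 's) \<Rightarrow> bool" where
  "markov_chain_from M K x0 X \<longleftrightarrow>
     (\<forall>t. X t \<in> measurable M (count_space UNIV)) \<and>
     (\<forall>t xs. measure M {\<omega> \<in> space M. \<forall>i\<le>t. X i \<omega> = xs i} =
        (if xs 0 = x0 then \<Prod>i<t. pmf (K (xs i)) (xs (Suc i)) else 0))"

text \<open>The library's \<open>indep_var\<close> would need N and the whole process X to have the same codomain type,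
  so independence is stated for the generated sigma-algebras.\<close>

definition indep_of_process ::
  "'w measure \<Rightarrow> ('w \<Rightarrow> nat) \<Rightarrow> (nat \<Rightarrow> 'w \<Rightarrow> 's) \<Rightarrow> bool" where
  "indep_of_process M N X \<longleftrightarrow>
     prob_space.indep_set M
       (sets (vimage_algebra (space M) N (count_space UNIV)))
       (sets (vimage_algebra (space M) (\<lambda>\<omega> t. X t \<omega>) (\<Pi>\<^sub>M t\<in>UNIV. count_space UNIV)))"


section \<open>Distributed algorithms\<close>

type_synonym msg = "bool list"

text \<open>The messages a node has received so far, with their senders, in order of arrival.\<close>
type_synonym history = "(nat \<times> msg) list"

text \<open>Local computation is unrestricted and takes no time, so a node is a function of its history:
  after each history (including the empty one, at the start) it gives the messages sent at that
  moment, with their addressees, and possibly the value returned.\<close>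
type_synonym behaviour = "history \<Rightarrow> (nat \<times> msg) list \<times> nat option"

text \<open>The initial knowledge of a node. In particular it knows neither the rest of the network
  nor the number of vertices.\<close>
record local_input =
  self :: nat
  neighbors :: "nat set"
  num_colors :: nat
  horizon :: real
  init_color :: nat

type_synonym coins = "nat \<Rightarrow> real"

type_synonym algorithm = "local_input \<Rightarrow> coins \<Rightarrow> behaviour"

text \<open>Private randomness: each node has its own infinite sequence of independent uniform reals,
  and these sequences are independent over the nodes.\<close>

definition node_coins :: "coins measure" where
  "node_coins = (\<Pi>\<^sub>M k\<in>UNIV. uniform_measure lborel {0..1})"

definition coin_space :: "nat set \<Rightarrow> (nat \<Rightarrow> coins) measure" where
  "coin_space V = (\<Pi>\<^sub>M v\<in>V. node_coins)"

definition network ::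
  "algorithm \<Rightarrow> nat set set \<Rightarrow> nat \<Rightarrow> real \<Rightarrow> (nat \<Rightarrow> nat) \<Rightarrow> (nat \<Rightarrow> coins) \<Rightarrow> nat \<Rightarrow> behaviour" where
  "network alg E q T x0 \<omega> v =
     alg \<lparr>self = v, neighbors = nbhd E v, num_colors = q, horizon = T, init_color = x0 v\<rparr> (\<omega> v)"


section \<open>Asynchronous executions\<close>

text \<open>\<open>chan c u w\<close> is the FIFO queue of messages in transit from u to w, oldest first, each with the
  time at which it was sent.\<close>
record config =
  hist :: "nat \<Rightarrow> history"
  chan :: "nat \<Rightarrow> nat \<Rightarrow> (real \<times> msg) list"

definition outgoing ::
  "nat set set \<Rightarrow> (nat \<Rightarrow> behaviour) \<Rightarrow> real \<Rightarrow> nat \<Rightarrow> history \<Rightarrow> nat \<Rightarrow> (real \<times> msg) list" where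
  "outgoing E B t u h w =
     (if w \<in> nbhd E u then [(t, m). (w', m) \<leftarrow> fst (B u h), w' = w] else [])"

definition returned :: "(nat \<Rightarrow> behaviour) \<Rightarrow> config \<Rightarrow> nat \<Rightarrow> nat option" where
  "returned B c v = snd (B v (hist c v))"

definition init_config :: "nat set set \<Rightarrow> (nat \<Rightarrow> behaviour) \<Rightarrow> config" where
  "init_config E B = \<lparr>hist = (\<lambda>_. []), chan = (\<lambda>u w. outgoing E B 0 u [] w)\<rparr>"

text \<open>Delivery at time t of the oldest message in transit from u to v; nothing happens if there is
  none. A node that has returned a value has halted: it discards the message, so it sends nothing
  more and its returned value is final.\<close>

definition deliver ::
  "nat set set \<Rightarrow> (nat \<Rightarrow> behaviour) \<Rightarrow> nat \<times> nat \<times> real \<Rightarrow> config \<Rightarrow> config" where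
  "deliver E B = (\<lambda>(u, v, t) c.
     case chan c u v of
       [] \<Rightarrow> c
     | (s, m) # rest \<Rightarrow>
         let c' = c\<lparr>chan := (chan c)(u := (chan c u)(v := rest))\<rparr>
         in if returned B c v \<noteq> None then c'
            else let h = hist c v @ [(u, m)]
                 in c'\<lparr>hist := (hist c)(v := h),
                       chan := (chan c')(v := (\<lambda>w. chan c' v w @ outgoing E B t v h w))\<rparr>)"

text \<open>The adversary's choices: the i-th entry \<open>(u, v, t)\<close> requests a delivery from u to v at time t.\<close>
type_synonym schedule = "nat \<Rightarrow> nat \<times> nat \<times> real"

primrec run ::
  "nat set set \<Rightarrow> (nat \<Rightarrow> behaviour) \<Rightarrow> schedule \<Rightarrow> nat \<Rightarrow> config" where
  "run E B \<sigma> 0 = init_config E B"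
| "run E B \<sigma> (Suc i) = deliver E B (\<sigma> i) (run E B \<sigma> i)"

definition step_time :: "schedule \<Rightarrow> nat \<Rightarrow> real" where
  "step_time \<sigma> i = snd (snd (\<sigma> i))"

text \<open>The time at which the configuration \<open>run E B \<sigma> i\<close> is reached.\<close>
definition clock :: "schedule \<Rightarrow> nat \<Rightarrow> real" where
  "clock \<sigma> i = (case i of 0 \<Rightarrow> 0 | Suc j \<Rightarrow> step_time \<sigma> j)"

text \<open>Time does not run backwards, and every message sent is delivered eventually (a nonempty
  channel is served again; with FIFO order this serves every message in it).\<close>
definition admissible :: "nat set set \<Rightarrow> (nat \<Rightarrow> behaviour) \<Rightarrow> schedule \<Rightarrow> bool" where
  "admissible E B \<sigma> \<longleftrightarrow>
     (\<forall>i. clock \<sigma> i \<le> clock \<sigma> (Suc i)) \<and>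
     (\<forall>i u v. chan (run E B \<sigma> i) u v \<noteq> [] \<longrightarrow> (\<exists>j\<ge>i. \<exists>t. \<sigma> j = (u, v, t)))"

definition delays :: "nat set set \<Rightarrow> (nat \<Rightarrow> behaviour) \<Rightarrow> schedule \<Rightarrow> real set" where
  "delays E B \<sigma> =
     {t - s | i u v t s m rest. \<sigma> i = (u, v, t) \<and> chan (run E B \<sigma> i) u v = (s, m) # rest}"

text \<open>The maximum delay in the execution. An execution in which all nodes halt has finitely many
  messages, so the supremum is then a maximum; the inserted 0 only matters when no message is ever
  sent.\<close>
definition time_unit :: "nat set set \<Rightarrow> (nat \<Rightarrow> behaviour) \<Rightarrow> schedule \<Rightarrow> real" where
  "time_unit E B \<sigma> = Sup (insert 0 (delays E B \<sigma>))"

definition terminates_with ::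
  "nat set \<Rightarrow> nat set set \<Rightarrow> (nat \<Rightarrow> behaviour) \<Rightarrow> schedule \<Rightarrow> (nat \<Rightarrow> nat) \<Rightarrow> bool" where
  "terminates_with V E B \<sigma> x \<longleftrightarrow> (\<exists>i. \<forall>v\<in>V. returned B (run E B \<sigma> i) v = Some (x v))"

definition terminates_within ::
  "nat set \<Rightarrow> nat set set \<Rightarrow> (nat \<Rightarrow> behaviour) \<Rightarrow> schedule \<Rightarrow> real \<Rightarrow> bool" where
  "terminates_within V E B \<sigma> R \<longleftrightarrow>
     (\<exists>i. (\<forall>v\<in>V. returned B (run E B \<sigma> i) v \<noteq> None) \<and> clock \<sigma> i \<le> R * time_unit E B \<sigma>)"

text \<open>Every message is in its channel in the configuration reached when it is sent, so looking at
  the messages in transit covers all messages of the execution.\<close>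
definition messages_at_most ::
  "nat set set \<Rightarrow> (nat \<Rightarrow> behaviour) \<Rightarrow> schedule \<Rightarrow> real \<Rightarrow> bool" where
  "messages_at_most E B \<sigma> b \<longleftrightarrow>
     (\<forall>i u v. \<forall>(s, m) \<in> set (chan (run E B \<sigma> i) u v). real (length m) \<le> b)"

end

theory Submission
  imports Defs "HOL-Combinatorics.Multiset_Permutations"
begin

text \<open>The schedule may adapt to all coins, so randomness and asynchrony are kept apart. For
  fixed coins and any admissible schedule, termination follows deterministically from two properties
  of the coins: the proposals contain no chain with n + 1 links, and events of different nodes have
  different times at precision p. Then p + n + 1 time units suffice, p of them to reach that
  precision. Only these two properties are given probabilities. Correctness needs no bound: the true
  network is always among the consistent ones.

  Fixed numbers of events would not give independent uniform vertices. With Poisson counts, the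
  factorials in their weights cancel against the number of ways to attribute the updates of each v
  to its events, so all proposal sequences become equally likely. N must be independent of the whole
  process X, hence X is continued past step N with spare coins.

  Long chains are bounded by an exponential moment: one update multiplies the expected total weight
  by at most 1 + 4 \<Delta> / (n q), up to an additive term, so about n (T + 1) updates cost a
  factor exp (O ((T + 1) / \<alpha>)).\<close>

text \<open>
  Node v draws a Poisson number of events with mean 2 T + 2 and gives each of them a uniform time in
  [0, 1] and a uniform color. Performing all events in the order of their times is a run of the
  Metropolis chain: given the total number N of events, the order of the times is uniform, so the
  proposals are independent and uniform, and N is Poisson and independent of them.

  The number of messages is not restricted, so a node may send a natural number in unary, with
  one-bit messages, within one time unit. The algorithm is plain gossip. Nodes exchange all they know,
  where event times are known to a precision that grows with the number of messages received. A node
  halts as soon as its knowledge determines which of its proposals are accepted and orders its events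
  relative to those of its neighbors.

  Suppose that v has not halted. Then some hypothetical network is consistent with the knowledge of v
  but disagrees about the acceptance of an event of v with color c. So some neighbor u holds c at that
  time in exactly one of the two networks. At the event of u where they part, either c is proposed or
  c is the color of u in the true network, and u had not halted one time unit earlier, because a
  halted node tells its neighbors what determined its decisions. A node that is active for long thus
  yields a long chain of events going back in time. Given the past, the color of an event satisfies
  the condition of a link with probability at most 2/q, so with \<open>\<Delta> \<le> q / \<alpha>\<close> a chain of length
  \<open>C (T + ln n)\<close> is unlikely.
\<close>

section \<open>Channels and milestones of an execution\<close>

lemma hist_deliver:
  "hist (deliver E B (u, v, t) c) w =
     (if w = v \<and> chan c u v \<noteq> [] \<and> returned B c v = None
      then hist c v @ [(u, snd (hd (chan c u v)))] else hist c w)"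
  by (auto simp: deliver_def Let_def split: list.splits)

lemma chan_deliver:
  "chan (deliver E B (u, v, t) c) x y =
     (if (x, y) = (u, v) then tl (chan c u v) else chan c x y) @
     (if x = v \<and> chan c u v \<noteq> [] \<and> returned B c v = None
      then outgoing E B t v (hist c v @ [(u, snd (hd (chan c u v)))]) y else [])"
  by (auto simp: deliver_def Let_def split: list.splits)

text \<open>Ghost state. A configuration forgets what has left a channel; with the log of all
  messages ever sent and the number of removals, a channel is a suffix of a list that only grows,
  and FIFO order becomes a statement about prefixes.\<close>

primrec sent_log ::
  "nat set set \<Rightarrow> (nat \<Rightarrow> behaviour) \<Rightarrow> schedule \<Rightarrow> nat \<Rightarrow> nat \<Rightarrow> nat \<Rightarrow> (real \<times> msg) list" where
  "sent_log E B \<sigma> 0 x y = outgoing E B 0 x [] y"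
| "sent_log E B \<sigma> (Suc i) x y = sent_log E B \<sigma> i x y @
     (case \<sigma> i of (u, v, t) \<Rightarrow>
        if x = v \<and> chan (run E B \<sigma> i) u v \<noteq> [] \<and> returned B (run E B \<sigma> i) v = None
        then outgoing E B t v (hist (run E B \<sigma> i) v @ [(u, snd (hd (chan (run E B \<sigma> i) u v)))]) y
        else [])"

text \<open>Removals are counted even if the receiver has halted and discards the message, so the
  count can exceed the number of messages in the receiver's history.\<close>

primrec popped :: "nat set set \<Rightarrow> (nat \<Rightarrow> behaviour) \<Rightarrow> schedule \<Rightarrow> nat \<Rightarrow> nat \<Rightarrow> nat \<Rightarrow> nat" where
  "popped E B \<sigma> 0 x y = 0"
| "popped E B \<sigma> (Suc i) x y = popped E B \<sigma> i x y +
     (case \<sigma> i of (u, v, t) \<Rightarrow> if (x, y) = (u, v) \<and> chan (run E B \<sigma> i) u v \<noteq> [] then 1 else 0)"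

text \<open>All that u has sent to w, as a function of the history of u alone. The time 0 is a
  dummy, since \<open>map snd\<close> drops the time stamps.\<close>

definition stream :: "nat set set \<Rightarrow> (nat \<Rightarrow> behaviour) \<Rightarrow> nat \<Rightarrow> nat \<Rightarrow> history \<Rightarrow> msg list" where
  "stream E B u w h = concat (map (\<lambda>k. map snd (outgoing E B 0 u (take k h) w)) [0..<Suc (length h)])"

definition recv :: "nat \<Rightarrow> history \<Rightarrow> msg list" where
  "recv u h = map snd (filter (\<lambda>e. fst e = u) h)"

lemma recv_Nil [simp]: "recv u [] = []"
  and recv_snoc: "recv u (h @ [(x, m)]) = recv u h @ (if x = u then [m] else [])"
  by (simp_all add: recv_def)

lemma map_snd_outgoing: "map snd (outgoing E B t u h w) = map snd (outgoing E B s u h w)"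
  unfolding outgoing_def map_concat by (auto simp: map_concat comp_def split: prod.split intro!: arg_cong[where f = concat])

lemma stream_Nil: "stream E B u w [] = map snd (outgoing E B 0 u [] w)"
  by (simp add: stream_def)

lemma stream_snoc:
  "stream E B u w (h @ [e]) = stream E B u w h @ map snd (outgoing E B 0 u (h @ [e]) w)"
proof -
  have "map (\<lambda>k. map snd (outgoing E B 0 u (take k (h @ [e])) w)) [0..<Suc (length h)] =
    map (\<lambda>k. map snd (outgoing E B 0 u (take k h) w)) [0..<Suc (length h)]"
    by (rule map_cong) auto
  then have "concat (map (\<lambda>k. map snd (outgoing E B 0 u (take k (h @ [e])) w)) [0..<Suc (length h)]) =
    stream E B u w h" by (simp only: stream_def)
  moreover have "[0..<Suc (length (h @ [e]))] = [0..<Suc (length h)] @ [Suc (length h)]" by simp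
  ultimately show ?thesis
    unfolding stream_def[of E B u w "h @ [e]"] by (simp del: upt_Suc)
qed

text \<open>The bound on \<open>popped\<close> belongs to the induction: it is what lets newly sent
  messages be appended behind the \<open>drop\<close>.\<close>

lemma chan_eq_drop:
  "chan (run E B \<sigma> i) x y = drop (popped E B \<sigma> i x y) (sent_log E B \<sigma> i x y) \<and>
   popped E B \<sigma> i x y \<le> length (sent_log E B \<sigma> i x y)"
proof (induction i arbitrary: x y)
  case 0
  show ?case by (simp add: init_config_def)
next
  case (Suc i)
  obtain u v t where s: "\<sigma> i = (u, v, t)" by (metis prod_cases3)
  have len: "popped E B \<sigma> i u v < length (sent_log E B \<sigma> i u v)" if "chan (run E B \<sigma> i) u v \<noteq> []"
    using Suc[of u v] that by auto
  show ?case
  proof (cases "(x, y) = (u, v) \<and> chan (run E B \<sigma> i) u v \<noteq> []")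
    case True
    then have "tl (chan (run E B \<sigma> i) u v) = drop (Suc (popped E B \<sigma> i u v)) (sent_log E B \<sigma> i u v)"
      using Suc[of u v] by (simp add: drop_Suc tl_drop)
    then show ?thesis using True len by (simp add: s chan_deliver)
  next
    case False
    then show ?thesis using Suc[of x y] by (auto simp: s chan_deliver)
  qed
qed

lemma map_snd_sent_log:
  "map snd (sent_log E B \<sigma> i x y) = stream E B x y (hist (run E B \<sigma> i) x)"
proof (induction i)
  case 0
  show ?case by (simp add: init_config_def stream_Nil)
next
  case (Suc i)
  obtain u v t where s: "\<sigma> i = (u, v, t)" by (metis prod_cases3)
  show ?case
    using Suc by (auto simp: s hist_deliver stream_snoc intro: map_snd_outgoing)
qed

lemma returned_mono:
  assumes "returned B (run E B \<sigma> i) v \<noteq> None" "i \<le> j"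
  shows "hist (run E B \<sigma> j) v = hist (run E B \<sigma> i) v"
  using assms(2)
proof (induction j rule: dec_induct)
  case (step j)
  obtain x y t where s: "\<sigma> j = (x, y, t)" by (metis prod_cases3)
  have "returned B (run E B \<sigma> j) v \<noteq> None" using assms(1) step.IH by (simp add: returned_def)
  then show ?case using step.IH by (auto simp: s hist_deliver)
qed simp

lemma returned_None_mono:
  "returned B (run E B \<sigma> j) v = None \<Longrightarrow> i \<le> j \<Longrightarrow> returned B (run E B \<sigma> i) v = None"
  by (metis returned_mono returned_def)

lemma sent_log_mono:
  assumes "i \<le> j"
  shows "\<exists>ys. sent_log E B \<sigma> j x y = sent_log E B \<sigma> i x y @ ys"
  using assms by (induction j rule: dec_induct) auto

lemma popped_mono: "i \<le> j \<Longrightarrow> popped E B \<sigma> i x y \<le> popped E B \<sigma> j x y"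
  by (induction j rule: dec_induct) auto

text \<open>The rest \<open>ys\<close> consists of the messages discarded after halting. Its
  emptiness for a live node is carried along because liveness can only be lost.\<close>

lemma recv_prefix:
  "\<exists>ys. map snd (take (popped E B \<sigma> i u w) (sent_log E B \<sigma> i u w)) =
     recv u (hist (run E B \<sigma> i) w) @ ys \<and> (returned B (run E B \<sigma> i) w = None \<longrightarrow> ys = [])"
proof (induction i)
  case 0
  show ?case by (simp add: init_config_def)
next
  case (Suc i)
  obtain x v t where s: "\<sigma> i = (x, v, t)" by (metis prod_cases3)
  let ?c = "run E B \<sigma> i" and ?p = "popped E B \<sigma> i u w" and ?l = "sent_log E B \<sigma> i u w"
  obtain ys where ys: "map snd (take ?p ?l) = recv u (hist ?c w) @ ys"
    "returned B ?c w = None \<longrightarrow> ys = []" using Suc by (elim exE conjE)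
  have le: "?p \<le> length ?l" by (rule chan_eq_drop[THEN conjunct2])
  have none: "returned B (run E B \<sigma> (Suc i)) w = None \<Longrightarrow> returned B ?c w = None"
    by (erule returned_None_mono) simp
  show ?case
  proof (cases "(x, v) = (u, w) \<and> chan ?c u w \<noteq> []")
    case True
    have ch: "chan ?c u w = drop ?p ?l" by (rule chan_eq_drop[THEN conjunct1])
    then have lt: "?p < length ?l" using True by auto
    have "take (Suc ?p) ?l = take ?p ?l @ [hd (chan ?c u w)]"
      unfolding ch using lt by (simp add: hd_drop_conv_nth take_Suc_conv_app_nth)
    then have t: "map snd (take (popped E B \<sigma> (Suc i) u w) (sent_log E B \<sigma> (Suc i) u w)) =
      recv u (hist ?c w) @ ys @ [snd (hd (chan ?c u w))]"
      using True lt ys(1) by (simp add: s)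
    show ?thesis
    proof (cases "returned B ?c w = None")
      case live: True
      then show ?thesis unfolding t using ys(2) True
        by (simp add: s hist_deliver recv_snoc)
    next
      case False
      then have "hist (run E B \<sigma> (Suc i)) w = hist ?c w" by (auto simp: s hist_deliver)
      moreover have "returned B (run E B \<sigma> (Suc i)) w \<noteq> None" using none False by blast
      ultimately show ?thesis 
        unfolding t by (intro exI[of _ "ys @ [snd (hd (chan ?c u w))]"]) (simp del: run.simps)
    qed
  next
    case False
    then have "map snd (take (popped E B \<sigma> (Suc i) u w) (sent_log E B \<sigma> (Suc i) u w)) =
        map snd (take ?p ?l)" using le by (auto simp: s)
    moreover have "recv u (hist (run E B \<sigma> (Suc i)) w) = recv u (hist ?c w)"
      using False by (auto simp: s hist_deliver recv_snoc)
    ultimately show ?thesis using ys none by metis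
  qed
qed

lemma recv_live:
  assumes "returned B (run E B \<sigma> i) w = None"
  shows "recv u (hist (run E B \<sigma> i) w) =
    map snd (take (popped E B \<sigma> i u w) (sent_log E B \<sigma> i u w))"
  using recv_prefix[where E = E and B = B and \<sigma> = \<sigma> and i = i and u = u and w = w] assms by auto

lemma recv_stream:
  "\<exists>ys. stream E B u w (hist (run E B \<sigma> i) u) = recv u (hist (run E B \<sigma> i) w) @ ys"
proof -
  let ?p = "popped E B \<sigma> i u w" and ?l = "sent_log E B \<sigma> i u w"
  obtain ys where ys: "map snd (take ?p ?l) = recv u (hist (run E B \<sigma> i) w) @ ys"
    using recv_prefix by blast
  have "stream E B u w (hist (run E B \<sigma> i) u) = map snd (take ?p ?l @ drop ?p ?l)"
    by (simp only: map_snd_sent_log append_take_drop_id)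
  also have "\<dots> = recv u (hist (run E B \<sigma> i) w) @ (ys @ map snd (drop ?p ?l))"
    by (simp only: map_append ys append_assoc)
  finally show ?thesis by (rule exI)
qed

lemma outgoing_not_nbhd: "w \<notin> nbhd E u \<Longrightarrow> outgoing E B t u h w = []"
  by (simp add: outgoing_def)

lemma stream_not_nbhd: "w \<notin> nbhd E u \<Longrightarrow> stream E B u w h = []"
  by (simp add: stream_def outgoing_not_nbhd)

lemma nbhd_sym: "u \<in> nbhd E v \<longleftrightarrow> v \<in> nbhd E u"
  by (simp add: nbhd_def insert_commute)

lemma nbhd_imp:
  assumes "simple_graph V E" "u \<in> nbhd E v"
  shows "u \<in> V" "v \<in> V" "u \<noteq> v"
proof -
  have "{u, v} \<in> E" using assms(2) by (simp add: nbhd_def)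
  moreover have "\<forall>e\<in>E. e \<subseteq> V \<and> card e = 2" using assms(1) by (simp add: simple_graph_def)
  ultimately have "{u, v} \<subseteq> V \<and> card {u, v} = 2" by (rule bspec[rotated])
  then show "u \<in> V" "v \<in> V" "u \<noteq> v" by (simp_all add: card_insert_if split: if_splits)
qed

section \<open>Milestones and elapsed time\<close>

locale execution =
  fixes V :: "nat set" and E :: "nat set set" and B :: "nat \<Rightarrow> behaviour" and \<sigma> :: schedule
  assumes graph: "simple_graph V E" and adm: "admissible E B \<sigma>"
begin

abbreviation "R \<equiv> run E B \<sigma>"
abbreviation "logs \<equiv> sent_log E B \<sigma>"
abbreviation "pops \<equiv> popped E B \<sigma>"

lemma clock_mono: "i \<le> j \<Longrightarrow> clock \<sigma> i \<le> clock \<sigma> j"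
  by (rule lift_Suc_mono_le[where f = "clock \<sigma>"]) (use adm in \<open>simp_all only: admissible_def\<close>)

lemma sent_time: "(s, m) \<in> set (logs i x y) \<Longrightarrow> s \<le> clock \<sigma> i"
proof (induction i)
  case 0
  then show ?case by (auto simp: outgoing_def clock_def split: if_splits)
next
  case (Suc i)
  obtain u v t where s: "\<sigma> i = (u, v, t)" by (metis prod_cases3)
  have "clock \<sigma> i \<le> clock \<sigma> (Suc i)" by (rule clock_mono) simp
  moreover have "clock \<sigma> (Suc i) = t" by (simp add: clock_def step_time_def s)
  ultimately show ?case using Suc
    by (auto simp: s outgoing_def split: if_splits)
qed

lemma logs_empty: "x \<notin> V \<or> y \<notin> V \<Longrightarrow> logs i x y = []"
proof -
  assume *: "x \<notin> V \<or> y \<notin> V"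
  have "y \<notin> nbhd E x" using nbhd_imp[OF graph] * by blast
  then have "map snd (logs i x y) = []" by (simp add: map_snd_sent_log stream_not_nbhd)
  then show ?thesis by simp
qed

text \<open>Admissibility only promises that a nonempty channel is requested again, and one request
  removes one message; hence the induction on the number of removals. If the channel is already
  empty when the request comes, everything in the log has left it.\<close>

lemma ex_popped: "\<exists>j\<ge>i. n \<le> length (logs i x y) \<longrightarrow> n \<le> pops j x y"
proof (induction n)
  case (Suc n)
  show ?case
  proof (cases "Suc n \<le> length (logs i x y)")
    case True
    then obtain j where j: "j \<ge> i" "n \<le> pops j x y" using Suc by auto
    show ?thesis
    proof (cases "n = pops j x y")
      case eq: True
      obtain ys where "logs j x y = logs i x y @ ys" using sent_log_mono j(1) by blast
      then have "chan (R j) x y \<noteq> []"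
        using True eq chan_eq_drop[of E B \<sigma> j x y] by auto
      then obtain k t where k: "k \<ge> j" "\<sigma> k = (x, y, t)" using adm unfolding admissible_def by meson
      show ?thesis
      proof (cases "chan (R k) x y = []")
        case True
        then have "pops k x y = length (logs k x y)"
          using chan_eq_drop[of E B \<sigma> k x y] by auto
        moreover obtain zs where "logs k x y = logs i x y @ zs" using sent_log_mono j(1) k(1) le_trans by blast
        ultimately have "Suc n \<le> pops k x y" using \<open>Suc n \<le> _\<close> by simp
        then show ?thesis using j k by (intro exI[of _ k]) auto
      next
        case False
        have "pops j x y \<le> pops k x y" using k by (intro popped_mono)
        then have "Suc n \<le> pops (Suc k) x y" using k False eq by simp
        then show ?thesis using j k by (intro exI[of _ "Suc k"]) auto
      qed
    next
      case False
      then show ?thesis using j by (intro exI[of _ j]) auto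
    qed
  qed auto
qed auto

definition flushed :: "nat \<Rightarrow> nat \<Rightarrow> bool" where
  "flushed i j \<longleftrightarrow> i \<le> j \<and> (\<forall>x y. length (logs i x y) \<le> pops j x y)"

lemma ex_flushed: "\<exists>j. flushed i j"
proof -
  have "\<forall>e. \<exists>j\<ge>i. length (logs i (fst e) (snd e)) \<le> pops j (fst e) (snd e)"
    using ex_popped by (metis le_refl)
  then obtain J where J: "\<And>e. J e \<ge> i" "\<And>e. length (logs i (fst e) (snd e)) \<le> pops (J e) (fst e) (snd e)"
    by metis
  define j where "j = Max (insert i (J ` (V \<times> V)))"
  have fin: "finite (V \<times> V)" using graph by (simp add: simple_graph_def)
  have "i \<le> j" unfolding j_def using fin by simp
  moreover have "length (logs i x y) \<le> pops j x y" for x y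
  proof (cases "x \<in> V \<and> y \<in> V")
    case True
    then have "J (x, y) \<le> j" unfolding j_def using fin by (intro Max_ge) auto
    then show ?thesis using J(2)[of "(x, y)"] popped_mono[of "J (x, y)" j E B \<sigma> x y] by simp
  next
    case False
    then show ?thesis using logs_empty by auto
  qed
  ultimately show ?thesis unfolding flushed_def by blast
qed

text \<open>Everything in transit at a milestone has been delivered at the next one, so milestones are at
  most one time unit apart.\<close>

primrec milestone :: "nat \<Rightarrow> nat" where
  "milestone 0 = 0"
| "milestone (Suc k) = (LEAST j. flushed (milestone k) j)"

lemma flushed_milestone: "flushed (milestone k) (milestone (Suc k))"
  unfolding milestone.simps using ex_flushed by (rule LeastI_ex)

lemma milestone_le: "milestone k \<le> milestone (Suc k)"
  using flushed_milestone unfolding flushed_def by blast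

lemma clock_milestone:
  assumes tau: "\<And>d. d \<in> delays E B \<sigma> \<Longrightarrow> d \<le> \<tau>" and "\<tau> \<ge> 0"
  shows "clock \<sigma> (milestone k) \<le> real k * \<tau>"
proof (induction k)
  case (Suc k)
  let ?i = "milestone k" and ?j = "milestone (Suc k)"
  have "clock \<sigma> ?j \<le> clock \<sigma> ?i + \<tau>"
  proof (cases "?j = ?i")
    case False
    then have "?i < ?j" using milestone_le[of k] by simp
    then obtain j where j: "?j = Suc j" "?i \<le> j" by (metis less_eq_Suc_le Suc_le_D Suc_le_mono)
    \<comment> \<open>Minimality of the milestone: at j some message sent by \<open>?i\<close> is
      still in transit, at \<open>Suc j\<close> none is. So step j delivers a message that was sent
      no later than \<open>clock \<sigma> ?i\<close>, and its delay bounds the time elapsed since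
      then.\<close>
    have "\<not> flushed ?i j"
      by (rule not_less_Least) (use j(1) in simp)
    then obtain x y where xy: "\<not> length (logs ?i x y) \<le> pops j x y"
      using j(2) unfolding flushed_def by blast
    have full: "length (logs ?i x y) \<le> pops (Suc j) x y"
      using flushed_milestone[of k] unfolding flushed_def j(1) by blast
    obtain u v t where s: "\<sigma> j = (u, v, t)" by (metis prod_cases3)
    have uv: "(x, y) = (u, v)" "chan (R j) u v \<noteq> []"
      using xy full by (auto simp: s split: if_splits)
    obtain ys where ys: "logs j x y = logs ?i x y @ ys" using sent_log_mono j(2) by blast
    then have "hd (chan (R j) x y) = logs ?i x y ! pops j x y"
      using xy chan_eq_drop[of E B \<sigma> j x y] by (simp add: hd_drop_conv_nth nth_append)
    then have "hd (chan (R j) x y) \<in> set (logs ?i x y)" using xy by simp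
    moreover obtain s' m rest where c: "chan (R j) x y = (s', m) # rest"
      using uv by (cases "chan (R j) x y") auto
    ultimately have "s' \<le> clock \<sigma> ?i" using sent_time by auto
    moreover have "t - s' \<in> delays E B \<sigma>" unfolding delays_def using s c uv by blast
    moreover have "clock \<sigma> ?j = t" using j s by (simp add: clock_def step_time_def)
    ultimately show ?thesis using tau[of "t - s'"] by simp
  qed (use \<open>\<tau> \<ge> 0\<close> in simp)
  then show ?case using Suc by (simp add: algebra_simps)
qed (simp add: clock_def)

text \<open>\<open>time_unit\<close> is a supremum of reals and bounds the delays only if they are
  bounded. Once all nodes have halted the logs are frozen, and after the next flush all channels
  stay empty, so only finitely many steps contribute a delay.\<close>

lemma bdd_delays:
  assumes "\<forall>v\<in>V. returned B (R i) v \<noteq> None"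
  shows "bdd_above (delays E B \<sigma>)"
proof -
  obtain j where j: "flushed i j" using ex_flushed by blast
  have const: "logs k x y = logs i x y" if "k \<ge> i" for k x y
  proof (cases "x \<in> V")
    case True
    then have "hist (R k) x = hist (R i) x" using assms returned_mono that by blast
    then have "map snd (logs k x y) = map snd (logs i x y)" by (simp add: map_snd_sent_log)
    then have "length (logs k x y) = length (logs i x y)" by (metis length_map)
    then show ?thesis using sent_log_mono[OF that, of E B \<sigma> x y] by auto
  qed (simp add: logs_empty)
  have empty: "chan (R k) x y = []" if "k \<ge> j" for k x y
  proof -
    have "length (logs i x y) \<le> pops k x y" using j popped_mono[OF that, of E B \<sigma> x y]
      unfolding flushed_def by (meson le_trans)
    then show ?thesis using chan_eq_drop[of E B \<sigma> k x y] const[of k x y] that j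
      by (auto simp: flushed_def)
  qed
  have "delays E B \<sigma> \<subseteq> (\<lambda>k. case \<sigma> k of (u, v, t) \<Rightarrow> t - fst (hd (chan (R k) u v))) ` {..<j}"
  proof
    fix d assume "d \<in> delays E B \<sigma>"
    then obtain k u v t s m rest where "d = t - s" "\<sigma> k = (u, v, t)" "chan (R k) u v = (s, m) # rest"
      unfolding delays_def by blast
    moreover from this have "k < j" using empty[of k u v] by (metis list.distinct(1) not_le)
    ultimately show "d \<in> (\<lambda>k. case \<sigma> k of (u, v, t) \<Rightarrow> t - fst (hd (chan (R k) u v))) ` {..<j}"
      by (intro image_eqI[of _ _ k]) auto
  qed
  then show ?thesis by (meson bdd_above_finite finite_imageI finite_lessThan finite_subset)
qed

lemma terminates_within_milestone:
  assumes "\<forall>v\<in>V. returned B (R (milestone k)) v \<noteq> None" "real k \<le> r"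
  shows "terminates_within V E B \<sigma> r"
proof -
  have bdd: "bdd_above (insert 0 (delays E B \<sigma>))" using bdd_delays[OF assms(1)] by simp
  have up: "d \<le> time_unit E B \<sigma>" if "d \<in> insert 0 (delays E B \<sigma>)" for d
    unfolding time_unit_def using bdd that by (intro cSup_upper)
  have "clock \<sigma> (milestone k) \<le> real k * time_unit E B \<sigma>"
    using up by (intro clock_milestone) auto
  also have "\<dots> \<le> r * time_unit E B \<sigma>" using assms(2) up by (intro mult_right_mono) auto
  finally show ?thesis using assms(1) unfolding terminates_within_def by blast
qed

lemma recv_milestone:
  assumes "returned B (R (milestone (Suc k))) w = None"
  shows "\<exists>ys. recv u (hist (R (milestone (Suc k))) w) = stream E B u w (hist (R (milestone k)) u) @ ys"
proof -
  let ?j = "milestone (Suc k)" and ?i = "milestone k"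
  obtain ys where ys: "logs ?j u w = logs ?i u w @ ys" using sent_log_mono milestone_le by blast
  have "length (logs ?i u w) \<le> pops ?j u w" using flushed_milestone unfolding flushed_def by blast
  then show ?thesis
    unfolding recv_live[OF assms] ys by (simp add: map_snd_sent_log del: milestone.simps)
qed

end

section \<open>Knowledge of a node and the gossip algorithm\<close>

definition block :: "nat \<Rightarrow> msg list" where
  "block k = replicate k [True] @ [[False]]"

text \<open>The accumulator counts the \<open>[True]\<close> messages of the current block. An
  unfinished block at the end yields nothing, so a prefix of a stream decodes only to numbers that
  were really sent.\<close>

fun parse :: "nat \<Rightarrow> msg list \<Rightarrow> nat list" where
  "parse k [] = []"
| "parse k (m # ms) = (if m = [True] then parse (Suc k) ms else k # parse 0 ms)"

lemma parse_replicate: "parse k (replicate j [True] @ ms) = parse (k + j) ms"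
  by (induction j arbitrary: k) auto

lemma parse_blocks: "parse 0 (concat (map block ns) @ ms) = ns @ parse 0 ms"
  by (induction ns) (auto simp: block_def parse_replicate)

lemma parse_mono: "set (parse k ms) \<subseteq> set (parse k (ms @ ms'))"
  by (induction k ms rule: parse.induct) auto

text \<open>A node's neighbors, initial color and events, in the order of their times.\<close>

type_synonym node_info = "nat list \<times> nat \<times> (real \<times> nat) list"
text \<open>A node v, a precision p, and the information on v with times in units of \<open>2 ^ - p\<close>.\<close>

type_synonym fact_item = "nat \<times> nat \<times> nat list \<times> nat \<times> (int \<times> nat) list"

definition rounded :: "nat \<Rightarrow> node_info \<Rightarrow> nat list \<times> nat \<times> (int \<times> nat) list" where
  "rounded p i = (case i of (ns, x, es) \<Rightarrow> (ns, x, map (\<lambda>(t, c). (\<lfloor>2 ^ p * t\<rfloor>, c)) es))"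

definition "nbs I v = fst ((I :: nat \<Rightarrow> node_info) v)"
definition "ini I v = fst (snd ((I :: nat \<Rightarrow> node_info) v))"
definition "evs I v = snd (snd ((I :: nat \<Rightarrow> node_info) v))"

text \<open>\<open>colour I a v m\<close> is the color of v after its first m events if \<open>a v\<close> says which are accepted. A
  pair of I and a that obeys the Metropolis rule stands for a run in a possible network; neither
  finiteness nor symmetry of that network is required.\<close>

primrec colour :: "(nat \<Rightarrow> node_info) \<Rightarrow> (nat \<Rightarrow> nat \<Rightarrow> bool) \<Rightarrow> nat \<Rightarrow> nat \<Rightarrow> nat" where
  "colour I a v 0 = ini I v"
| "colour I a v (Suc m) = (if a v m then snd (evs I v ! m) else colour I a v m)"

definition before :: "(nat \<Rightarrow> node_info) \<Rightarrow> nat \<Rightarrow> nat \<Rightarrow> nat \<Rightarrow> nat" where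
  "before I v i u = length (filter (\<lambda>e. fst e < fst (evs I v ! i)) (evs I u))"

definition metropolis_rule :: "(nat \<Rightarrow> node_info) \<Rightarrow> (nat \<Rightarrow> nat \<Rightarrow> bool) \<Rightarrow> bool" where
  "metropolis_rule I a \<longleftrightarrow> (\<forall>v. \<forall>i<length (evs I v).
     a v i \<longleftrightarrow> (\<forall>u\<in>set (nbs I v). colour I a u (before I v i u) \<noteq> snd (evs I v ! i)))"

definition consistent :: "fact_item set \<Rightarrow> (nat \<Rightarrow> node_info) \<Rightarrow> (nat \<Rightarrow> nat \<Rightarrow> bool) \<Rightarrow> bool" where
  "consistent F I a \<longleftrightarrow> metropolis_rule I a \<and> (\<forall>(v, p, r)\<in>F. rounded p (I v) = r)"

definition apart :: "fact_item set \<Rightarrow> nat \<Rightarrow> nat \<Rightarrow> bool" where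
  "apart F v u \<longleftrightarrow> (\<exists>p ns x es ns' x' es'. (v, p, ns, x, es) \<in> F \<and> (u, p, ns', x', es') \<in> F \<and>
     fst ` set es \<inter> fst ` set es' = {})"

text \<open>\<open>apart\<close> is demanded explicitly since a halted node no longer refines the times it has sent, and
  its neighbors must still be able to order their events relative to its own.\<close>

definition decided :: "fact_item set \<Rightarrow> nat \<Rightarrow> bool" where
  "decided F v \<longleftrightarrow> (\<forall>I a I' a'. consistent F I a \<longrightarrow> consistent F I' a' \<longrightarrow>
     (\<forall>u\<in>set (nbs I v). apart F v u) \<and> (\<forall>i<length (evs I v). a v i = a' v i))"

text \<open>A whole list of facts is one natural number under the countable-type encoding. This is
  possible because facts contain integers instead of real times.\<close>

definition decoded :: "history \<Rightarrow> fact_item list" where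
  "decoded h = concat (map (\<lambda>u. concat (map from_nat (parse 0 (recv u h)))) (map fst h))"

text \<open>All coarser precisions are kept as well: \<open>apart\<close> compares two nodes at a
  common precision, and knowledge has to grow with the history.\<close>

definition known :: "nat \<Rightarrow> node_info \<Rightarrow> history \<Rightarrow> fact_item list" where
  "known v i h = map (\<lambda>p. (v, p, rounded p i)) [0..<Suc (length h)] @ decoded h"

text \<open>The broadcast does not depend on being undecided: the last one carries the very
  knowledge that made the node halt, and its neighbors rely on it.\<close>

definition gossip :: "nat \<Rightarrow> node_info \<Rightarrow> behaviour" where
  "gossip v i h =
     (let F = set (known v i h) in
      (concat (map (\<lambda>w. map (Pair w) (block (to_nat (known v i h)))) (fst i)),
       if decided F v then Some (SOME x. \<exists>I a. consistent F I a \<and> x = colour I a v (length (evs I v)))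
       else None))"

section \<open>Comparison of two consistent networks\<close>

lemma consistentD: "consistent F I a \<Longrightarrow> (v, p, r) \<in> F \<Longrightarrow> rounded p (I v) = r"
  unfolding consistent_def by (elim conjE, drule (1) bspec) (simp only: prod.case)

lemma consistent_subset: "consistent F I a \<Longrightarrow> F' \<subseteq> F \<Longrightarrow> consistent F' I a"
  unfolding consistent_def by (elim conjE) (intro conjI ballI, assumption, drule (1) subsetD, drule (1) bspec)

lemma rounded_eqD:
  assumes "rounded p (I v) = rounded p (I' v)"
  shows "nbs I v = nbs I' v" "ini I v = ini I' v" "length (evs I v) = length (evs I' v)"
    "i < length (evs I v) \<Longrightarrow> snd (evs I v ! i) = snd (evs I' v ! i)"
    "i < length (evs I v) \<Longrightarrow> \<lfloor>2 ^ p * fst (evs I v ! i)\<rfloor> = \<lfloor>2 ^ p * fst (evs I' v ! i)\<rfloor>"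
proof -
  have eq: "map (\<lambda>(t, c). (\<lfloor>2 ^ p * t\<rfloor>, c)) (evs I v) = map (\<lambda>(t, c). (\<lfloor>2 ^ p * t\<rfloor>, c)) (evs I' v)"
    using assms unfolding rounded_def evs_def by (simp split: prod.splits)
  then show len: "length (evs I v) = length (evs I' v)" by (metis length_map)
  show "nbs I v = nbs I' v" "ini I v = ini I' v"
    using assms unfolding rounded_def nbs_def ini_def by (simp_all split: prod.splits)
  show "snd (evs I v ! i) = snd (evs I' v ! i)" "\<lfloor>2 ^ p * fst (evs I v ! i)\<rfloor> = \<lfloor>2 ^ p * fst (evs I' v ! i)\<rfloor>"
    if "i < length (evs I v)"
    using arg_cong[OF eq, of "\<lambda>l. l ! i"] that len by (simp_all split: prod.splits)
qed

lemma floor_less_cases: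
  fixes s t s' t' :: real
  assumes "\<lfloor>2 ^ p * s\<rfloor> = \<lfloor>2 ^ p * s'\<rfloor>" "\<lfloor>2 ^ p * t\<rfloor> = \<lfloor>2 ^ p * t'\<rfloor>" "\<lfloor>2 ^ p * s\<rfloor> \<noteq> \<lfloor>2 ^ p * t\<rfloor>"
  shows "s < t \<longleftrightarrow> s' < t'"
proof -
  have *: "x < y \<longleftrightarrow> \<lfloor>2 ^ p * x\<rfloor> < \<lfloor>2 ^ p * y\<rfloor>" if "\<lfloor>2 ^ p * x\<rfloor> \<noteq> \<lfloor>2 ^ p * y\<rfloor>" for x y :: real
  proof
    assume "x < y"
    then have "\<lfloor>2 ^ p * x\<rfloor> \<le> \<lfloor>2 ^ p * y\<rfloor>" by (intro floor_mono) simp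
    then show "\<lfloor>2 ^ p * x\<rfloor> < \<lfloor>2 ^ p * y\<rfloor>" using that by simp
  next
    assume "\<lfloor>2 ^ p * x\<rfloor> < \<lfloor>2 ^ p * y\<rfloor>"
    then have "2 ^ p * x < 2 ^ p * y" by (meson floor_mono not_le)
    then show "x < y" by simp
  qed
  show ?thesis using *[of s t] *[of s' t'] assms by simp
qed

lemma length_filter_cong:
  assumes "length xs = length ys" "\<And>i. i < length xs \<Longrightarrow> P (xs ! i) \<longleftrightarrow> Q (ys ! i)"
  shows "length (filter P xs) = length (filter Q ys)"
  using assms(2) by (simp add: length_filter_conv_card assms(1) cong: conj_cong)

text \<open>At the common precision no event of v shares its rounded time with an event of u, so the
  integers known to both networks already fix the order.\<close>

lemma before_cong:
  assumes F: "apart F v u" and "consistent F I a" "consistent F I' a'" "i < length (evs I v)"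
  shows "before I v i u = before I' v i u"
proof -
  obtain p ns x es ns' x' es' where p: "(v, p, ns, x, es) \<in> F" "(u, p, ns', x', es') \<in> F"
    "fst ` set es \<inter> fst ` set es' = {}" using F unfolding apart_def by blast
  have rv: "rounded p (I v) = (ns, x, es)" "rounded p (I' v) = (ns, x, es)"
    and ru: "rounded p (I u) = (ns', x', es')" "rounded p (I' u) = (ns', x', es')"
    using consistentD[OF assms(2)] consistentD[OF assms(3)] p(1,2) by auto
  have es: "es = map (\<lambda>(t, c). (\<lfloor>2 ^ p * t\<rfloor>, c)) (evs I v)" "es' = map (\<lambda>(t, c). (\<lfloor>2 ^ p * t\<rfloor>, c)) (evs I u)"
    using rv ru unfolding rounded_def evs_def by (auto split: prod.splits)
  have eqv: "rounded p (I v) = rounded p (I' v)" and equ: "rounded p (I u) = rounded p (I' u)"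
    by (simp_all only: rv ru)
  note v = rounded_eqD[of p I v I', OF eqv] and u = rounded_eqD[of p I u I', OF equ]
  show ?thesis unfolding before_def
  proof (rule length_filter_cong)
    show "length (evs I u) = length (evs I' u)" by (rule u(3))
    fix j assume j: "j < length (evs I u)"
    have "fst ` set es = (\<lambda>e. \<lfloor>2 ^ p * fst e\<rfloor>) ` set (evs I v)"
      "fst ` set es' = (\<lambda>e. \<lfloor>2 ^ p * fst e\<rfloor>) ` set (evs I u)"
      unfolding es set_map image_image by (auto intro!: image_cong)
    then have "\<lfloor>2 ^ p * fst (evs I v ! i)\<rfloor> \<in> fst ` set es" "\<lfloor>2 ^ p * fst (evs I u ! j)\<rfloor> \<in> fst ` set es'"
      using j assms(4) by auto
    then have "\<lfloor>2 ^ p * fst (evs I u ! j)\<rfloor> \<noteq> \<lfloor>2 ^ p * fst (evs I v ! i)\<rfloor>" using p(3) by (metis IntI empty_iff)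
    then show "fst (evs I u ! j) < fst (evs I v ! i) \<longleftrightarrow> fst (evs I' u ! j) < fst (evs I' v ! i)"
      by (intro floor_less_cases[of p]) (use u(5)[of j] v(5)[of i] j assms(4) in simp_all)
  qed
qed

text \<open>The colour held when the decisions first differ is common to both processes, so a link
  constrains only the colours of the first one.\<close>

lemma colour_disagreement:
  assumes "ini I u = ini I' u"
    and "\<And>j. j < m \<Longrightarrow> snd (evs I u ! j) = snd (evs I' u ! j)"
    and "(colour I a u m = c) \<noteq> (colour I' a' u m = c)"
  shows "\<exists>j<m. a u j \<noteq> a' u j \<and> (snd (evs I u ! j) = c \<or> colour I a u j = c)"
  using assms(2,3)
proof (induction m)
  case (Suc m)
  show ?case
  proof (cases "a u m \<noteq> a' u m \<and> (snd (evs I u ! m) = c \<or> colour I a u m = c)")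
    case False
    then have "(colour I a u m = c) \<noteq> (colour I' a' u m = c)"
      using Suc.prems(1)[of m] Suc.prems(2) by (auto split: if_splits)
    then show ?thesis using Suc.IH Suc.prems(1) less_SucI by blast
  qed auto
qed (use assms(1) in simp)

text \<open>One link of the backward chain. By \<open>apart\<close> both networks see the same
  number of earlier events of u, so the colors of u can be compared event by event, and
  \<open>colour_disagreement\<close> finds where they part.\<close>

lemma decision_disagreement:
  assumes "consistent F I a" "consistent F I' a'" "i < length (evs I v)" "a v i \<noteq> a' v i"
    and own: "(v, p, r) \<in> F"
    and nbrs: "\<And>u. u \<in> set (nbs I v) \<Longrightarrow> apart F v u"
  shows "\<exists>u\<in>set (nbs I v). \<exists>j<before I v i u. a u j \<noteq> a' u j \<and>
    (snd (evs I u ! j) = snd (evs I v ! i) \<or> colour I a u j = snd (evs I v ! i))"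
proof -
  let ?c = "snd (evs I v ! i)"
  have eqv: "rounded p (I v) = rounded p (I' v)" 
    using consistentD[OF assms(1) own] consistentD[OF assms(2) own] by simp
  note v = rounded_eqD[of p I v I', OF eqv]
  have "a v i \<longleftrightarrow> (\<forall>u\<in>set (nbs I v). colour I a u (before I v i u) \<noteq> ?c)"
    using assms(1,3) unfolding consistent_def metropolis_rule_def by blast
  moreover have "a' v i \<longleftrightarrow> (\<forall>u\<in>set (nbs I v). colour I' a' u (before I' v i u) \<noteq> ?c)"
    using assms(2,3) v unfolding consistent_def metropolis_rule_def by metis
  ultimately obtain u where u: "u \<in> set (nbs I v)"
    "(colour I a u (before I v i u) = ?c) \<noteq> (colour I' a' u (before I' v i u) = ?c)"
    using assms(4) by blast
  have b: "before I v i u = before I' v i u" using before_cong nbrs u(1) assms by blast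
  obtain p' ru where "(u, p', ru) \<in> F" using nbrs[OF u(1)] unfolding apart_def by blast
  then have equ: "rounded p' (I u) = rounded p' (I' u)" 
    using consistentD[OF assms(1)] consistentD[OF assms(2)] by metis
  have "before I v i u \<le> length (evs I u)" unfolding before_def by simp
  then have "\<exists>j<before I v i u. a u j \<noteq> a' u j \<and> (snd (evs I u ! j) = ?c \<or> colour I a u j = ?c)"
    using rounded_eqD[of p' I u I', OF equ] u(2) b
    by (intro colour_disagreement[of I u I' "before I v i u" a ?c a']) auto
  then show ?thesis using u(1) by blast
qed

lemma colour_cong:
  assumes "ini I v = ini I' v" "\<And>j. j < m \<Longrightarrow> snd (evs I v ! j) = snd (evs I' v ! j)"
    "\<And>j. j < m \<Longrightarrow> a v j = a' v j"
  shows "colour I a v m = colour I' a' v m"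
  using assms(2,3) by (induction m) (simp_all add: assms(1))

text \<open>All consistent runs agree on the decisions of v, hence on its final color, so the choice
  by \<open>SOME\<close> is forced. As the true run is one of them, a returned value is always the
  right one, whenever the node halts.\<close>

lemma gossip_returned:
  assumes "consistent (set (known v i h)) I a" "snd (gossip v i h) \<noteq> None"
  shows "snd (gossip v i h) = Some (colour I a v (length (evs I v)))"
proof -
  let ?F = "set (known v i h)"
  have own: "(v, 0, rounded 0 i) \<in> ?F" by (auto simp: known_def image_iff)
  have dec: "decided ?F v" using assms(2) by (auto simp: gossip_def Let_def split: if_splits)
  have "colour I' a' v (length (evs I' v)) = colour I a v (length (evs I v))" if "consistent ?F I' a'" for I' a'
  proof -
    have "rounded 0 (I v) = rounded 0 (I' v)"
      using consistentD[OF assms(1) own] consistentD[OF that own] by simp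
    note v = rounded_eqD[of 0 I v I', OF this]
    have "\<forall>i<length (evs I v). a v i = a' v i" using dec assms(1) that unfolding decided_def by blast
    then have "colour I a v (length (evs I v)) = colour I' a' v (length (evs I v))"
      using v(2,4) by (intro colour_cong) auto
    then show ?thesis using v(3) by simp
  qed
  note same = this
  have "(SOME x. \<exists>I a. consistent ?F I a \<and> x = colour I a v (length (evs I v))) =
      colour I a v (length (evs I v))"
  proof (rule some_equality)
    show "\<exists>J b. consistent ?F J b \<and> colour I a v (length (evs I v)) = colour J b v (length (evs J v))"
      using assms(1) by (intro exI[of _ I] exI[of _ a]) simp
    fix x assume "\<exists>J b. consistent ?F J b \<and> x = colour J b v (length (evs J v))"
    then show "x = colour I a v (length (evs I v))" by (elim exE conjE) (simp only: same)
  qed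
  then show ?thesis using dec by (simp add: gossip_def Let_def)
qed

section \<open>Termination of the gossip algorithm\<close>

lemma recv_take: "\<exists>ys. recv u h = recv u (take k h) @ ys"
  unfolding recv_def by (metis append_take_drop_id filter_append map_append)

lemma mem_decoded: "f \<in> set (decoded h) \<longleftrightarrow> (\<exists>u n. n \<in> set (parse 0 (recv u h)) \<and> f \<in> set (from_nat n))"
proof -
  have "u \<in> fst ` set h" if "n \<in> set (parse 0 (recv u h))" for u n
  proof (rule ccontr)
    assume "u \<notin> fst ` set h"
    then have "recv u h = []" unfolding recv_def by (auto simp: filter_empty_conv)
    then show False using that by simp
  qed
  then show ?thesis unfolding decoded_def by auto blast
qed

lemma apart_sym: "apart F u v \<Longrightarrow> apart F v u"
  unfolding apart_def
  by (elim exE conjE, intro exI conjI, assumption, assumption, subst Int_commute)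

lemma apart_subset: "apart F v u \<Longrightarrow> F \<subseteq> F' \<Longrightarrow> apart F' v u"
  unfolding apart_def
  by (elim exE conjE, intro exI conjI, erule (1) subsetD[rotated], erule (1) subsetD[rotated])

lemma apartI:
  "(v, p, r) \<in> F \<Longrightarrow> (u, p, r') \<in> F \<Longrightarrow> fst ` set (snd (snd r)) \<inter> fst ` set (snd (snd r')) = {} \<Longrightarrow> apart F v u"
  unfolding apart_def by (cases r, cases r') (simp only: fst_conv snd_conv, intro exI conjI)

lemma set_known: "set (known v i h) = (\<lambda>p. (v, p, rounded p i)) ` {..length h} \<union> set (decoded h)"
  unfolding known_def set_append set_map set_upt by (simp only: lessThan_Suc_atMost flip: lessThan_atLeast0)

lemma known_mono: "set (known v i (take k h)) \<subseteq> set (known v i h)"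
proof -
  have "set (decoded (take k h)) \<subseteq> set (decoded h)"
  proof
    fix f assume "f \<in> set (decoded (take k h))"
    then obtain u n where un: "n \<in> set (parse 0 (recv u (take k h)))" "f \<in> set (from_nat n)"
      unfolding mem_decoded by blast
    obtain ys where "recv u h = recv u (take k h) @ ys" using recv_take by blast
    then have "n \<in> set (parse 0 (recv u h))" using un(1) parse_mono[of 0 "recv u (take k h)" ys] by auto
    then show "f \<in> set (decoded h)" unfolding mem_decoded using un(2) by blast
  qed
  then show ?thesis unfolding set_known by auto
qed

lemma own_known: "p \<le> length h \<Longrightarrow> (v, p, rounded p i) \<in> set (known v i h)"
  by (auto simp: set_known)

lemma map_snd_outgoing_filter:
  "w \<in> nbhd E u \<Longrightarrow> map snd (outgoing E B t u h w) = map snd (filter (\<lambda>e. fst e = w) (fst (B u h)))"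
proof -
  have "map snd (concat (map (\<lambda>(w', m). if w' = w then [(t, m)] else []) xs)) =
      map snd (filter (\<lambda>e. fst e = w) xs)" for xs :: "(nat \<times> msg) list"
    by (induction xs) auto
  then show "w \<in> nbhd E u \<Longrightarrow> ?thesis" by (simp add: outgoing_def)
qed

lemma filter_broadcast:
  "distinct ws \<Longrightarrow> map snd (filter (\<lambda>e. fst e = w) (concat (map (\<lambda>w'. map (Pair w') ms) ws))) =
     (if w \<in> set ws then ms else [])"
proof (induction ws)
  case (Cons x ws)
  then show ?case by (cases "x = w") (auto simp: filter_map comp_def)
qed simp

text \<open>The link condition mentions only the true run and no hypothetical network. Existence of
  long chains is therefore a property of the coins, untouched by the schedule.\<close>

inductive chain :: "(nat \<Rightarrow> node_info) \<Rightarrow> (nat \<Rightarrow> nat \<Rightarrow> bool) \<Rightarrow> nat \<Rightarrow> nat \<Rightarrow> nat \<Rightarrow> bool"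
  for I a where
  chain_0: "i < length (evs I v) \<Longrightarrow> chain I a 0 v i"
| chain_Suc: "chain I a n u j \<Longrightarrow> u \<in> set (nbs I v) \<Longrightarrow> i < length (evs I v) \<Longrightarrow> j < before I v i u \<Longrightarrow>
    snd (evs I u ! j) = snd (evs I v ! i) \<or> colour I a u j = snd (evs I v ! i) \<Longrightarrow> chain I a (Suc n) v i"

definition separated :: "(nat \<Rightarrow> node_info) \<Rightarrow> nat \<Rightarrow> bool" where
  "separated I p \<longleftrightarrow> (\<forall>v. \<forall>u\<in>set (nbs I v).
     (\<lambda>e. \<lfloor>2 ^ p * fst e\<rfloor>) ` set (evs I v) \<inter> (\<lambda>e. \<lfloor>2 ^ p * fst e\<rfloor>) ` set (evs I u) = {})"

locale gossip_execution =
  fixes V :: "nat set" and E :: "nat set set" and \<sigma> :: schedule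
    and I :: "nat \<Rightarrow> node_info" and a :: "nat \<Rightarrow> nat \<Rightarrow> bool"
  assumes gossip_graph: "simple_graph V E"
    and gossip_adm: "admissible E (\<lambda>v. gossip v (I v)) \<sigma>"
    and nbs: "\<And>v. nbs I v = sorted_list_of_set (nbhd E v)"
    and rule: "metropolis_rule I a"
begin

sublocale execution V E "\<lambda>v. gossip v (I v)" \<sigma>
  by unfold_locales (rule gossip_graph gossip_adm)+

abbreviation "B \<equiv> \<lambda>v. gossip v (I v)"
abbreviation "K i v \<equiv> set (known v (I v) (hist (R i) v))"

lemma finite_nbhd: "finite (nbhd E v)"
  using gossip_graph nbhd_imp(1)[OF gossip_graph] by (meson finite_subset simple_graph_def subsetI)

lemma set_nbs: "set (nbs I v) = nbhd E v"
  using finite_nbhd by (simp add: nbs)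

lemma stream_gossip:
  assumes "w \<in> nbhd E u"
  shows "stream E B u w h =
    concat (map block (map (\<lambda>k. to_nat (known u (I u) (take k h))) [0..<Suc (length h)]))"
proof -
  have "fst (I u) = sorted_list_of_set (nbhd E u)" using nbs[of u] by (simp add: nbs_def)
  then have "map snd (outgoing E B 0 u h' w) = block (to_nat (known u (I u) h'))" for h'
    using assms filter_broadcast[of "sorted_list_of_set (nbhd E u)" w "block (to_nat (known u (I u) h'))"] finite_nbhd
    by (simp add: map_snd_outgoing_filter gossip_def Let_def)
  then show ?thesis unfolding stream_def map_map comp_def by simp
qed

text \<open>Induction over the steps: whatever a complete block decodes to was the knowledge of its
  sender at some prefix of the sender's history.\<close>

lemma known_true: "(w, p, r) \<in> K i v \<Longrightarrow> rounded p (I w) = r"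
proof (induction i arbitrary: v w p r)
  case 0
  then have "(w, p, r) = (v, 0, rounded 0 (I v))"
    by (simp add: known_def decoded_def init_config_def)
  then show ?case by simp
next
  case (Suc i)
  obtain x y t where s: "\<sigma> i = (x, y, t)" by (metis prod_cases3)
  show ?case
  proof (cases "hist (R (Suc i)) v = hist (R i) v")
    case True
    then show ?thesis using Suc by metis
  next
    case False
    then have v: "v = y" "chan (R i) x v \<noteq> []" by (auto simp: s hist_deliver split: if_splits)
    have "x \<in> nbhd E v"
    proof (rule ccontr)
      assume "x \<notin> nbhd E v"
      then have "map snd (logs i x v) = []" using nbhd_sym by (metis map_snd_sent_log stream_not_nbhd)
      then have "logs i x v = []" by simp
      then show False using v(2) by (simp add: chan_eq_drop)
    qed
    then have xv: "x \<noteq> v" using nbhd_imp gossip_graph by blast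
    consider "w = v \<and> r = rounded p (I v)" | "(w, p, r) \<in> set (decoded (hist (R (Suc i)) v))"
      using Suc.prems unfolding set_known by auto
    then show ?thesis
    proof cases
      case 2
      then obtain u n where un: "n \<in> set (parse 0 (recv u (hist (R (Suc i)) v)))" "(w, p, r) \<in> set (from_nat n)"
        unfolding mem_decoded by blast
      obtain ys where ys: "stream E B u v (hist (R (Suc i)) u) = recv u (hist (R (Suc i)) v) @ ys"
        using recv_stream by blast
      have vu: "v \<in> nbhd E u"
        using ys un(1) stream_not_nbhd by (cases "v \<in> nbhd E u") fastforce+
      then have "u \<noteq> v" using nbhd_imp gossip_graph by blast
      \<comment> \<open>The sender differs from the receiver, so its history is unchanged in this
        step and the induction hypothesis for \<open>i\<close> covers it.\<close>
      then have hu: "hist (R (Suc i)) u = hist (R i) u" using v by (auto simp: s hist_deliver)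
      let ?ns = "map (\<lambda>k. to_nat (known u (I u) (take k (hist (R i) u)))) [0..<Suc (length (hist (R i) u))]"
      have "n \<in> set (parse 0 (recv u (hist (R (Suc i)) v) @ ys))" using un(1) parse_mono by blast
      then have "n \<in> set (parse 0 (concat (map block ?ns) @ []))"
        using ys stream_gossip[OF vu] hu by simp
      then have "n \<in> set ?ns" unfolding parse_blocks by simp
      then obtain k where "n = to_nat (known u (I u) (take k (hist (R i) u)))"
        by (auto simp del: upt_Suc)
      then have "(w, p, r) \<in> set (known u (I u) (take k (hist (R i) u)))" using un(2) by simp
      then show ?thesis using known_mono Suc.IH by blast
    qed auto
  qed
qed

lemma consistent_true: "consistent (K i v) I a"
  unfolding consistent_def
proof (intro conjI rule ballI)
  fix f assume "f \<in> K i v"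
  moreover obtain w p r where "f = (w, p, r)" by (metis prod_cases3)
  ultimately show "case f of (v, p, r) \<Rightarrow> rounded p (I v) = r" using known_true by simp
qed

lemma milestone_known:
  assumes "returned B (R (milestone (Suc k))) v = None" "u \<in> nbhd E v"
  shows "K (milestone k) u \<subseteq> K (milestone (Suc k)) v"
    and "length (hist (R (milestone k)) u) < length (hist (R (milestone (Suc k))) v)"
proof -
  let ?h = "hist (R (milestone k)) u" and ?h' = "hist (R (milestone (Suc k))) v"
  obtain ys where ys: "recv u ?h' = stream E B u v ?h @ ys" using recv_milestone[OF assms(1)] by blast
  have vu: "v \<in> nbhd E u" using assms(2) nbhd_sym by blast
  let ?ns = "map (\<lambda>k. to_nat (known u (I u) (take k ?h))) [0..<Suc (length ?h)]"
  have recv: "recv u ?h' = concat (map block ?ns) @ ys" using ys stream_gossip[OF vu] by simp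
  have "to_nat (known u (I u) (take (length ?h) ?h)) \<in> set ?ns" 
    unfolding set_map by (rule imageI) simp
  then have "to_nat (known u (I u) ?h) \<in> set (parse 0 (recv u ?h'))"
    unfolding recv parse_blocks by simp
  note sent = this
  have "set (known u (I u) ?h) \<subseteq> set (decoded ?h')"
  proof
    fix f assume "f \<in> set (known u (I u) ?h)"
    then have "f \<in> set (from_nat (to_nat (known u (I u) ?h)))" by (simp only: from_nat_to_nat)
    then show "f \<in> set (decoded ?h')" unfolding mem_decoded by (intro exI conjI) (rule sent)
  qed
  then show "K (milestone k) u \<subseteq> K (milestone (Suc k)) v" unfolding set_known[of v] by auto
  \<comment> \<open>The stream holds one nonempty block for each prefix of the history of u, the
    empty prefix included, hence more messages than u has received.\<close>
  have "length ns \<le> length (concat (map block ns))" for ns by (induction ns) (auto simp: block_def)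
  from this[of ?ns] have "length ?h < length (recv u ?h')" unfolding recv by simp
  also have "\<dots> \<le> length ?h'" unfolding recv_def by simp
  finally show "length ?h < length ?h'" .
qed

abbreviation "live k v \<equiv> returned B (R (milestone k)) v = None"
abbreviation "KM k v \<equiv> K (milestone k) v"

lemma live_iff: "live k v \<longleftrightarrow> \<not> decided (KM k v) v"
  by (simp add: returned_def gossip_def Let_def)

lemma own_KM: "(v, 0, rounded 0 (I v)) \<in> KM k v"
  by (rule own_known) simp

lemma halted_apart:
  assumes "\<not> live k u" "v \<in> nbhd E u"
  shows "apart (KM k u) v u"
proof -
  have "apart (KM k u) u v"
    using assms consistent_true set_nbs unfolding live_iff decided_def by blast
  then show ?thesis by (rule apart_sym)
qed

lemma halted_agree:
  assumes "\<not> live k u" "consistent F I' a'" "KM k u \<subseteq> F" "j < length (evs I u)"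
  shows "a u j = a' u j"
  using assms consistent_true[where i = "milestone k" and v = u] consistent_subset[OF assms(2,3)]
  unfolding live_iff decided_def by blast

text \<open>If all neighbors had halted by milestone k, their knowledge would have reached v and
  fixed all their decisions and the order of events, so a disagreement at v would have no neighbor
  to come from. The lemma keeps histories, and with them precision, growing.\<close>

lemma live_neighbour:
  assumes "live (Suc k) v"
  shows "\<exists>u\<in>nbhd E v. live k u"
proof (rule ccontr)
  assume *: "\<not> (\<exists>u\<in>nbhd E v. live k u)"
  have sub: "KM k u \<subseteq> KM (Suc k) v" if "u \<in> nbhd E v" for u
    using milestone_known(1)[OF assms that] .
  have ap: "apart (KM (Suc k) v) v u" if "u \<in> nbhd E v" for u
    by (rule apart_subset[OF halted_apart sub[OF that]]) (use * that nbhd_sym[of u E v] in simp_all)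
  have agree: "a v i = a' v i" if c: "consistent (KM (Suc k) v) I' a'" and i: "i < length (evs I v)" for I' a' i
  proof (rule ccontr)
    assume ne: "a v i \<noteq> a' v i"
    have "\<exists>u\<in>set (nbs I v). \<exists>j<before I v i u. a u j \<noteq> a' u j \<and>
      (snd (evs I u ! j) = snd (evs I v ! i) \<or> colour I a u j = snd (evs I v ! i))"
      using ap set_nbs by (intro decision_disagreement[OF consistent_true c i ne own_KM]) auto
    then obtain u j where u: "u \<in> nbhd E v" "j < before I v i u" "a u j \<noteq> a' u j" using set_nbs by auto
    have "before I v i u \<le> length (evs I u)" unfolding before_def by simp
    then show False using halted_agree[OF _ c sub[OF u(1)], of j] u * by auto
  qed
  have own: "nbs I' v = nbs I v" "length (evs I' v) = length (evs I v)" if "consistent (KM (Suc k) v) I' a'" for I' a'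
    using rounded_eqD(1,3)[of 0 I' v I] consistentD[OF that own_KM] by auto
  have "decided (KM (Suc k) v) v"
    unfolding decided_def
  proof (intro allI impI)
    fix I1 a1 I2 a2 assume c: "consistent (KM (Suc k) v) I1 a1" "consistent (KM (Suc k) v) I2 a2"
    show "(\<forall>u\<in>set (nbs I1 v). apart (KM (Suc k) v) v u) \<and> (\<forall>i<length (evs I1 v). a1 v i = a2 v i)"
      using own[OF c(1)] ap agree[OF c(1)] agree[OF c(2)] set_nbs by simp
  qed
  then show False using assms live_iff by blast
qed

text \<open>Following live neighbors back to the start gives k steps, each of which lengthens the
  history by at least one message. Hence a node live at milestone k knows its own times to precision
  k.\<close>

lemma length_hist: "live k v \<Longrightarrow> k \<le> length (hist (R (milestone k)) v)"
proof (induction k arbitrary: v)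
  case (Suc k)
  obtain u where "u \<in> nbhd E v" "live k u" using live_neighbour[OF Suc.prems] by blast
  then show ?case using Suc.IH[of u] milestone_known(2)[OF Suc.prems, of u] by simp
qed simp

text \<open>Two reasons: a neighbor live at milestone k has already sent its times at precision p,
  and a halted one could halt only with facts that set its events apart from those of v.\<close>

lemma live_apart:
  assumes "live (Suc k) v" "separated I p" "p \<le> k" "u \<in> nbhd E v"
  shows "apart (KM (Suc k) v) v u"
proof (cases "live k u")
  case True
  have "(u, p, rounded p (I u)) \<in> KM k u" using length_hist[OF True] assms(3) by (intro own_known) simp
  then have u: "(u, p, rounded p (I u)) \<in> KM (Suc k) v" using milestone_known(1) assms by blast
  have v: "(v, p, rounded p (I v)) \<in> KM (Suc k) v"
    using length_hist[OF assms(1)] assms(3) by (intro own_known) simp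
  have "fst ` set (snd (snd (rounded p (I w)))) = (\<lambda>e. \<lfloor>2 ^ p * fst e\<rfloor>) ` set (evs I w)" for w
    unfolding rounded_def evs_def by (auto simp: image_image split: prod.splits intro!: image_cong)
  then have "fst ` set (snd (snd (rounded p (I v)))) \<inter> fst ` set (snd (snd (rounded p (I u)))) = {}"
    using assms(2,4) set_nbs unfolding separated_def by metis
  then show ?thesis using u v by (intro apartI)
next
  case False
  moreover have "v \<in> nbhd E u" using assms(4) nbhd_sym by blast
  ultimately show ?thesis by (rule apart_subset[OF halted_apart milestone_known(1)[OF assms(1,4)]])
qed

text \<open>The first p milestones serve to reach a separating precision; each later one contributes
  a link, because a neighbor that disagrees cannot have halted one milestone earlier.\<close>

lemma disagreement_chain:
  assumes "separated I p" "live (p + n) v" "consistent (KM (p + n) v) I' a'"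
    "i < length (evs I v)" "a v i \<noteq> a' v i"
  shows "chain I a n v i"
  using assms(2-5)
proof (induction n arbitrary: v i)
  case 0
  then show ?case by (intro chain_0)
next
  case (Suc n)
  have live: "live (Suc (p + n)) v" and c: "consistent (KM (Suc (p + n)) v) I' a'"
    using Suc.prems(1,2) by (simp_all only: add_Suc_right)
  have ap: "apart (KM (Suc (p + n)) v) v u" if "u \<in> set (nbs I v)" for u
    using that set_nbs live_apart[OF live assms(1), of u] by simp
  obtain u j where u: "u \<in> set (nbs I v)" "j < before I v i u" "a u j \<noteq> a' u j"
    "snd (evs I u ! j) = snd (evs I v ! i) \<or> colour I a u j = snd (evs I v ! i)"
    using decision_disagreement[OF consistent_true c Suc.prems(3,4) own_KM ap] by blast
  have sub: "KM (p + n) u \<subseteq> KM (Suc (p + n)) v" using milestone_known(1)[OF live, of u] u(1) set_nbs by blast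
  have j: "j < length (evs I u)" using u(2) unfolding before_def by (meson length_filter_le less_le_trans)
  have "live (p + n) u" using halted_agree[OF _ c sub j] u(3) by blast
  then have "chain I a n u j" using Suc.IH consistent_subset[OF c sub] j u(3) by blast
  then show ?case using u Suc.prems(3) by (intro chain_Suc)
qed

lemma all_returned:
  assumes "separated I p" "\<And>v i. \<not> chain I a (Suc n) v i"
  shows "returned B (R (milestone (p + Suc n))) v \<noteq> None"
proof
  assume live: "live (p + Suc n) v"
  let ?F = "KM (p + Suc n) v"
  have agree: "a v i = a' v i" if "consistent ?F I' a'" "i < length (evs I v)" for I' a' i
    using disagreement_chain[OF assms(1) live that] assms(2) by blast
  have ap: "apart ?F v u" if "u \<in> nbhd E v" for u
    using live_apart[of "p + n" v p u] live assms(1) that by (simp del: milestone.simps)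
  have own: "nbs I' v = nbs I v" "length (evs I' v) = length (evs I v)" if "consistent ?F I' a'" for I' a'
    using rounded_eqD(1,3)[of 0 I' v I] consistentD[OF that own_KM] by auto
  have "decided ?F v"
    unfolding decided_def
  proof (intro allI impI)
    fix I1 a1 I2 a2 assume c: "consistent ?F I1 a1" "consistent ?F I2 a2"
    show "(\<forall>u\<in>set (nbs I1 v). apart ?F v u) \<and> (\<forall>i<length (evs I1 v). a1 v i = a2 v i)"
      using own[OF c(1)] ap agree[OF c(1)] agree[OF c(2)] set_nbs by simp
  qed
  then show False using live live_iff by blast
qed

lemma returned_value:
  "returned B (R i) v \<noteq> None \<Longrightarrow> returned B (R i) v = Some (colour I a v (length (evs I v)))"
  unfolding returned_def using consistent_true by (rule gossip_returned)

end

section \<open>The chain in the order of the event times\<close>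

definition update :: "nat set set \<Rightarrow> nat \<times> nat \<Rightarrow> (nat \<Rightarrow> nat) \<Rightarrow> nat \<Rightarrow> nat" where
  "update E w x = (if snd w \<notin> x ` nbhd E (fst w) then x(fst w := snd w) else x)"

primrec trajectory :: "nat set set \<Rightarrow> (nat \<Rightarrow> nat) \<Rightarrow> (nat \<Rightarrow> nat \<times> nat) \<Rightarrow> nat \<Rightarrow> nat \<Rightarrow> nat" where
  "trajectory E x0 W 0 = x0"
| "trajectory E x0 W (Suc k) = update E (W k) (trajectory E x0 W k)"

text \<open>\<open>chain\<close> in the global order of updates. In this form it is a property of
  the proposal sequence alone, so it can be counted over all sequences.\<close>

inductive global_chain :: "nat set set \<Rightarrow> (nat \<Rightarrow> nat) \<Rightarrow> (nat \<Rightarrow> nat \<times> nat) \<Rightarrow> nat \<Rightarrow> nat \<Rightarrow> bool"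
  for E x0 W where
  global_chain_0: "global_chain E x0 W 0 k"
| global_chain_Suc: "global_chain E x0 W n j \<Longrightarrow> j < k \<Longrightarrow> fst (W j) \<in> nbhd E (fst (W k)) \<Longrightarrow>
    snd (W k) = snd (W j) \<or> snd (W k) = trajectory E x0 W j (fst (W j)) \<Longrightarrow>
    global_chain E x0 W (Suc n) k"

lemma filter_sorted_take:
  fixes G :: "('a::linorder \<times> 'b) list"
  assumes "sorted_wrt (<) (map fst G)" "k < length G"
  shows "filter (\<lambda>e. fst e < fst (G ! k)) G = take k G"
proof -
  have lt: "fst (G ! i) < fst (G ! j)" if "i < j" "j < length G" for i j
    using assms(1) that by (simp add: sorted_wrt_iff_nth_less)
  have "\<forall>e\<in>set (take k G). fst e < fst (G ! k)"
  proof
    fix e assume "e \<in> set (take k G)"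
    then obtain i where "i < k" "e = G ! i" using assms(2) unfolding in_set_conv_nth by auto
    then show "fst e < fst (G ! k)" using lt assms(2) by simp
  qed
  then have "filter (\<lambda>e. fst e < fst (G ! k)) (take k G) = take k G"
    by (simp add: filter_id_conv)
  moreover have "filter (\<lambda>e. fst e < fst (G ! k)) (drop k G) = []"
  proof -
    have "\<not> fst (drop k G ! i) < fst (G ! k)" if "i < length G - k" for i
    proof (cases "i = 0")
      case False
      then have "fst (G ! k) < fst (G ! (k + i))" using that by (intro lt) auto
      then show ?thesis using that assms(2) by simp
    qed (use assms(2) in simp)
    note notless = this
    have "\<not> fst e < fst (G ! k)" if e: "e \<in> set (drop k G)" for e
    proof -
      obtain i where "i < length (drop k G)" "drop k G ! i = e" using e unfolding in_set_conv_nth by (elim exE conjE)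
      then show ?thesis using notless[of i] by (simp only: length_drop) simp
    qed
    then show ?thesis by (simp add: filter_empty_conv del: nth_drop)
  qed
  ultimately show ?thesis
    using filter_append[of "\<lambda>e. fst e < fst (G ! k)" "take k G" "drop k G"] by simp
qed

text \<open>G merges the events of all nodes as (time, vertex, color). W is infinite and tied to G
  only on the length of G; beyond that it drives the continued chain.\<close>

locale timeline =
  fixes V :: "nat set" and E :: "nat set set" and x0 :: "nat \<Rightarrow> nat"
    and G :: "(real \<times> nat \<times> nat) list" and W :: "nat \<Rightarrow> nat \<times> nat" and I :: "nat \<Rightarrow> node_info"
  assumes graph: "simple_graph V E"
    and sorted: "sorted_wrt (<) (map fst G)"
    and W: "\<And>k. k < length G \<Longrightarrow> W k = snd (G ! k)"
    and nbs: "\<And>v. nbs I v = sorted_list_of_set (nbhd E v)"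
    and ini: "\<And>v. v \<in> V \<Longrightarrow> ini I v = x0 v"
    and evs: "\<And>v. v \<in> V \<Longrightarrow> evs I v = map (\<lambda>e. (fst e, snd (snd e))) (filter (\<lambda>e. fst (snd e) = v) G)"
begin

abbreviation "X \<equiv> trajectory E x0 W"

text \<open>Dictionary between global and local indices: if step k updates v, then it is event
  \<open>cnt v k\<close> of v.\<close>

definition cnt :: "nat \<Rightarrow> nat \<Rightarrow> nat" where
  "cnt v k = length (filter (\<lambda>e. fst (snd e) = v) (take k G))"

text \<open>\<open>metropolis_rule\<close> speaks about all natural numbers. Outside V the events
  are unconstrained, but there are no neighbors, so acceptance is the value that satisfies the
  rule.\<close>

definition acc :: "nat \<Rightarrow> nat \<Rightarrow> bool" where
  "acc v i \<longleftrightarrow> v \<notin> V \<or> (\<exists>k<length G. fst (W k) = v \<and> cnt v k = i \<and> snd (W k) \<notin> X k ` nbhd E v)"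

lemma set_nbs: "set (nbs I v) = nbhd E v"
proof -
  have "finite (nbhd E v)"
    using graph nbhd_imp(1)[OF graph] by (meson finite_subset simple_graph_def subsetI)
  then show ?thesis by (simp add: nbs)
qed

lemma cnt_0: "cnt v 0 = 0"
  by (simp add: cnt_def)

lemma cnt_Suc: "k < length G \<Longrightarrow> cnt v (Suc k) = cnt v k + (if fst (W k) = v then 1 else 0)"
  by (simp add: cnt_def take_Suc_conv_app_nth W)

lemma cnt_mono: "j \<le> k \<Longrightarrow> k \<le> length G \<Longrightarrow> cnt v j \<le> cnt v k"
  by (induction k rule: dec_induct) (auto simp: cnt_Suc)

lemma cnt_less:
  assumes "j < k" "k \<le> length G" "fst (W j) = v"
  shows "cnt v j < cnt v k"
  using cnt_mono[of "Suc j" k v] cnt_Suc[of j v] assms by simp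

lemma evs_cnt:
  assumes "k < length G" "fst (W k) = v" "v \<in> V"
  shows "cnt v k < length (evs I v)" "evs I v ! cnt v k = (fst (G ! k), snd (W k))"
proof -
  have "G = take k G @ G ! k # drop (Suc k) G" using assms(1) by (simp add: id_take_nth_drop)
  then have "filter (\<lambda>e. fst (snd e) = v) G =
      filter (\<lambda>e. fst (snd e) = v) (take k G @ G ! k # drop (Suc k) G)" by (rule arg_cong)
  also have "\<dots> = filter (\<lambda>e. fst (snd e) = v) (take k G) @
    G ! k # filter (\<lambda>e. fst (snd e) = v) (drop (Suc k) G)"
    using assms(1,2) W[of k] by simp
  finally have ev: "evs I v = map (\<lambda>e. (fst e, snd (snd e))) (filter (\<lambda>e. fst (snd e) = v) (take k G)) @
    (fst (G ! k), snd (snd (G ! k))) # map (\<lambda>e. (fst e, snd (snd e))) (filter (\<lambda>e. fst (snd e) = v) (drop (Suc k) G))"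
    unfolding evs[OF assms(3)] by (rule arg_cong[where f = "map _", THEN trans]) simp
  show "cnt v k < length (evs I v)" unfolding ev cnt_def by simp
  show "evs I v ! cnt v k = (fst (G ! k), snd (W k))" unfolding ev cnt_def W[OF assms(1)]
    by (simp add: nth_append)
qed

lemma ex_cnt:
  assumes "i < length (evs I v)" "v \<in> V"
  shows "\<exists>k<length G. fst (W k) = v \<and> cnt v k = i"
proof -
  have "m \<le> length G \<Longrightarrow> i < cnt v m \<Longrightarrow> \<exists>k<m. fst (W k) = v \<and> cnt v k = i" for m
  proof (induction m)
    case (Suc m)
    show ?case
    proof (cases "i < cnt v m")
      case True
      then show ?thesis using Suc.IH Suc.prems(1) by (meson Suc_leD less_SucI)
    next
      case False
      then have "fst (W m) = v \<and> cnt v m = i"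
        using Suc.prems cnt_Suc[of m v] by (auto split: if_splits)
      then show ?thesis by blast
    qed
  qed (simp add: cnt_0)
  moreover have "cnt v (length G) = length (evs I v)" by (simp add: cnt_def evs[OF assms(2)])
  ultimately show ?thesis using assms(1) by (metis order_refl)
qed

lemma cnt_inj: "j < length G \<Longrightarrow> k < length G \<Longrightarrow> fst (W j) = v \<Longrightarrow> fst (W k) = v \<Longrightarrow> cnt v j = cnt v k \<Longrightarrow> j = k"
  using cnt_less[of j k v] cnt_less[of k j v] by (metis less_imp_le linorder_neqE_nat nat_neq_iff)

lemma before_cnt:
  assumes "k < length G" "fst (W k) = v" "v \<in> V" "u \<in> V"
  shows "before I v (cnt v k) u = cnt u k"
proof -
  have "before I v (cnt v k) u = length (filter (\<lambda>e. fst e < fst (G ! k)) (evs I u))"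
    unfolding before_def evs_cnt(2)[OF assms(1-3)] by simp
  also have "\<dots> = length (filter (\<lambda>e. fst (snd e) = u) (filter (\<lambda>e. fst e < fst (G ! k)) G))"
    unfolding evs[OF assms(4)] by (simp add: filter_map comp_def conj_commute)
  also have "\<dots> = cnt u k" unfolding filter_sorted_take[OF sorted assms(1)] cnt_def ..
  finally show ?thesis .
qed

lemma acc_cnt:
  assumes "k < length G" "fst (W k) = v" "v \<in> V"
  shows "acc v (cnt v k) \<longleftrightarrow> snd (W k) \<notin> X k ` nbhd E v"
proof
  assume "acc v (cnt v k)"
  then obtain j where "j < length G" "fst (W j) = v" "cnt v j = cnt v k" "snd (W j) \<notin> X j ` nbhd E v"
    using assms unfolding acc_def by auto
  then show "snd (W k) \<notin> X k ` nbhd E v" using cnt_inj assms by metis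
qed (use assms in \<open>auto simp: acc_def\<close>)

lemma colour_cnt: "k \<le> length G \<Longrightarrow> v \<in> V \<Longrightarrow> colour I acc v (cnt v k) = X k v"
proof (induction k)
  case (Suc k)
  show ?case
  proof (cases "fst (W k) = v")
    case True
    then have "cnt v (Suc k) = Suc (cnt v k)" using Suc.prems by (simp add: cnt_Suc)
    then show ?thesis
      using Suc True evs_cnt(2)[of k v] acc_cnt[of k v] by (simp add: update_def)
  next
    case False
    then show ?thesis using Suc by (simp add: cnt_Suc update_def)
  qed
qed (simp add: cnt_0 ini)

lemma final_colour: "v \<in> V \<Longrightarrow> colour I acc v (length (evs I v)) = X (length G) v"
  using colour_cnt[of "length G" v] by (simp add: cnt_def evs)

lemma rule: "metropolis_rule I acc"
  unfolding metropolis_rule_def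
proof (intro allI impI)
  fix v i assume i: "i < length (evs I v)"
  show "acc v i \<longleftrightarrow> (\<forall>u\<in>set (nbs I v). colour I acc u (before I v i u) \<noteq> snd (evs I v ! i))"
  proof (cases "v \<in> V")
    case True
    then obtain k where k: "k < length G" "fst (W k) = v" "cnt v k = i" using ex_cnt i by blast
    have "colour I acc u (before I v i u) = X k u" if "u \<in> nbhd E v" for u
      using before_cnt[of k v u] colour_cnt[of k u] nbhd_imp(1)[OF graph that] k True by simp
    moreover have "snd (evs I v ! i) = snd (W k)" using evs_cnt(2)[of k v] k True by simp
    moreover have "acc v i \<longleftrightarrow> snd (W k) \<notin> X k ` nbhd E v" using acc_cnt[of k v] k True by simp
    moreover have "snd (W k) \<notin> X k ` nbhd E v \<longleftrightarrow> (\<forall>u\<in>nbhd E v. X k u \<noteq> snd (W k))"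
      by (metis imageE imageI)
    ultimately show ?thesis by (simp only: set_nbs cong: ball_cong)
  next
    case False
    then show ?thesis using set_nbs nbhd_imp(2)[OF graph] by (auto simp: acc_def)
  qed
qed

lemma chain_global:
  assumes "chain I acc n v i" "v \<in> V"
  shows "\<exists>k<length G. fst (W k) = v \<and> cnt v k = i \<and> global_chain E x0 W n k"
  using assms
proof (induction n v i rule: chain.induct)
  case (chain_0 i v)
  then show ?case using ex_cnt global_chain_0 by blast
next
  case (chain_Suc n u j v i)
  have u: "u \<in> nbhd E v" using chain_Suc.hyps set_nbs by blast
  then have uV: "u \<in> V" using nbhd_imp graph by blast
  obtain j' where j': "j' < length G" "fst (W j') = u" "cnt u j' = j" "global_chain E x0 W n j'"
    using chain_Suc.IH uV by blast
  obtain k where k: "k < length G" "fst (W k) = v" "cnt v k = i" using ex_cnt chain_Suc by blast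
  have "cnt u j' < cnt u k" using chain_Suc.hyps before_cnt[of k v u] k j' chain_Suc.prems uV by simp
  then have "j' < k" using cnt_mono[of k j' u] j' by (meson less_imp_le not_le)
  moreover have "snd (evs I u ! j) = snd (W j')" "snd (evs I v ! i) = snd (W k)"
    using evs_cnt(2)[of j' u] evs_cnt(2)[of k v] j' k uV chain_Suc.prems by auto
  moreover have "colour I acc u j = X j' u" using colour_cnt[of j' u] j' uV by simp
  ultimately have "global_chain E x0 W (Suc n) k"
    using j' k u chain_Suc.hyps by (intro global_chain_Suc[of _ _ _ _ j']) auto
  then show ?case using k by blast
qed

text \<open>A chain with at least one link ends at a node that has a neighbor, hence in V. This is
  why \<open>Suc n\<close> appears instead of n: nothing is assumed about the events of nodes
  outside V.\<close>

lemma no_chain: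
  assumes "\<And>k. k < length G \<Longrightarrow> \<not> global_chain E x0 W (Suc n) k"
  shows "\<not> chain I acc (Suc n) v i"
proof
  assume c: "chain I acc (Suc n) v i"
  then obtain u where "u \<in> set (nbs I v)" by (cases rule: chain.cases) auto
  then have "v \<in> V" using set_nbs nbhd_imp(2)[OF graph] by blast
  then show False using chain_global[OF c] assms by blast
qed

end

section \<open>Counting chains of dependent updates\<close>

lemma trajectory_cong: "(\<And>i. i < k \<Longrightarrow> W i = W' i) \<Longrightarrow> trajectory E x0 W k = trajectory E x0 W' k"
  by (induction k) auto

definition link :: "nat set set \<Rightarrow> (nat \<Rightarrow> nat) \<Rightarrow> (nat \<Rightarrow> nat \<times> nat) \<Rightarrow> nat \<Rightarrow> nat \<times> nat \<Rightarrow> bool" where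
  "link E x0 W j w \<longleftrightarrow> fst (W j) \<in> nbhd E (fst w) \<and>
     (snd w = snd (W j) \<or> snd w = trajectory E x0 W j (fst (W j)))"

text \<open>A weight that counts every chain ending at a step, a chain with n links being counted
  \<open>2 ^ n\<close> times.\<close>

function weight :: "nat set set \<Rightarrow> (nat \<Rightarrow> nat) \<Rightarrow> (nat \<Rightarrow> nat \<times> nat) \<Rightarrow> nat \<Rightarrow> real" where
  "weight E x0 W k = 1 + (\<Sum>j<k. if link E x0 W j (W k) then 2 * weight E x0 W j else 0)"
  by auto
termination by (relation "Wellfounded.measure (\<lambda>(E, x0, W, k). k)") auto

declare weight.simps [simp del]

lemma weight_ge_1: "1 \<le> weight E x0 W k"
proof (induction k rule: less_induct)
  case (less k)
  have "0 \<le> (\<Sum>j<k. if link E x0 W j (W k) then 2 * weight E x0 W j else 0)"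
    by (rule sum_nonneg) (use less in \<open>fastforce\<close>)
  then show ?case by (subst weight.simps) simp
qed

lemma link_cong: "(\<And>i. i \<le> j \<Longrightarrow> W i = W' i) \<Longrightarrow> link E x0 W j w = link E x0 W' j w"
  using trajectory_cong[of j W W' E x0] by (simp add: link_def)

lemma weight_cong: "(\<And>i. i \<le> k \<Longrightarrow> W i = W' i) \<Longrightarrow> weight E x0 W k = weight E x0 W' k"
proof (induction k rule: less_induct)
  case (less k)
  have "link E x0 W j (W k) = link E x0 W' j (W' k)" if "j < k" for j
    using less.prems link_cong[of j W W' E x0] that by simp
  moreover have "weight E x0 W j = weight E x0 W' j" if "j < k" for j
    using less that by simp
  ultimately show ?case
    by (subst (1 2) weight.simps) (intro arg_cong2[where f = "(+)"] sum.cong refl, auto)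
qed

lemma global_chain_weight: "global_chain E x0 W n k \<Longrightarrow> 2 ^ n \<le> weight E x0 W k"
proof (induction n k rule: global_chain.induct)
  case (global_chain_0 k)
  then show ?case using weight_ge_1 by simp
next
  case (global_chain_Suc n j k)
  let ?f = "\<lambda>j. if link E x0 W j (W k) then 2 * weight E x0 W j else 0"
  have "2 ^ Suc n \<le> ?f j" using global_chain_Suc by (simp add: link_def)
  also have "\<dots> \<le> sum ?f {..<k}"
    using global_chain_Suc.hyps(2) weight_ge_1 by (intro member_le_sum) (auto intro: order_trans[OF zero_le_one])
  also have "\<dots> \<le> weight E x0 W k" by (subst (2) weight.simps) simp
  finally show ?case .
qed

definition seqs :: "'a set \<Rightarrow> nat \<Rightarrow> 'a list set" where
  "seqs D t = {ws. set ws \<subseteq> D \<and> length ws = t}"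

lemma finite_seqs: "finite D \<Longrightarrow> finite (seqs D t)"
  by (simp add: seqs_def finite_lists_length_eq)

lemma card_seqs: "finite D \<Longrightarrow> card (seqs D t) = card D ^ t"
  by (simp add: seqs_def card_lists_length_eq)

lemma seqs_Suc: "seqs D (Suc t) = (\<lambda>(ws, w). ws @ [w]) ` (seqs D t \<times> D)"
proof (intro equalityI subsetI)
  fix xs assume xs: "xs \<in> seqs D (Suc t)"
  then have "xs \<noteq> []" by (auto simp: seqs_def)
  then have "xs = butlast xs @ [last xs]" by simp
  moreover have "butlast xs \<in> seqs D t" "last xs \<in> D"
    using xs \<open>xs \<noteq> []\<close> by (auto simp: seqs_def dest: in_set_butlastD)
  ultimately show "xs \<in> (\<lambda>(ws, w). ws @ [w]) ` (seqs D t \<times> D)"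
    by (intro image_eqI[of _ _ "(butlast xs, last xs)"]) auto
qed (auto simp: seqs_def)

lemma sum_seqs_Suc: "sum f (seqs D (Suc t)) = (\<Sum>ws\<in>seqs D t. \<Sum>w\<in>D. f (ws @ [w]))"
proof -
  have "inj_on (\<lambda>(ws, w). ws @ [w]) (seqs D t \<times> D)" by (auto simp: inj_on_def)
  then show ?thesis
    unfolding seqs_Suc by (simp add: sum.reindex comp_def sum.cartesian_product case_prod_unfold)
qed

lemma card_nbhd_le:
  assumes "simple_graph V E"
  shows "card (nbhd E v) \<le> max_degree V E"
proof (cases "v \<in> V")
  case True
  have "finite V" using assms by (simp add: simple_graph_def)
  then show ?thesis using True unfolding max_degree_def by (intro Max_ge) auto
next
  case False
  then have "nbhd E v = {}" using nbhd_imp(2)[OF assms] by blast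
  then show ?thesis by simp
qed

text \<open>A new last proposal leaves the earlier weights alone and extends a chain ending at step
  j for at most 2 \<Delta> of the \<open>card D\<close> choices; the factor 2 per link makes this 4
  \<Delta>. The trivial chains at the new step add \<open>card D ^ Suc t\<close> in total. So the
  sum S obeys S (t + 1) \<le> d S t + d ^ (t + 1). Divided by \<open>card D ^ t\<close>, S t is the
  expected total weight.\<close>

lemma sum_weight_le:
  assumes g: "simple_graph V E" and D: "D = V \<times> {1..q}"
  defines "d \<equiv> real (card D) + 4 * real (max_degree V E)"
  shows "(\<Sum>ws\<in>seqs D t. \<Sum>k<t. weight E x0 ((!) ws) k) \<le> real t * d ^ t"
proof (induction t)
  case (Suc t)
  have fin: "finite D" using g by (simp add: D simple_graph_def)
  \<comment> \<open>A proposal linked to step j has its vertex among the neighbors of the vertex of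
    step j and its color among two, both sets being fixed by the past.\<close>
  have links: "real (card {w\<in>D. link E x0 W j w}) \<le> 2 * real (max_degree V E)" for W j
  proof -
    have "{w\<in>D. link E x0 W j w} \<subseteq> nbhd E (fst (W j)) \<times> {snd (W j), trajectory E x0 W j (fst (W j))}"
      using nbhd_sym by (auto simp: link_def)
    then have "card {w\<in>D. link E x0 W j w} \<le> card (nbhd E (fst (W j)) \<times> {snd (W j), trajectory E x0 W j (fst (W j))})"
    proof (rule card_mono[rotated])
      have "finite (nbhd E (fst (W j)))" using g nbhd_imp(1)[OF g] by (meson finite_subset simple_graph_def subsetI)
      then show "finite (nbhd E (fst (W j)) \<times> {snd (W j), trajectory E x0 W j (fst (W j))})" by simp
    qed
    also have "\<dots> \<le> max_degree V E * 2"
      unfolding card_cartesian_product using card_nbhd_le[OF g]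
      by (intro mult_mono) (simp_all add: card_insert_if)
    finally show ?thesis by simp
  qed
  let ?S = "\<lambda>ws. \<Sum>k<t. weight E x0 ((!) ws) k"
  have step: "(\<Sum>w\<in>D. \<Sum>k<Suc t. weight E x0 ((!) (ws @ [w])) k) \<le> d * ?S ws + real (card D)"
    if ws: "ws \<in> seqs D t" for ws
  proof -
    have len: "length ws = t" using ws by (simp add: seqs_def)
    have old: "weight E x0 ((!) (ws @ [w])) k = weight E x0 ((!) ws) k" if "k < t" for k w
      using that len by (intro weight_cong) (simp add: nth_append)
    have lk: "link E x0 ((!) (ws @ [w])) k w' = link E x0 ((!) ws) k w'" if "k < t" for k w w'
      using that len by (intro link_cong) (simp add: nth_append)
    have new: "weight E x0 ((!) (ws @ [w])) t =
        1 + (\<Sum>k<t. if link E x0 ((!) ws) k w then 2 * weight E x0 ((!) ws) k else 0)" for w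
    proof -
      have "(\<Sum>k<t. if link E x0 ((!) (ws @ [w])) k ((ws @ [w]) ! t) then 2 * weight E x0 ((!) (ws @ [w])) k else 0) =
        (\<Sum>k<t. if link E x0 ((!) ws) k w then 2 * weight E x0 ((!) ws) k else 0)"
        using len by (intro sum.cong refl) (simp add: old lk nth_append)
      then show ?thesis by (subst weight.simps) simp
    qed
    have "(\<Sum>w\<in>D. \<Sum>k<Suc t. weight E x0 ((!) (ws @ [w])) k) =
        (\<Sum>w\<in>D. ?S ws + (1 + (\<Sum>k<t. if link E x0 ((!) ws) k w then 2 * weight E x0 ((!) ws) k else 0)))"
      by (simp add: old new)
    also have "\<dots> = real (card D) * ?S ws + real (card D) +
        (\<Sum>k<t. \<Sum>w\<in>D. if link E x0 ((!) ws) k w then 2 * weight E x0 ((!) ws) k else 0)"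
      by (simp add: sum.distrib sum.swap[of _ _ D] algebra_simps)
    also have "(\<Sum>k<t. \<Sum>w\<in>D. if link E x0 ((!) ws) k w then 2 * weight E x0 ((!) ws) k else 0) =
        (\<Sum>k<t. real (card {w\<in>D. link E x0 ((!) ws) k w}) * (2 * weight E x0 ((!) ws) k))"
      using fin by (intro sum.cong refl) (simp add: sum.If_cases Int_def)
    also have "\<dots> \<le> (\<Sum>k<t. (2 * real (max_degree V E)) * (2 * weight E x0 ((!) ws) k))"
      using weight_ge_1 by (intro sum_mono mult_right_mono links) (auto intro: order_trans[OF zero_le_one])
    also have "\<dots> = 4 * real (max_degree V E) * ?S ws" by (simp add: sum_distrib_left mult.assoc)
    finally show ?thesis unfolding d_def by (simp add: algebra_simps)
  qed
  have "(\<Sum>ws\<in>seqs D (Suc t). \<Sum>k<Suc t. weight E x0 ((!) ws) k) \<le> (\<Sum>ws\<in>seqs D t. d * ?S ws + real (card D))"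
    unfolding sum_seqs_Suc by (rule sum_mono) (rule step)
  also have "\<dots> = d * (\<Sum>ws\<in>seqs D t. ?S ws) + real (card D) ^ Suc t"
    using card_seqs[OF fin, of t] by (simp add: sum.distrib sum_distrib_left)
  also have "\<dots> \<le> d * (real t * d ^ t) + d ^ Suc t"
    unfolding d_def by (intro add_mono mult_left_mono Suc.IH[unfolded d_def] power_mono) auto
  finally show ?case by (simp add: algebra_simps)
qed simp

text \<open>Markov's inequality: a sequence containing a chain with n links has total weight at
  least \<open>2 ^ n\<close>.\<close>

lemma card_chains_le:
  assumes g: "simple_graph V E" and D: "D = V \<times> {1..q}"
  shows "real (card {ws\<in>seqs D t. \<exists>k<t. global_chain E x0 ((!) ws) n k}) * 2 ^ n
    \<le> real t * (real (card D) + 4 * real (max_degree V E)) ^ t"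
proof -
  let ?S = "{ws\<in>seqs D t. \<exists>k<t. global_chain E x0 ((!) ws) n k}"
  have fin: "finite (seqs D t)" using g by (intro finite_seqs) (simp add: D simple_graph_def)
  have nn: "0 \<le> weight E x0 W k" for W k using weight_ge_1[of E x0 W k] by linarith
  have "real (card ?S) * 2 ^ n = (\<Sum>ws\<in>?S. 2 ^ n)" by simp
  also have "\<dots> \<le> (\<Sum>ws\<in>?S. \<Sum>k<t. weight E x0 ((!) ws) k)"
  proof (rule sum_mono)
    fix ws assume "ws \<in> ?S"
    then obtain k where k: "k < t" "global_chain E x0 ((!) ws) n k" by blast
    have "2 ^ n \<le> weight E x0 ((!) ws) k" by (rule global_chain_weight[OF k(2)])
    also have "\<dots> \<le> (\<Sum>k<t. weight E x0 ((!) ws) k)" using k(1) nn by (intro member_le_sum) auto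
    finally show "2 ^ n \<le> (\<Sum>k<t. weight E x0 ((!) ws) k)" .
  qed
  also have "\<dots> \<le> (\<Sum>ws\<in>seqs D t. \<Sum>k<t. weight E x0 ((!) ws) k)"
    using fin nn by (intro sum_mono2) (auto intro: sum_nonneg)
  also have "\<dots> \<le> real t * (real (card D) + 4 * real (max_degree V E)) ^ t" by (rule sum_weight_le[OF g D])
  finally show ?thesis .
qed

section \<open>Independent uniform coins\<close>

definition unif :: "real measure" where
  "unif = uniform_measure lborel {0..1}"

lemma sets_unif [simp, measurable_cong]: "sets unif = sets borel"
  and space_unif [simp]: "space unif = UNIV"
  by (simp_all add: unif_def)

lemma prob_space_unif: "prob_space unif"
  unfolding unif_def by (rule prob_space_uniform_measure) auto

lemma measure_unif: "A \<in> sets borel \<Longrightarrow> measure unif A = measure lborel ({0..1} \<inter> A)"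
  unfolding unif_def by (subst measure_uniform_measure) (auto simp: emeasure_lborel_Icc)

lemma node_coins_eq: "node_coins = (\<Pi>\<^sub>M k\<in>UNIV. unif)"
  by (simp add: node_coins_def unif_def)

lemma measure_unif_eq:
  assumes "A \<in> sets borel" "A \<inter> {0..1} = {a..<b}" "a \<le> b"
  shows "measure unif A = b - a"
  using assms by (simp add: measure_unif Int_commute)

lemma AE_unif: "AE x in unif. x \<in> {0..<1}"
proof -
  interpret prob_space unif by (rule prob_space_unif)
  have "prob {0..<1} = 1" by (subst measure_unif_eq[of _ 0 1]) auto
  then show ?thesis by (subst prob_eq_1[symmetric]) auto
qed

definition coin_at :: "nat \<times> nat \<Rightarrow> (nat \<Rightarrow> coins) \<Rightarrow> real" where
  "coin_at z \<omega> = \<omega> (fst z) (snd z)"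

locale coins_space =
  fixes V :: "nat set"
  assumes finite_V: "finite V" and V_nonempty: "V \<noteq> {}"
begin

abbreviation "P \<equiv> coin_space V"

lemma prob_space_node: "prob_space node_coins"
  unfolding node_coins_eq by (rule prob_space_PiM) (rule prob_space_unif)

sublocale prob_space P
  unfolding coin_space_def by (rule prob_space_PiM) (rule prob_space_node)

lemma measurable_node [measurable]: "(\<lambda>c. c k) \<in> measurable node_coins borel"
proof -
  have "(\<lambda>c. c k) \<in> measurable node_coins unif" unfolding node_coins_eq by measurable
  then show ?thesis by (simp cong: measurable_cong_sets)
qed

lemma measurable_coin [measurable]: "v \<in> V \<Longrightarrow> (\<lambda>\<omega>. \<omega> v k) \<in> borel_measurable P"
proof -
  assume "v \<in> V"
  then have "(\<lambda>\<omega>. \<omega> v) \<in> measurable P node_coins"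
    unfolding coin_space_def by (rule measurable_component_singleton)
  then show ?thesis by (rule measurable_compose[OF _ measurable_node])
qed

lemma measurable_coin_at: "z \<in> V \<times> UNIV \<Longrightarrow> coin_at z \<in> borel_measurable P"
  unfolding coin_at_def by auto

lemma measure_node:
  assumes "finite J" "\<And>k. k \<in> J \<Longrightarrow> A k \<in> sets borel"
  shows "{c \<in> space node_coins. \<forall>k\<in>J. c k \<in> A k} \<in> sets node_coins"
    and "measure node_coins {c \<in> space node_coins. \<forall>k\<in>J. c k \<in> A k} = (\<Prod>k\<in>J. measure unif (A k))"
proof -
  interpret product_prob_space "\<lambda>_. unif" "UNIV :: nat set"
    by (simp add: product_prob_space_def product_prob_space_axioms_def product_sigma_finite_def
        prob_space_unif prob_space_imp_sigma_finite)
  have eq: "{c \<in> space node_coins. \<forall>k\<in>J. c k \<in> A k} = prod_emb UNIV (\<lambda>_. unif) J (Pi\<^sub>E J A)"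
    unfolding node_coins_eq by (auto simp: prod_emb_def space_PiM PiE_iff restrict_def)
  show "{c \<in> space node_coins. \<forall>k\<in>J. c k \<in> A k} \<in> sets node_coins"
    unfolding eq unfolding node_coins_eq using assms by (intro sets_PiM_I) auto
  show "measure node_coins {c \<in> space node_coins. \<forall>k\<in>J. c k \<in> A k} = (\<Prod>k\<in>J. measure unif (A k))"
    unfolding eq unfolding node_coins_eq using assms by (intro measure_PiM_emb) auto
qed

text \<open>The coins form a product over nodes of products over indices. Splitting J by node turns
  them into a single independent family indexed by pairs.\<close>

lemma prob_cylinder:
  assumes "finite J" "J \<subseteq> V \<times> UNIV" "\<And>z. z \<in> J \<Longrightarrow> A z \<in> sets borel"
  shows "prob {\<omega> \<in> space P. \<forall>z\<in>J. coin_at z \<omega> \<in> A z} = (\<Prod>z\<in>J. measure unif (A z))"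
proof -
  interpret pr: product_prob_space "\<lambda>_. node_coins" V
    by (simp add: product_prob_space_def product_prob_space_axioms_def product_sigma_finite_def
        prob_space_node prob_space_imp_sigma_finite)
  let ?J = "\<lambda>v. {k. (v, k) \<in> J}"
  let ?C = "\<lambda>v. {c \<in> space node_coins. \<forall>k\<in>?J v. c k \<in> A (v, k)}"
  have finJ: "finite (?J v)" for v
    using assms(1) by (rule finite_subset[rotated, OF finite_imageI[of J snd]]) force
  have J: "J = Sigma V ?J" using assms(2) by auto
  have "{\<omega> \<in> space P. \<forall>z\<in>J. coin_at z \<omega> \<in> A z} = Pi\<^sub>E V ?C"
  proof (intro equalityI subsetI)
    fix \<omega> assume "\<omega> \<in> {\<omega> \<in> space P. \<forall>z\<in>J. coin_at z \<omega> \<in> A z}"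
    then show "\<omega> \<in> Pi\<^sub>E V ?C" by (auto simp: coin_space_def space_PiM PiE_iff coin_at_def)
  next
    fix \<omega> assume *: "\<omega> \<in> Pi\<^sub>E V ?C"
    then have "\<omega> \<in> space P" by (auto simp: coin_space_def space_PiM PiE_iff)
    moreover have "coin_at z \<omega> \<in> A z" if "z \<in> J" for z
      using * that assms(2) unfolding coin_at_def by (cases z) (auto simp: PiE_iff)
    ultimately show "\<omega> \<in> {\<omega> \<in> space P. \<forall>z\<in>J. coin_at z \<omega> \<in> A z}" by simp
  qed
  moreover have "prob (Pi\<^sub>E V ?C) = (\<Prod>v\<in>V. measure node_coins (?C v))"
  proof -
    have "prod_emb V (\<lambda>_. node_coins) V (Pi\<^sub>E V ?C) = Pi\<^sub>E V ?C" by (rule prod_emb_PiE_same_index) auto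
    moreover have "measure (Pi\<^sub>M V (\<lambda>_. node_coins)) (prod_emb V (\<lambda>_. node_coins) V (Pi\<^sub>E V ?C)) =
        (\<Prod>v\<in>V. measure node_coins (?C v))"
      using finite_V measure_node(1)[OF finJ] assms(2,3) by (intro pr.measure_PiM_emb) auto
    ultimately show ?thesis unfolding coin_space_def by simp
  qed
  moreover have "(\<Prod>v\<in>V. measure node_coins (?C v)) = (\<Prod>v\<in>V. \<Prod>k\<in>?J v. measure unif (A (v, k)))"
    using measure_node(2)[OF finJ] assms(3) by (intro prod.cong) auto
  moreover have "(\<Prod>v\<in>V. \<Prod>k\<in>?J v. measure unif (A (v, k))) = (\<Prod>z\<in>J. measure unif (A z))"
    by (subst (2) J) (simp add: prod.Sigma finite_V finJ)
  ultimately show ?thesis by simp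
qed

text \<open>The joint law of distinct coins depends only on how many there are. This is the source
  of all exchangeability used later.\<close>

lemma distr_coins:
  assumes "distinct zs" "set zs \<subseteq> V \<times> UNIV"
  shows "distr P (\<Pi>\<^sub>M i\<in>{..<length zs}. unif) (\<lambda>\<omega>. \<lambda>i\<in>{..<length zs}. coin_at (zs ! i) \<omega>) = (\<Pi>\<^sub>M i\<in>{..<length zs}. unif)"
    and "(\<lambda>\<omega>. \<lambda>i\<in>{..<length zs}. coin_at (zs ! i) \<omega>) \<in> measurable P (\<Pi>\<^sub>M i\<in>{..<length zs}. unif)"
proof -
  let ?I = "{..<length zs}" and ?f = "\<lambda>\<omega>. \<lambda>i\<in>{..<length zs}. coin_at (zs ! i) \<omega>"
  interpret pr: product_prob_space "\<lambda>_. unif" ?I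
    by (simp add: product_prob_space_def product_prob_space_axioms_def product_sigma_finite_def
        prob_space_unif prob_space_imp_sigma_finite)
  have "coin_at (zs ! i) \<in> measurable P unif" if "i < length zs" for i
  proof -
    have "zs ! i \<in> V \<times> UNIV" using assms(2) nth_mem[OF that] by (rule subsetD)
    then have "coin_at (zs ! i) \<in> borel_measurable P" by (rule measurable_coin_at)
    then show ?thesis by (simp cong: measurable_cong_sets)
  qed
  then show meas: "?f \<in> measurable P (\<Pi>\<^sub>M i\<in>?I. unif)" by (intro measurable_restrict) auto
  show "distr P (\<Pi>\<^sub>M i\<in>?I. unif) ?f = (\<Pi>\<^sub>M i\<in>?I. unif)"
  proof (rule pr.PiM_eqI)
    fix A assume A: "\<And>i. i \<in> ?I \<Longrightarrow> A i \<in> sets unif"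
    \<comment> \<open>The product measure is tested on sets indexed by position, while
      \<open>prob_cylinder\<close> expects sets indexed by coin; since \<open>zs\<close> is
      distinct, positions and coins correspond.\<close>
    define B where "B z = A (inv_into ?I ((!) zs) z)" for z
    have inj: "inj_on ((!) zs) ?I" using assms(1) by (auto simp: inj_on_def nth_eq_iff_index_eq)
    have B: "B (zs ! i) = A i" if "i < length zs" for i
      using inj that by (simp add: B_def)
    have img: "(!) zs ` ?I = set zs" by (auto simp: set_conv_nth)
    have "?f -` Pi\<^sub>E ?I A \<inter> space P = {\<omega> \<in> space P. \<forall>z\<in>set zs. coin_at z \<omega> \<in> B z}"
    proof (rule set_eqI)
      fix \<omega>
      have "(\<forall>z\<in>set zs. coin_at z \<omega> \<in> B z) \<longleftrightarrow> (\<forall>i<length zs. coin_at (zs ! i) \<omega> \<in> B (zs ! i))"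
        by (rule all_set_conv_all_nth)
      moreover have "\<dots> \<longleftrightarrow> (\<forall>i<length zs. coin_at (zs ! i) \<omega> \<in> A i)" by (intro all_cong) (simp only: B)
      moreover have "?f \<omega> \<in> Pi\<^sub>E ?I A \<longleftrightarrow> (\<forall>i<length zs. coin_at (zs ! i) \<omega> \<in> A i)"
        by (simp add: PiE_iff Ball_def)
      ultimately show "\<omega> \<in> ?f -` Pi\<^sub>E ?I A \<inter> space P \<longleftrightarrow> \<omega> \<in> {\<omega> \<in> space P. \<forall>z\<in>set zs. coin_at z \<omega> \<in> B z}"
        by (simp only: vimage_eq Int_iff mem_Collect_eq) blast
    qed
    moreover have "prob \<dots> = (\<Prod>z\<in>set zs. measure unif (B z))"
    proof (rule prob_cylinder)
      fix z assume "z \<in> set zs"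
      then obtain i where "i < length zs" "z = zs ! i" by (metis in_set_conv_nth)
      then show "B z \<in> sets borel" using A[of i] B by simp
    qed (use assms(2) in auto)
    moreover have "\<dots> = (\<Prod>i\<in>?I. measure unif (A i))"
      unfolding img[symmetric] using inj by (simp add: prod.reindex B)
    ultimately have "prob (?f -` Pi\<^sub>E ?I A \<inter> space P) = (\<Prod>i\<in>?I. measure unif (A i))" by simp
    then show "emeasure (distr P (\<Pi>\<^sub>M i\<in>?I. unif) ?f) (Pi\<^sub>E ?I A) = (\<Prod>i\<in>?I. emeasure unif (A i))"
      using meas A by (subst emeasure_distr)
        (auto simp: emeasure_eq_measure finite_measure.emeasure_eq_measure[OF prob_space.finite_measure[OF prob_space_unif]] prod_ennreal intro!: sets_PiM_I_finite)
  qed auto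
qed

lemma AE_coin_range: "z \<in> V \<times> UNIV \<Longrightarrow> AE \<omega> in P. 0 \<le> coin_at z \<omega> \<and> coin_at z \<omega> < 1"
proof -
  assume z: "z \<in> V \<times> UNIV"
  have "prob {\<omega> \<in> space P. \<forall>z\<in>{z}. coin_at z \<omega> \<in> {0..<1}} = 1"
  proof -
    have "measure unif {0..<1} = 1" by (subst measure_unif_eq[of _ 0 1]) auto
    then show ?thesis using z by (subst prob_cylinder) auto
  qed
  then have "AE \<omega> in P. \<omega> \<in> {\<omega> \<in> space P. \<forall>z\<in>{z}. coin_at z \<omega> \<in> {0..<1}}"
    by (subst prob_eq_1[symmetric]) (use measurable_coin_at[OF z] in \<open>auto intro!: measurable_sets_Collect\<close>)
  then show ?thesis by eventually_elim auto
qed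

lemma measure_dyadic:
  assumes "k < 2 ^ p"
  shows "measure unif {x. \<lfloor>2 ^ p * x\<rfloor> = int k} = 1 / 2 ^ p"
proof -
  have "{x. \<lfloor>2 ^ p * x\<rfloor> = int k} \<inter> {0..1} = {real k / 2 ^ p ..< real (Suc k) / 2 ^ p}"
  proof -
    have "real (Suc k) \<le> 2 ^ p" using assms by (metis Suc_leI numeral_power_le_of_nat_cancel_iff of_nat_le_numeral_power_cancel_iff)
    moreover have "0 \<le> x \<and> x \<le> 1" if "real k \<le> 2 ^ p * x" "2 ^ p * x < real k + 1" for x :: real
    proof -
      have "2 ^ p * 0 \<le> 2 ^ p * x" "2 ^ p * x \<le> 2 ^ p * 1" using that calculation by linarith+
      then show ?thesis by (simp only: mult_le_cancel_left_pos zero_less_power zero_less_numeral)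
    qed
    ultimately show ?thesis by (auto simp: floor_eq_iff field_simps)
  qed
  then have "measure unif {x. \<lfloor>2 ^ p * x\<rfloor> = int k} = real (Suc k) / 2 ^ p - real k / 2 ^ p"
    by (rule measure_unif_eq[rotated]) (simp, intro divide_right_mono, simp_all)
  also have "\<dots> = (real (Suc k) - real k) / 2 ^ p" by (rule diff_divide_distrib[symmetric])
  finally show ?thesis by simp
qed

text \<open>Almost surely both coins lie in one of the \<open>2 ^ p\<close> dyadic cells of [0, 1),
  and each cell catches both with probability \<open>1 / 2 ^ p * (1 / 2 ^ p)\<close>.\<close>

lemma prob_tie_le:
  assumes "y \<in> V \<times> UNIV" "z \<in> V \<times> UNIV" "y \<noteq> z"
  shows "{\<omega> \<in> space P. \<lfloor>2 ^ p * coin_at y \<omega>\<rfloor> = \<lfloor>2 ^ p * coin_at z \<omega>\<rfloor>} \<in> events"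
    and "prob {\<omega> \<in> space P. \<lfloor>2 ^ p * coin_at y \<omega>\<rfloor> = \<lfloor>2 ^ p * coin_at z \<omega>\<rfloor>} \<le> 1 / 2 ^ p"
proof -
  note [measurable] = measurable_coin_at[OF assms(1)] measurable_coin_at[OF assms(2)]
  let ?T = "{\<omega> \<in> space P. \<lfloor>2 ^ p * coin_at y \<omega>\<rfloor> = \<lfloor>2 ^ p * coin_at z \<omega>\<rfloor>}"
  show T: "?T \<in> events" by measurable
  let ?D = "\<lambda>k::nat. {x. \<lfloor>2 ^ p * x\<rfloor> = int k}"
  let ?A = "\<lambda>k. {\<omega> \<in> space P. \<forall>w\<in>{y, z}. coin_at w \<omega> \<in> ?D k}"
  have A: "?A k \<in> events" for k
  proof -
    have "?A k = {\<omega> \<in> space P. \<lfloor>2 ^ p * coin_at y \<omega>\<rfloor> = int k \<and> \<lfloor>2 ^ p * coin_at z \<omega>\<rfloor> = int k}" by auto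
    also have "\<dots> \<in> events" by measurable
    finally show ?thesis .
  qed
  have "AE \<omega> in P. \<omega> \<in> ?T \<longrightarrow> \<omega> \<in> (\<Union>k<2 ^ p. ?A k)"
    using AE_coin_range[OF assms(1)] AE_space
  proof eventually_elim
    case (elim \<omega>)
    show ?case
    proof
      assume "\<omega> \<in> ?T"
      moreover have "0 \<le> \<lfloor>2 ^ p * coin_at y \<omega>\<rfloor>" using elim by simp
      then have "\<lfloor>2 ^ p * coin_at y \<omega>\<rfloor> = int (nat \<lfloor>2 ^ p * coin_at y \<omega>\<rfloor>)" by simp
      moreover have "nat \<lfloor>2 ^ p * coin_at y \<omega>\<rfloor> < 2 ^ p"
      proof -
        have "\<lfloor>2 ^ p * coin_at y \<omega>\<rfloor> < 2 ^ p" using elim by (simp add: floor_less_iff)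
        then show ?thesis by (simp add: nat_less_iff)
      qed
      ultimately show "\<omega> \<in> (\<Union>k<2 ^ p. ?A k)" using elim by (intro UN_I[of "nat \<lfloor>2 ^ p * coin_at y \<omega>\<rfloor>"]) auto
    qed
  qed
  then have "prob ?T \<le> prob (\<Union>k<2 ^ p. ?A k)" using A by (intro finite_measure_mono_AE) auto
  also have "\<dots> \<le> (\<Sum>k<2 ^ p. prob (?A k))" using A by (intro finite_measure_subadditive_finite) auto
  also have "\<dots> = (\<Sum>k::nat<2 ^ p. 1 / 2 ^ p * (1 / 2 ^ p))"
    using assms by (intro sum.cong refl, subst prob_cylinder) (simp_all add: measure_dyadic)
  also have "\<dots> = 1 / 2 ^ p" by simp
  finally show "prob ?T \<le> 1 / 2 ^ p" .
qed

text \<open>Equal coins are tied at every precision p, so the probability is below every power of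
  1/2.\<close>

lemma AE_no_tie:
  assumes "y \<in> V \<times> UNIV" "z \<in> V \<times> UNIV" "y \<noteq> z"
  shows "AE \<omega> in P. coin_at y \<omega> \<noteq> coin_at z \<omega>"
proof -
  note [measurable] = measurable_coin_at[OF assms(1)] measurable_coin_at[OF assms(2)]
  let ?T = "{\<omega> \<in> space P. coin_at y \<omega> = coin_at z \<omega>}"
  have T: "?T \<in> events" by measurable
  have le: "prob ?T \<le> (1 / 2) ^ p" for p
  proof -
    have "prob ?T \<le> prob {\<omega> \<in> space P. \<lfloor>2 ^ p * coin_at y \<omega>\<rfloor> = \<lfloor>2 ^ p * coin_at z \<omega>\<rfloor>}"
      by (intro finite_measure_mono prob_tie_le assms) auto
    also have "\<dots> \<le> (1 / 2) ^ p" using prob_tie_le(2)[OF assms, of p] by (simp add: power_one_over)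
    finally show ?thesis .
  qed
  have "prob ?T \<le> 0"
    by (rule LIMSEQ_le_const[OF LIMSEQ_power_zero[of "1 / 2 :: real"]]) (use le in auto)
  then have "prob ?T = 0" using measure_nonneg[of P ?T] by linarith
  then have "AE \<omega> in P. \<omega> \<notin> ?T" using T prob_eq_0 by blast
  then show ?thesis using AE_space by eventually_elim auto
qed

end

section \<open>Exchangeability of the event times\<close>

lemma strictly_sorted_unique:
  fixes f :: "'a \<Rightarrow> 'b::linorder"
  assumes "sorted_wrt (<) (map f xs)" "sorted_wrt (<) (map f ys)" "set xs = set ys"
  shows "xs = ys"
proof (rule map_sorted_distinct_set_unique)
  have "distinct (map f xs)" "distinct (map f ys)" "sorted (map f xs)" "sorted (map f ys)"
    using assms(1,2) strict_sorted_iff by blast+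
  then show "sorted (map f xs)" "distinct (map f xs)" "sorted (map f ys)" "distinct (map f ys)"
    "inj_on f (set xs \<union> set ys)"
    using assms(3) by (simp_all add: distinct_map)
  show "set xs = set ys" by fact
qed

lemma strictly_sorted_sort_key:
  assumes "distinct xs" "inj_on f (set xs)"
  shows "sorted_wrt (<) (map f (sort_key f xs))"
  using assms by (simp add: strict_sorted_iff distinct_map)

context coins_space
begin

definition cylinder :: "(nat \<times> nat) list \<Rightarrow> real set list \<Rightarrow> (nat \<Rightarrow> coins) set" where
  "cylinder js Bs = {\<omega> \<in> space P. list_all2 (\<lambda>z B. coin_at z \<omega> \<in> B) js Bs}"

definition increasing_on :: "(nat \<times> nat) list \<Rightarrow> (nat \<Rightarrow> coins) set" where
  "increasing_on xs = {\<omega> \<in> space P. sorted_wrt (<) (map (\<lambda>z. coin_at z \<omega>) xs)}"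

text \<open>S involves \<open>xs\<close> and \<open>js\<close> only through their lengths, so
  permuting \<open>xs\<close> does not change the probability.\<close>

lemma prob_increasing_cylinder_eq:
  assumes "distinct (xs @ js)" "set (xs @ js) \<subseteq> V \<times> UNIV"
    and "length Bs = length js" "\<And>B. B \<in> set Bs \<Longrightarrow> B \<in> sets borel"
  defines "S \<equiv> {y \<in> space (\<Pi>\<^sub>M i\<in>{..<length (xs @ js)}. unif). (\<forall>i<length xs. \<forall>j<length xs. i < j \<longrightarrow> y i < y j) \<and>
      (\<forall>i<length js. y (length xs + i) \<in> Bs ! i)}"
  shows "prob (increasing_on xs \<inter> cylinder js Bs) = measure (\<Pi>\<^sub>M i\<in>{..<length (xs @ js)}. unif) S"
    and "increasing_on xs \<inter> cylinder js Bs \<in> events"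
proof -
  let ?I = "{..<length (xs @ js)}"
  let ?M = "\<Pi>\<^sub>M i\<in>?I. unif"
  let ?f = "\<lambda>\<omega>. \<lambda>i\<in>?I. coin_at ((xs @ js) ! i) \<omega>"
  note f = distr_coins[OF assms(1,2)]
  have comp: "(\<lambda>y. y i) \<in> borel_measurable ?M" if "i < length (xs @ js)" for i
  proof -
    have "(\<lambda>y. y i) \<in> measurable ?M unif" using that by (intro measurable_component_singleton) simp
    then show ?thesis by (simp cong: measurable_cong_sets)
  qed
  have "{y \<in> space ?M. \<forall>i\<in>{..<length xs}. \<forall>j\<in>{..<length xs}. i < j \<longrightarrow> y i < y j} \<in> sets ?M"
  proof (intro sets.sets_Collect_finite_All finite_lessThan)
    fix i j assume "i \<in> {..<length xs}" "j \<in> {..<length xs}"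
    then have [measurable]: "(\<lambda>y. y i) \<in> borel_measurable ?M" "(\<lambda>y. y j) \<in> borel_measurable ?M"
      using comp[of i] comp[of j] by simp_all
    show "{y \<in> space ?M. i < j \<longrightarrow> y i < y j} \<in> sets ?M" by measurable
  qed
  moreover have "{y \<in> space ?M. \<forall>i\<in>{..<length js}. y (length xs + i) \<in> Bs ! i} \<in> sets ?M"
  proof (intro sets.sets_Collect_finite_All finite_lessThan)
    fix i assume i: "i \<in> {..<length js}"
    then have [measurable]: "(\<lambda>y. y (length xs + i)) \<in> borel_measurable ?M" by (intro comp) simp
    have [measurable]: "Bs ! i \<in> sets borel" using assms(3,4) i by simp
    show "{y \<in> space ?M. y (length xs + i) \<in> Bs ! i} \<in> sets ?M" by measurable
  qed
  moreover have "S = {y \<in> space ?M. \<forall>i\<in>{..<length xs}. \<forall>j\<in>{..<length xs}. i < j \<longrightarrow> y i < y j} \<inter>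
      {y \<in> space ?M. \<forall>i\<in>{..<length js}. y (length xs + i) \<in> Bs ! i}" unfolding S_def by (auto simp: Ball_def)
  ultimately have S: "S \<in> sets ?M" by (simp only: sets.Int)
  have "increasing_on xs \<inter> cylinder js Bs = ?f -` S \<inter> space P"
  proof (rule set_eqI)
    fix \<omega>
    have "sorted_wrt (<) (map (\<lambda>z. coin_at z \<omega>) xs) \<longleftrightarrow> (\<forall>i<length xs. \<forall>j<length xs. i < j \<longrightarrow> ?f \<omega> i < ?f \<omega> j)"
      by (auto simp: sorted_wrt_iff_nth_less nth_append)
    moreover have "list_all2 (\<lambda>z B. coin_at z \<omega> \<in> B) js Bs \<longleftrightarrow> (\<forall>i<length js. ?f \<omega> (length xs + i) \<in> Bs ! i)"
      using assms(3) by (auto simp: list_all2_conv_all_nth)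
    moreover have "\<omega> \<in> space P \<Longrightarrow> ?f \<omega> \<in> space ?M" using f(2) by (rule measurable_space)
    ultimately show "\<omega> \<in> increasing_on xs \<inter> cylinder js Bs \<longleftrightarrow> \<omega> \<in> ?f -` S \<inter> space P"
      unfolding increasing_on_def cylinder_def S_def by (simp only: vimage_eq Int_iff mem_Collect_eq) blast
  qed
  moreover have "measure ?M S = measure (distr P ?M ?f) S" by (simp only: f(1))
  ultimately show "prob (increasing_on xs \<inter> cylinder js Bs) = measure ?M S"
    and "increasing_on xs \<inter> cylinder js Bs \<in> events"
    using measure_distr[OF f(2) S] measurable_sets[OF f(2) S] by (simp_all only:)
qed

lemma prob_list_cylinder:
  assumes "distinct js" "set js \<subseteq> V \<times> UNIV"
    and "length Bs = length js" "\<And>B. B \<in> set Bs \<Longrightarrow> B \<in> sets borel"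
  shows "prob (cylinder js Bs) = prod_list (map (measure unif) Bs)"
    and "cylinder js Bs \<in> events"
proof -
  have inc: "increasing_on [] \<inter> cylinder js Bs = cylinder js Bs" by (auto simp: increasing_on_def cylinder_def)
  then show "cylinder js Bs \<in> events" using prob_increasing_cylinder_eq(2)[of "[]" js Bs] assms by simp
  let ?I = "{..<length js}"
  interpret pr: product_prob_space "\<lambda>_. unif" ?I
    by (simp add: product_prob_space_def product_prob_space_axioms_def product_sigma_finite_def
        prob_space_unif prob_space_imp_sigma_finite)
  have "{y \<in> space (\<Pi>\<^sub>M i\<in>?I. unif). \<forall>i<length js. y i \<in> Bs ! i} = Pi\<^sub>E ?I (\<lambda>i. Bs ! i)"
    by (rule set_eqI) (simp add: space_PiM PiE_iff Ball_def conj_commute)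
  moreover have "measure (\<Pi>\<^sub>M i\<in>?I. unif) (prod_emb ?I (\<lambda>_. unif) ?I (Pi\<^sub>E ?I (\<lambda>i. Bs ! i))) = (\<Prod>i\<in>?I. measure unif (Bs ! i))"
    using assms by (intro pr.measure_PiM_emb) auto
  moreover have "prod_emb ?I (\<lambda>_. unif) ?I (Pi\<^sub>E ?I (\<lambda>i. Bs ! i)) = Pi\<^sub>E ?I (\<lambda>i. Bs ! i)"
    by (rule prod_emb_PiE_same_index) simp
  moreover have "prod_list (map (measure unif) Bs) = (\<Prod>i\<in>?I. measure unif (Bs ! i))"
    using assms(3) by (simp add: prod.list_conv_set_nth lessThan_atLeast0)
  moreover have "prob (increasing_on [] \<inter> cylinder js Bs) =
      measure (\<Pi>\<^sub>M i\<in>?I. unif) {y \<in> space (\<Pi>\<^sub>M i\<in>?I. unif). \<forall>i<length js. y i \<in> Bs ! i}"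
    using prob_increasing_cylinder_eq(1)[of "[]" js Bs] assms by simp
  ultimately show "prob (cylinder js Bs) = prod_list (map (measure unif) Bs)" using inc by simp
qed

text \<open>Permuting the coins at xs preserves the measure, and almost surely exactly one order of xs is
  increasing.\<close>

lemma prob_increasing_cylinder:
  assumes "distinct (xs @ js)" "set (xs @ js) \<subseteq> V \<times> UNIV"
    and "length Bs = length js" "\<And>B. B \<in> set Bs \<Longrightarrow> B \<in> sets borel"
  shows "prob (increasing_on xs \<inter> cylinder js Bs) = prod_list (map (measure unif) Bs) / fact (length xs)"
proof -
  let ?perms = "permutations_of_set (set xs)"
  let ?Q = "\<lambda>zs. increasing_on zs \<inter> cylinder js Bs"
  have perm: "set zs = set xs" "distinct zs" "length zs = length xs" if "zs \<in> ?perms" for zs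
    using that assms(1) unfolding permutations_of_set_def by (auto simp: distinct_card dest: distinct_card)
  have Q: "?Q zs \<in> events" "prob (?Q zs) = prob (?Q xs)" if "zs \<in> ?perms" for zs
  proof -
    have d: "distinct (zs @ js)" "set (zs @ js) \<subseteq> V \<times> UNIV" using perm[OF that] assms(1,2) by auto
    show "?Q zs \<in> events" by (rule prob_increasing_cylinder_eq(2)[OF d assms(3,4)])
    show "prob (?Q zs) = prob (?Q xs)"
      using prob_increasing_cylinder_eq(1)[OF d assms(3,4)] prob_increasing_cylinder_eq(1)[OF assms(1-4)]
      by (simp only: length_append perm(3)[OF that])
  qed
  have disj: "disjoint_family_on ?Q ?perms"
    unfolding disjoint_family_on_def
  proof (intro ballI impI equals0I)
    fix zs zs' \<omega> assume z: "zs \<in> ?perms" "zs' \<in> ?perms" "zs \<noteq> zs'" and "\<omega> \<in> ?Q zs \<inter> ?Q zs'"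
    then have "sorted_wrt (<) (map (\<lambda>z. coin_at z \<omega>) zs)" "sorted_wrt (<) (map (\<lambda>z. coin_at z \<omega>) zs')"
      by (simp_all add: increasing_on_def)
    then have "zs = zs'" by (rule strictly_sorted_unique) (simp only: perm(1)[OF z(1)] perm(1)[OF z(2)])
    then show False using z(3) by simp
  qed
  have "AE \<omega> in P. \<forall>(y, z)\<in>{(y, z). y \<in> set xs \<and> z \<in> set xs \<and> y \<noteq> z}. coin_at y \<omega> \<noteq> coin_at z \<omega>"
  proof (rule AE_ball_countable')
    show "countable {(y, z). y \<in> set xs \<and> z \<in> set xs \<and> y \<noteq> z}" by (rule countableI_type)
    fix p assume p: "p \<in> {(y, z). y \<in> set xs \<and> z \<in> set xs \<and> y \<noteq> z}"
    obtain y z where yz: "p = (y, z)" by (cases p)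
    then have "AE \<omega> in P. coin_at y \<omega> \<noteq> coin_at z \<omega>" using p assms(2) by (intro AE_no_tie) auto
    then show "AE \<omega> in P. case p of (y, z) \<Rightarrow> coin_at y \<omega> \<noteq> coin_at z \<omega>" by (simp add: yz)
  qed
  then have "AE \<omega> in P. \<omega> \<in> cylinder js Bs \<longleftrightarrow> \<omega> \<in> (\<Union>zs\<in>?perms. ?Q zs)"
    using AE_space
  proof eventually_elim
    case (elim \<omega>)
    let ?zs = "sort_key (\<lambda>z. coin_at z \<omega>) xs"
    have "inj_on (\<lambda>z. coin_at z \<omega>) (set xs)" using elim(1) by (auto simp: inj_on_def)
    then have "\<omega> \<in> increasing_on ?zs"
      using elim(2) assms(1) by (simp add: increasing_on_def strictly_sorted_sort_key)
    moreover have "?zs \<in> ?perms" using assms(1) by (simp add: permutations_of_set_def)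
    ultimately show ?case by blast
  qed
  then have "prob (cylinder js Bs) = prob (\<Union>zs\<in>?perms. ?Q zs)"
  proof (rule finite_measure_eq_AE)
    show "cylinder js Bs \<in> events" using assms by (intro prob_list_cylinder) auto
    show "(\<Union>zs\<in>?perms. ?Q zs) \<in> events" by (rule sets.finite_UN) (simp_all only: finite_permutations_of_set finite_set Q(1))
  qed
  also have "\<dots> = (\<Sum>zs\<in>?perms. prob (?Q zs))"
    using Q(1) disj by (intro finite_measure_finite_Union) auto
  also have "\<dots> = (\<Sum>zs\<in>?perms. prob (?Q xs))" by (intro sum.cong refl Q(2))
  also have "\<dots> = fact (length xs) * prob (?Q xs)" using assms(1) by (simp add: distinct_card)
  finally show ?thesis using prob_list_cylinder(1)[of js Bs] assms by (simp add: field_simps)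
qed

end

text \<open>The occurrences of v in \<open>ls\<close> are matched with the elements of
  \<open>J v\<close> in any order, independently for every v. The induction removes the element
  matched with the head, which is why J is general. These factorials later cancel those of the
  Poisson weights.\<close>

lemma card_arrangements:
  assumes "finite V" "set ls \<subseteq> V" "\<And>v. v \<in> V \<Longrightarrow> finite (J v) \<and> card (J v) = count_list ls v"
  shows "card {xs. map fst xs = ls \<and> distinct xs \<and> set xs = Sigma V J} = (\<Prod>v\<in>V. fact (count_list ls v))"
  using assms(2,3)
proof (induction ls arbitrary: J)
  case Nil
  have "J v = {}" if "v \<in> V" for v using Nil(2)[OF that] card_0_eq[of "J v"] by simp
  then have "Sigma V J = {}" by auto
  then have "{xs. map fst xs = [] \<and> distinct xs \<and> set xs = Sigma V J} = {[]}" by auto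
  then show ?case by simp
next
  case (Cons v ls)
  let ?S = "\<lambda>j. {xs. map fst xs = ls \<and> distinct xs \<and> set xs = Sigma V (J(v := J v - {j}))}"
  have v: "v \<in> V" "finite (J v)" "card (J v) = Suc (count_list ls v)" using Cons.prems by auto
  have sig: "Sigma V J = insert (v, j) (Sigma V (J(v := J v - {j})))" "(v, j) \<notin> Sigma V (J(v := J v - {j}))"
    if "j \<in> J v" for j using that v(1) by (auto split: if_splits)
  have "{xs. map fst xs = v # ls \<and> distinct xs \<and> set xs = Sigma V J} = (\<Union>j\<in>J v. (#) (v, j) ` ?S j)"
  proof (intro equalityI subsetI)
    fix xs assume "xs \<in> {xs. map fst xs = v # ls \<and> distinct xs \<and> set xs = Sigma V J}"
    then obtain j ys where xs: "xs = (v, j) # ys" "map fst ys = ls" "distinct xs" "set xs = Sigma V J"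
      by (cases xs) auto
    then have j: "j \<in> J v" by auto
    then have "set ys = Sigma V (J(v := J v - {j}))" using xs sig[OF j] by (auto simp: insert_ident)
    then show "xs \<in> (\<Union>j\<in>J v. (#) (v, j) ` ?S j)" using xs j by auto
  next
    fix xs assume "xs \<in> (\<Union>j\<in>J v. (#) (v, j) ` ?S j)"
    then obtain j ys where "j \<in> J v" "xs = (v, j) # ys" "ys \<in> ?S j" by blast
    then show "xs \<in> {xs. map fst xs = v # ls \<and> distinct xs \<and> set xs = Sigma V J}"
      using sig[of j] by simp
  qed
  moreover have fin: "finite (?S j)" if "j \<in> J v" for j
  proof (rule finite_subset)
    have "finite (Sigma V J)" using assms(1) Cons.prems by auto
    then show "finite {xs. set xs \<subseteq> Sigma V J \<and> length xs = length ls}" by (rule finite_lists_length_eq)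
    show "?S j \<subseteq> {xs. set xs \<subseteq> Sigma V J \<and> length xs = length ls}" by (auto split: if_splits)
  qed
  ultimately have "card {xs. map fst xs = v # ls \<and> distinct xs \<and> set xs = Sigma V J} = (\<Sum>j\<in>J v. card ((#) (v, j) ` ?S j))"
    using v(2) by (simp only:, intro card_UN_disjoint) auto
  also have "\<dots> = (\<Sum>j\<in>J v. \<Prod>u\<in>V. fact (count_list ls u))"
  proof (rule sum.cong)
    fix j assume j: "j \<in> J v"
    have "card (?S j) = (\<Prod>u\<in>V. fact (count_list ls u))"
    proof (rule Cons.IH)
      show "finite ((J(v := J v - {j})) u) \<and> card ((J(v := J v - {j})) u) = count_list ls u" if "u \<in> V" for u
        using Cons.prems(2)[OF that] v j by auto
    qed (use Cons.prems in simp)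
    moreover have "card ((#) (v, j) ` ?S j) = card (?S j)" by (rule card_image) simp
    ultimately show "card ((#) (v, j) ` ?S j) = (\<Prod>u\<in>V. fact (count_list ls u))" by (simp only:)
  qed simp
  also have "\<dots> = Suc (count_list ls v) * (\<Prod>u\<in>V. fact (count_list ls u))" by (simp add: v(3))
  also have "\<dots> = (\<Prod>u\<in>V. fact (count_list (v # ls) u))"
  proof -
    have "(\<Prod>u\<in>V - {v}. fact (count_list (v # ls) u)) = (\<Prod>u\<in>V - {v}. fact (count_list ls u) :: nat)"
      by (rule prod.cong) auto
    then show ?thesis using prod.remove[OF assms(1) v(1), of "\<lambda>u. fact (count_list (v # ls) u) :: nat"]
        prod.remove[OF assms(1) v(1), of "\<lambda>u. fact (count_list ls u) :: nat"] by (simp add: algebra_simps)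
  qed
  finally show ?case .
qed

section \<open>Event counts, colors and times read off the coins\<close>

lemma measure_unif_restrict:
  assumes "A \<in> sets borel"
  shows "measure unif A = measure unif (A \<inter> {0..<1})"
proof (rule measure_eq_AE)
  show "AE x in unif. x \<in> A \<longleftrightarrow> x \<in> A \<inter> {0..<1}" using AE_unif by eventually_elim simp
qed (use assms in auto)

lemma measure_unif_Ico: "0 \<le> a \<Longrightarrow> a \<le> b \<Longrightarrow> b \<le> 1 \<Longrightarrow> measure unif {a..<b} = b - a"
  by (rule measure_unif_eq) auto

definition poisson_weight :: "real \<Rightarrow> nat \<Rightarrow> real" where
  "poisson_weight l k = exp (- l) * l ^ k / fact k"

text \<open>Inverse of the distribution function. The strict inequality makes the fibers half-open
  intervals; for l \<ge> 0 and x \<ge> 1 no such k exists, which is a null event.\<close>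

definition poisson_quantile :: "real \<Rightarrow> real \<Rightarrow> nat" where
  "poisson_quantile l x = (LEAST k. x < (\<Sum>i\<le>k. poisson_weight l i))"

definition pick :: "nat \<Rightarrow> real \<Rightarrow> nat" where
  "pick m x = nat \<lfloor>real m * x\<rfloor>"

lemma poisson_weight_nonneg: "0 \<le> l \<Longrightarrow> 0 \<le> poisson_weight l k"
  by (simp add: poisson_weight_def)

lemma poisson_weight_sums: "poisson_weight l sums 1"
proof -
  have "(\<lambda>k. exp (- l) * (l ^ k /\<^sub>R fact k)) sums (exp (- l) * exp l)"
    by (intro sums_mult exp_converges)
  moreover have "exp (- l) * exp l = 1" by (simp flip: exp_add)
  moreover have "(\<lambda>k. exp (- l) * (l ^ k /\<^sub>R fact k)) = poisson_weight l"
    by (simp add: poisson_weight_def fun_eq_iff divide_inverse mult_ac)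
  ultimately show ?thesis by simp
qed

lemma measurable_poisson_quantile [measurable]: "poisson_quantile l \<in> measurable borel (count_space UNIV)"
  unfolding poisson_quantile_def by measurable

lemma measure_poisson_quantile:
  assumes "0 \<le> l"
  shows "measure unif {x. poisson_quantile l x = k} = poisson_weight l k"
proof -
  let ?F = "\<lambda>k. \<Sum>i<k. poisson_weight l i"
  have F: "mono ?F" using poisson_weight_nonneg[OF assms] by (intro monoI sum_mono2) auto
  have F0: "0 \<le> ?F k" for k using poisson_weight_nonneg[OF assms] by (intro sum_nonneg) auto
  have F1: "?F k \<le> 1" for k
    using poisson_weight_sums poisson_weight_nonneg[OF assms] by (metis sum_le_suminf finite_lessThan sums_unique sums_summable)
  have eq: "poisson_quantile l x = k \<longleftrightarrow> ?F k \<le> x \<and> x < ?F (Suc k)" if x: "0 \<le> x" "x < 1" for x k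
  proof -
    have "eventually (\<lambda>j. x < ?F j) sequentially"
      using poisson_weight_sums[of l] x(2) unfolding sums_def by (rule order_tendstoD)
    then obtain j where "x < ?F j" unfolding eventually_sequentially by blast
    then have "x < ?F (Suc j)" using monoD[OF F, of j "Suc j"] by simp
    then have ex: "\<exists>j. x < ?F (Suc j)" by blast
    have q: "poisson_quantile l x = (LEAST k. x < ?F (Suc k))"
      unfolding poisson_quantile_def by (simp only: lessThan_Suc_atMost)
    show ?thesis
    proof
      assume k: "poisson_quantile l x = k"
      have "x < ?F (Suc k)" using LeastI_ex[OF ex] k q by simp
      moreover have "?F k \<le> x"
      proof (cases k)
        case (Suc i)
        then have "\<not> x < ?F (Suc i)" using k q by (intro not_less_Least) simp
        then show ?thesis using Suc by simp
      qed (use x in simp)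
      ultimately show "?F k \<le> x \<and> x < ?F (Suc k)" by simp
    next
      assume k: "?F k \<le> x \<and> x < ?F (Suc k)"
      show "poisson_quantile l x = k" unfolding q
      proof (rule Least_equality)
        show "k \<le> y" if "x < ?F (Suc y)" for y
        proof (rule ccontr)
          assume "\<not> k \<le> y"
          then have "?F (Suc y) \<le> ?F k" by (intro monoD[OF F]) simp
          then show False using that k by linarith
        qed
      qed (use k in simp)
    qed
  qed
  have "measure unif {x. poisson_quantile l x = k} = measure unif ({x. poisson_quantile l x = k} \<inter> {0..<1})"
    by (rule measure_unif_restrict) measurable
  also have "{x. poisson_quantile l x = k} \<inter> {0..<1} = {?F k ..< ?F (Suc k)}"
  proof (rule set_eqI)
    fix x
    have "0 \<le> x \<and> x < 1" if "?F k \<le> x \<and> x < ?F (Suc k)" using that F0[of k] F1[of "Suc k"] by linarith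
    then show "x \<in> {x. poisson_quantile l x = k} \<inter> {0..<1} \<longleftrightarrow> x \<in> {?F k ..< ?F (Suc k)}"
      using eq[of x k] by (simp only: Int_iff mem_Collect_eq atLeastLessThan_iff) blast
  qed
  also have "measure unif \<dots> = ?F (Suc k) - ?F k"
    using F0[of k] F1[of "Suc k"] monoD[OF F, of k "Suc k"] by (intro measure_unif_eq) auto
  finally show ?thesis by simp
qed

lemma measurable_pick [measurable]: "pick m \<in> measurable borel (count_space UNIV)"
  unfolding pick_def by measurable

lemma measure_pick:
  assumes "i < m"
  shows "measure unif {x. pick m x = i} = 1 / real m"
proof -
  have m: "real m > 0" and i: "real (Suc i) \<le> real m" using assms by linarith+
  have "measure unif {x. pick m x = i} = measure unif ({x. pick m x = i} \<inter> {0..<1})"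
    by (rule measure_unif_restrict) measurable
  also have "{x. pick m x = i} \<inter> {0..<1} = {real i / real m ..< real (Suc i) / real m}"
  proof (rule set_eqI)
    fix x :: real
    have "pick m x = i \<longleftrightarrow> real i \<le> real m * x \<and> real m * x < real i + 1" if "0 \<le> x"
    proof -
      have "0 \<le> real m * x" using that by simp
      then have "pick m x = i \<longleftrightarrow> \<lfloor>real m * x\<rfloor> = int i" unfolding pick_def by (simp add: nat_eq_iff)
      then show ?thesis by (simp add: floor_eq_iff)
    qed
    moreover have "0 \<le> x" if "real i / real m \<le> x" using that m by (meson divide_nonneg_nonneg of_nat_0_le_iff order_trans)
    moreover have "x < 1" if "x < real (Suc i) / real m"
      using that i m by (smt (verit) divide_le_eq_1)
    ultimately show "x \<in> {x. pick m x = i} \<inter> {0..<1} \<longleftrightarrow> x \<in> {real i / real m ..< real (Suc i) / real m}"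
      using m by (auto simp: field_simps)
  qed
  also have "measure unif \<dots> = real (Suc i) / real m - real i / real m"
    using m i by (intro measure_unif_Ico divide_right_mono) simp_all
  also have "\<dots> = 1 / real m" by (simp flip: diff_divide_distrib)
  finally show ?thesis .
qed

lemma pick_less: "0 \<le> x \<Longrightarrow> x < 1 \<Longrightarrow> 0 < m \<Longrightarrow> pick m x < m"
  unfolding pick_def by (simp add: nat_less_iff floor_less_iff)

text \<open>Layout of a node's coins: index 0 gives the number of events; residues 1 and 2 modulo 5
  give their colors and times; residues 3 and 4, at the node \<open>Min V\<close>, drive the chain
  after the agenda. Disjoint indices mean independence.\<close>

definition event_count :: "real \<Rightarrow> coins \<Rightarrow> nat" where
  "event_count l c = poisson_quantile l (c 0)"

definition event_colour :: "nat \<Rightarrow> coins \<Rightarrow> nat \<Rightarrow> nat" where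
  "event_colour q c j = Suc (pick q (c (5 * j + 1)))"

definition event_time :: "coins \<Rightarrow> nat \<Rightarrow> real" where
  "event_time c j = c (5 * j + 2)"

definition agenda :: "nat set \<Rightarrow> real \<Rightarrow> (nat \<Rightarrow> coins) \<Rightarrow> (nat \<times> nat) list" where
  "agenda V l \<omega> = sort_key (\<lambda>(v, j). event_time (\<omega> v) j)
     (concat (map (\<lambda>v. map (Pair v) [0..<event_count l (\<omega> v)]) (sorted_list_of_set V)))"

text \<open>After the agenda is exhausted the chain goes on with coins that no node uses.\<close>

definition proposal :: "nat set \<Rightarrow> real \<Rightarrow> nat \<Rightarrow> (nat \<Rightarrow> coins) \<Rightarrow> nat \<Rightarrow> nat \<times> nat" where
  "proposal V l q \<omega> i =
     (if i < length (agenda V l \<omega>)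
      then let (v, j) = agenda V l \<omega> ! i in (v, event_colour q (\<omega> v) j)
      else (sorted_list_of_set V ! pick (card V) (\<omega> (Min V) (5 * i + 3)), Suc (pick q (\<omega> (Min V) (5 * i + 4)))))"

lemma set_agenda:
  assumes "finite V"
  shows "set (agenda V l \<omega>) = Sigma V (\<lambda>v. {..<event_count l (\<omega> v)})" "distinct (agenda V l \<omega>)"
proof -
  show "set (agenda V l \<omega>) = Sigma V (\<lambda>v. {..<event_count l (\<omega> v)})"
    using assms by (auto simp: agenda_def)
  have "distinct (concat (map (\<lambda>v. map (Pair v) [0..<event_count l (\<omega> v)]) vs))" if "distinct vs" for vs
    using that by (induction vs) (auto simp: distinct_map inj_on_def)
  then show "distinct (agenda V l \<omega>)" by (simp add: agenda_def)
qed

lemma count_list_map_fst: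
  assumes "distinct xs" "set xs = Sigma V (\<lambda>v. {..<k v})" "v \<in> V"
  shows "count_list (map fst xs) v = k v"
proof -
  have "count_list (map fst xs) v = length (filter (\<lambda>e. fst e = v) xs)"
    by (induction xs) auto
  also have "\<dots> = card {e \<in> set xs. fst e = v}"
    using assms(1) by (simp flip: distinct_card[OF distinct_filter])
  also have "{e \<in> set xs. fst e = v} = Pair v ` {..<k v}"
    unfolding assms(2) using assms(3) by auto
  also have "card \<dots> = k v" by (subst card_image) (auto simp: inj_on_def)
  finally show ?thesis .
qed

context coins_space
begin

text \<open>An almost sure condition under which the combinatorial statements hold pointwise:
  strictly ordered event times, and proposals inside \<open>V \<times> {1..q}\<close>.\<close>

definition good :: "(nat \<Rightarrow> coins) \<Rightarrow> bool" where
  "good \<omega> \<longleftrightarrow> (\<forall>z\<in>V \<times> UNIV. 0 \<le> coin_at z \<omega> \<and> coin_at z \<omega> < 1) \<and>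
     (\<forall>z\<in>V \<times> UNIV. \<forall>z'\<in>V \<times> UNIV. z \<noteq> z' \<longrightarrow> coin_at z \<omega> \<noteq> coin_at z' \<omega>)"

lemma AE_good: "AE \<omega> in P. good \<omega>"
  unfolding good_def
proof (intro AE_conjI)
  show "AE \<omega> in P. \<forall>z\<in>V \<times> UNIV. 0 \<le> coin_at z \<omega> \<and> coin_at z \<omega> < 1"
    using AE_coin_range by (intro AE_ball_countable') (auto intro: countableI_type)
  show "AE \<omega> in P. \<forall>z\<in>V \<times> UNIV. \<forall>z'\<in>V \<times> UNIV. z \<noteq> z' \<longrightarrow> coin_at z \<omega> \<noteq> coin_at z' \<omega>"
  proof (intro AE_ball_countable' countableI_type)
    fix z z' assume "z \<in> V \<times> (UNIV :: nat set)" "z' \<in> V \<times> (UNIV :: nat set)"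
    then show "AE \<omega> in P. z \<noteq> z' \<longrightarrow> coin_at z \<omega> \<noteq> coin_at z' \<omega>"
      using AE_no_tie[of z z'] by (cases "z = z'") auto
  qed
qed

lemma inj_event_time:
  assumes "good \<omega>"
  shows "inj_on (\<lambda>(v, j). event_time (\<omega> v) j) (V \<times> UNIV)"
proof (rule inj_onI)
  fix y z assume yz: "y \<in> V \<times> UNIV" "z \<in> V \<times> UNIV"
    and eq: "(case y of (v, j) \<Rightarrow> event_time (\<omega> v) j) = (case z of (v, j) \<Rightarrow> event_time (\<omega> v) j)"
  have "coin_at (fst y, 5 * snd y + 2) \<omega> = coin_at (fst z, 5 * snd z + 2) \<omega>"
    using eq by (simp add: coin_at_def event_time_def case_prod_unfold)
  moreover have "(fst y, 5 * snd y + 2) \<in> V \<times> UNIV" "(fst z, 5 * snd z + 2) \<in> V \<times> UNIV" using yz by auto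
  ultimately have "(fst y, 5 * snd y + 2) = (fst z, 5 * snd z + 2)" using assms unfolding good_def by metis
  then show "y = z" by (simp add: prod_eq_iff)
qed

lemma agenda_sorted:
  assumes "good \<omega>"
  shows "sorted_wrt (<) (map (\<lambda>(v, j). event_time (\<omega> v) j) (agenda V l \<omega>))"
proof -
  let ?f = "\<lambda>(v, j). event_time (\<omega> v) j"
  have "set (agenda V l \<omega>) \<subseteq> V \<times> UNIV" using set_agenda(1)[OF finite_V] by auto
  then have "inj_on ?f (set (agenda V l \<omega>))" using inj_event_time[OF assms] inj_on_subset by blast
  then have "distinct (map ?f (agenda V l \<omega>))" using set_agenda(2)[OF finite_V] by (simp add: distinct_map)
  moreover have "sorted (map ?f (agenda V l \<omega>))" unfolding agenda_def by (rule sorted_sort_key)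
  ultimately show ?thesis by (simp add: strict_sorted_iff)
qed

end

section \<open>Measurability of the agenda and the proposals\<close>

context coins_space
begin

lemma measurable_any_coin [measurable]: "(\<lambda>\<omega>. \<omega> v k) \<in> borel_measurable P"
proof (cases "v \<in> V")
  case False
  have "\<omega> v k = (undefined :: coins) k" if "\<omega> \<in> space P" for \<omega>
  proof -
    have "\<omega> \<in> Pi\<^sub>E V (\<lambda>_. space node_coins)" using that by (simp only: coin_space_def space_PiM)
    then have "\<omega> v = undefined" using False by (rule PiE_arb)
    then show ?thesis by (rule fun_cong)
  qed
  then have "(\<lambda>\<omega>. \<omega> v k) \<in> borel_measurable P \<longleftrightarrow> (\<lambda>\<omega>. (undefined :: coins) k) \<in> borel_measurable P"
    by (rule measurable_cong)
  moreover have "(\<lambda>\<omega>. (undefined :: coins) k) \<in> borel_measurable P" by (rule measurable_const) simp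
  ultimately show ?thesis by (rule iffD2)
qed (rule measurable_coin)

lemma measurable_combine:
  fixes g :: "(nat \<Rightarrow> coins) \<Rightarrow> 'a::countable" and h :: "(nat \<Rightarrow> coins) \<Rightarrow> 'b::countable"
  assumes "g \<in> measurable P (count_space UNIV)" "h \<in> measurable P (count_space UNIV)"
  shows "(\<lambda>\<omega>. F (g \<omega>) (h \<omega>)) \<in> measurable P (count_space UNIV)"
  by (rule measurable_compose_countable[OF _ assms(1)], rule measurable_compose[OF assms(2)]) simp

lemma measurable_insort:
  "(\<lambda>\<omega>. insort_key (\<lambda>(v, j). event_time (\<omega> v) j) x ys) \<in> measurable P (count_space UNIV)"
proof (induction ys)
  case (Cons y ys)
  have [measurable]: "Measurable.pred P (\<lambda>\<omega>. (case x of (v, j) \<Rightarrow> event_time (\<omega> v) j) \<le> (case y of (v, j) \<Rightarrow> event_time (\<omega> v) j))"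
    unfolding event_time_def case_prod_unfold pred_def
    by (rule borel_measurable_le[OF measurable_any_coin measurable_any_coin])
  have [measurable]: "(\<lambda>\<omega>. y # insort_key (\<lambda>(v, j). event_time (\<omega> v) j) x ys) \<in> measurable P (count_space UNIV)"
    by (rule measurable_compose[OF Cons]) simp
  show ?case unfolding insort_key.simps by measurable
qed simp

lemma measurable_sort:
  "(\<lambda>\<omega>. sort_key (\<lambda>(v, j). event_time (\<omega> v) j) xs) \<in> measurable P (count_space UNIV)"
proof (induction xs)
  case (Cons x xs)
  have "(\<lambda>\<omega>. insort_key (\<lambda>(v, j). event_time (\<omega> v) j) x (sort_key (\<lambda>(v, j). event_time (\<omega> v) j) xs))
      \<in> measurable P (count_space UNIV)"
    by (rule measurable_compose_countable[OF measurable_insort Cons])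
  then show ?case by simp
qed simp

lemma measurable_agenda: "agenda V l \<in> measurable P (count_space UNIV)"
proof -
  have "(\<lambda>\<omega>. concat (map (\<lambda>v. map (Pair v) [0..<event_count l (\<omega> v)]) vs)) \<in> measurable P (count_space UNIV)" for vs
  proof (induction vs)
    case (Cons v vs)
    have "(\<lambda>\<omega>. event_count l (\<omega> v)) \<in> measurable P (count_space UNIV)"
      unfolding event_count_def by measurable
    from measurable_combine[OF this Cons, of "\<lambda>k ys. map (Pair v) [0..<k] @ ys"] show ?case by simp
  qed simp
  then show ?thesis unfolding agenda_def by (rule measurable_compose_countable[OF measurable_sort])
qed

lemma measurable_proposal: "(\<lambda>\<omega>. proposal V l q \<omega> i) \<in> measurable P (count_space UNIV)"
proof -
  have pk: "(\<lambda>\<omega>. pick m (\<omega> v k)) \<in> measurable P (count_space UNIV)" for m v k by measurable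
  have ext: "(\<lambda>\<omega>. (sorted_list_of_set V ! pick (card V) (\<omega> (Min V) (5 * i + 3)), Suc (pick q (\<omega> (Min V) (5 * i + 4)))))
      \<in> measurable P (count_space UNIV)"
    using measurable_combine[OF pk pk, of "\<lambda>a b. (sorted_list_of_set V ! a, Suc b)"] .
  have ev: "(\<lambda>\<omega>. (v, event_colour q (\<omega> v) j)) \<in> measurable P (count_space UNIV)" for v j
    unfolding event_colour_def by (rule measurable_compose[OF pk]) simp
  have "(\<lambda>\<omega>. if i < length xs then let (v, j) = xs ! i in (v, event_colour q (\<omega> v) j)
      else (sorted_list_of_set V ! pick (card V) (\<omega> (Min V) (5 * i + 3)), Suc (pick q (\<omega> (Min V) (5 * i + 4)))))
      \<in> measurable P (count_space UNIV)" for xs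
    using ev[of "fst (xs ! i)" "snd (xs ! i)"] ext by (cases "i < length xs") (simp_all add: Let_def case_prod_unfold)
  then show ?thesis unfolding proposal_def by (rule measurable_compose_countable[OF _ measurable_agenda])
qed

lemma measurable_proposals: "(\<lambda>\<omega>. map (proposal V l q \<omega>) [0..<t]) \<in> measurable P (count_space UNIV)"
proof (induction t)
  case (Suc t)
  from measurable_combine[OF Suc measurable_proposal, of "\<lambda>xs x. xs @ [x]"] show ?case by simp
qed simp

end

locale sampler = coins_space +
  fixes l :: real and q :: nat
  assumes l: "0 \<le> l" and q: "0 < q"
begin

abbreviation "vs \<equiv> sorted_list_of_set V"
abbreviation "N \<equiv> \<lambda>\<omega>. length (agenda V l \<omega>)"
abbreviation "W \<equiv> proposal V l q"
abbreviation "run_event m t ws \<equiv> {\<omega> \<in> space P. N \<omega> = m \<and> map (W \<omega>) [0..<t] = ws}"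
abbreviation "D \<equiv> V \<times> {1..q}"

definition position :: "nat \<Rightarrow> nat" where
  "position v = inv_into {..<card V} ((!) vs) v"

lemma card_V: "0 < card V"
  using finite_V V_nonempty by (simp add: card_gt_0_iff)

lemma position:
  assumes "v \<in> V"
  shows "position v < card V" "i < card V \<Longrightarrow> vs ! i = v \<longleftrightarrow> i = position v"
proof -
  have img: "(!) vs ` {..<card V} = V"
  proof -
    have "set vs = (!) vs ` {..<length vs}" by (auto simp: set_conv_nth)
    then show ?thesis using finite_V by simp
  qed
  have inj: "inj_on ((!) vs) {..<card V}" by (auto simp: inj_on_def nth_eq_iff_index_eq)
  have v: "v \<in> (!) vs ` {..<card V}" using assms img by simp
  show "position v < card V" using inv_into_into[OF v] by (simp add: position_def)
  show "vs ! i = v \<longleftrightarrow> i = position v" if "i < card V"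
    using f_inv_into_f[OF v] inv_into_f_f[OF inj, of i] that by (auto simp: position_def)
qed

lemma measurable_N: "N \<in> measurable P (count_space UNIV)"
  by (rule measurable_compose[OF measurable_agenda]) simp

lemma joint_event: "{\<omega> \<in> space P. N \<omega> = m \<and> map (W \<omega>) [0..<t] \<in> S} \<in> events"
proof -
  have "(\<lambda>\<omega>. (N \<omega>, map (W \<omega>) [0..<t])) \<in> measurable P (count_space UNIV)"
    using measurable_combine[OF measurable_N measurable_proposals, of Pair] .
  from measurable_sets[OF this, of "{m} \<times> S"] show ?thesis by (simp add: vimage_def Int_def conj_commute)
qed

lemma good_proposal_in: "good \<omega> \<Longrightarrow> W \<omega> i \<in> D"
proof -
  assume g: "good \<omega>"
  have c: "0 \<le> \<omega> v k \<and> \<omega> v k < 1" if "v \<in> V" for v k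
    using g that unfolding good_def coin_at_def by force
  have pq: "Suc (pick q (\<omega> v k)) \<in> {1..q}" if "v \<in> V" for v k
    using pick_less[of "\<omega> v k" q] c[OF that] q by simp
  have M: "Min V \<in> V" using finite_V V_nonempty by simp
  show ?thesis
  proof (cases "i < N \<omega>")
    case True
    then have "agenda V l \<omega> ! i \<in> Sigma V (\<lambda>v. {..<event_count l (\<omega> v)})"
      using set_agenda(1)[OF finite_V] nth_mem by blast
    then show ?thesis using True pq by (auto simp: proposal_def event_colour_def)
  next
    case False
    have "pick (card V) (\<omega> (Min V) (5 * i + 3)) < length vs"
      using pick_less c[OF M] card_V by simp
    then have "vs ! pick (card V) (\<omega> (Min V) (5 * i + 3)) \<in> V"
      using nth_mem finite_V by (metis set_sorted_list_of_set)
    then show ?thesis using False pq[OF M] by (simp add: proposal_def)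
  qed
qed

text \<open>An agenda xs fixes the number of events of every node, so it occurs with the first t proposals
  ws exactly when the coins lie in a cylinder and the event times are increasing along xs.\<close>

definition slots :: "nat \<Rightarrow> nat \<Rightarrow> (nat \<times> nat) list \<Rightarrow> (nat \<times> nat) list" where
  "slots m t xs = map (\<lambda>v. (v, 0)) vs @ map (\<lambda>e. (fst e, 5 * snd e + 1)) xs @
     map (\<lambda>i. (Min V, 5 * i + 3)) [m..<t] @ map (\<lambda>i. (Min V, 5 * i + 4)) [m..<t]"

text \<open>For each coin listed in \<open>slots\<close>, the set it has to lie in. Colors start at
  1 and are \<open>Suc\<close> of a pick, hence the subtraction.\<close>

definition slot_sets :: "nat \<Rightarrow> nat \<Rightarrow> (nat \<times> nat) list \<Rightarrow> real set list" where
  "slot_sets m t ws = map (\<lambda>v. {x. poisson_quantile l x = count_list (map fst (take m ws)) v}) vs @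
     map (\<lambda>w. {x. pick q x = snd w - 1}) (take m ws) @
     map (\<lambda>i. {x. pick (card V) x = position (fst (ws ! i))}) [m..<t] @
     map (\<lambda>i. {x. pick q x = snd (ws ! i) - 1}) [m..<t]"

definition agendas :: "nat list \<Rightarrow> (nat \<times> nat) list set" where
  "agendas ls = {xs. map fst xs = ls \<and> distinct xs \<and> set xs = Sigma V (\<lambda>v. {..<count_list ls v})}"

lemma mem_cylinder_slots:
  assumes "length xs = m" "m \<le> t" "length ws = t"
  shows "\<omega> \<in> cylinder (slots m t xs) (slot_sets m t ws) \<longleftrightarrow> \<omega> \<in> space P \<and>
    (\<forall>v\<in>V. event_count l (\<omega> v) = count_list (map fst (take m ws)) v) \<and>
    (\<forall>i<m. pick q (\<omega> (fst (xs ! i)) (5 * snd (xs ! i) + 1)) = snd (ws ! i) - 1) \<and>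
    (\<forall>i\<in>{m..<t}. pick (card V) (\<omega> (Min V) (5 * i + 3)) = position (fst (ws ! i))) \<and>
    (\<forall>i\<in>{m..<t}. pick q (\<omega> (Min V) (5 * i + 4)) = snd (ws ! i) - 1)"
proof -
  let ?R = "\<lambda>z B. coin_at z \<omega> \<in> B"
  have same: "list_all2 ?R (map f as) (map g as) \<longleftrightarrow> (\<forall>a\<in>set as. ?R (f a) (g a))" for f g and as :: "nat list"
    by (induction as) auto
  have mid: "list_all2 ?R (map f xs) (map g (take m ws)) \<longleftrightarrow> (\<forall>i<m. ?R (f (xs ! i)) (g (ws ! i)))" for f g
    using assms by (simp add: list_all2_conv_all_nth)
  show ?thesis
    unfolding cylinder_def slots_def slot_sets_def mem_Collect_eq
    by (simp only: list_all2_append length_map length_take assms(1,3) min.absorb2[OF assms(2)] same mid)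
      (simp add: coin_at_def event_count_def finite_V)
qed

text \<open>Forwards the witness is the actual agenda. Backwards, the counts give \<open>xs\<close>
  and the agenda the same elements, and a strictly increasing list is determined by its set. The
  choice of \<open>xs\<close> is the attribution of the updates at v to the events of v.\<close>

lemma agenda_iff:
  assumes good: "good \<omega>" and sp: "\<omega> \<in> space P" and ws: "ws \<in> seqs D t" and "m \<le> t"
  shows "N \<omega> = m \<and> map (W \<omega>) [0..<t] = ws \<longleftrightarrow>
    (\<exists>xs\<in>agendas (map fst (take m ws)).
       \<omega> \<in> increasing_on (map (\<lambda>e. (fst e, 5 * snd e + 2)) xs) \<inter> cylinder (slots m t xs) (slot_sets m t ws))"
proof -
  let ?ls = "map fst (take m ws)" and ?z = "\<lambda>e. (fst e, 5 * snd e + 2)"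
  let ?T = "\<lambda>(v, j). event_time (\<omega> v) j"
  have len: "length ws = t" using ws by (simp add: seqs_def)
  have times: "map (\<lambda>z. coin_at z \<omega>) (map ?z xs) = map ?T xs" for xs
    by (simp add: coin_at_def event_time_def case_prod_unfold)
  have wsD: "fst (ws ! i) \<in> V" "1 \<le> snd (ws ! i)" if "i < t" for i
  proof -
    have "ws ! i \<in> set ws" using that len by simp
    moreover have "set ws \<subseteq> D" using ws by (simp add: seqs_def)
    ultimately have "ws ! i \<in> D" by (rule rev_subsetD)
    then show "fst (ws ! i) \<in> V" "1 \<le> snd (ws ! i)" by (simp_all add: mem_Times_iff)
  qed
  have c: "0 \<le> \<omega> v k \<and> \<omega> v k < 1" if "v \<in> V" for v k
    using good that unfolding good_def coin_at_def by force
  have M: "Min V \<in> V" using finite_V V_nonempty by simp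
  have W_map: "map (W \<omega>) [0..<t] = ws \<longleftrightarrow> (\<forall>i<t. W \<omega> i = ws ! i)"
    using len by (auto simp: list_eq_iff_nth_eq)
  have ext: "W \<omega> i = ws ! i \<longleftrightarrow> pick (card V) (\<omega> (Min V) (5 * i + 3)) = position (fst (ws ! i)) \<and>
      pick q (\<omega> (Min V) (5 * i + 4)) = snd (ws ! i) - 1" if "\<not> i < N \<omega>" "i < t" for i
    using that position(2)[OF wsD(1)[OF that(2)]] pick_less[of "\<omega> (Min V) (5 * i + 3)" "card V"] c[OF M] card_V wsD(2)[OF that(2)]
    by (auto simp: proposal_def prod_eq_iff)
  have int: "W \<omega> i = ws ! i \<longleftrightarrow> fst (agenda V l \<omega> ! i) = fst (ws ! i) \<and>
      pick q (\<omega> (fst (agenda V l \<omega> ! i)) (5 * snd (agenda V l \<omega> ! i) + 1)) = snd (ws ! i) - 1" if "i < N \<omega>" "i < t" for i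
    using that wsD(2)[OF that(2)] by (auto simp: proposal_def event_colour_def prod_eq_iff Let_def case_prod_unfold)
  show ?thesis
  proof
    assume *: "N \<omega> = m \<and> map (W \<omega>) [0..<t] = ws"
    let ?xs = "agenda V l \<omega>"
    have W: "W \<omega> i = ws ! i" if "i < t" for i using * that W_map by blast
    have ls: "map fst ?xs = ?ls"
      using * W int len \<open>m \<le> t\<close> by (intro nth_equalityI) auto
    have cnt: "event_count l (\<omega> v) = count_list ?ls v" if "v \<in> V" for v
      using count_list_map_fst[OF set_agenda(2)[OF finite_V] set_agenda(1)[OF finite_V] that] ls by metis
    then have "set ?xs = Sigma V (\<lambda>v. {..<count_list ?ls v})"
      using set_agenda(1)[OF finite_V, of l \<omega>] by (simp cong: Sigma_cong)
    then have "?xs \<in> agendas ?ls" using ls set_agenda(2)[OF finite_V] by (simp add: agendas_def)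
    moreover have "\<omega> \<in> increasing_on (map ?z ?xs)"
      by (simp only: increasing_on_def mem_Collect_eq times agenda_sorted[OF good] sp)
    moreover have "\<omega> \<in> cylinder (slots m t ?xs) (slot_sets m t ws)"
    proof (subst mem_cylinder_slots)
      have "pick q (\<omega> (fst (?xs ! i)) (5 * snd (?xs ! i) + 1)) = snd (ws ! i) - 1" if "i < m" for i
      proof -
        have "i < N \<omega>" "i < t" using that * \<open>m \<le> t\<close> by simp_all
        then show ?thesis using int[of i] W[of i] by blast
      qed
      moreover have "pick (card V) (\<omega> (Min V) (5 * i + 3)) = position (fst (ws ! i)) \<and>
          pick q (\<omega> (Min V) (5 * i + 4)) = snd (ws ! i) - 1" if "i \<in> {m..<t}" for i
      proof -
        have "\<not> i < N \<omega>" "i < t" using that * by simp_all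
        then show ?thesis using ext[of i] W[of i] by blast
      qed
      ultimately show "\<omega> \<in> space P \<and> (\<forall>v\<in>V. event_count l (\<omega> v) = count_list ?ls v) \<and>
        (\<forall>i<m. pick q (\<omega> (fst (?xs ! i)) (5 * snd (?xs ! i) + 1)) = snd (ws ! i) - 1) \<and>
        (\<forall>i\<in>{m..<t}. pick (card V) (\<omega> (Min V) (5 * i + 3)) = position (fst (ws ! i))) \<and>
        (\<forall>i\<in>{m..<t}. pick q (\<omega> (Min V) (5 * i + 4)) = snd (ws ! i) - 1)"
        using sp cnt by blast
    qed (use * len \<open>m \<le> t\<close> in simp_all)
    ultimately show "\<exists>xs\<in>agendas ?ls. \<omega> \<in> increasing_on (map ?z xs) \<inter> cylinder (slots m t xs) (slot_sets m t ws)"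
      by blast
  next
    assume "\<exists>xs\<in>agendas ?ls. \<omega> \<in> increasing_on (map ?z xs) \<inter> cylinder (slots m t xs) (slot_sets m t ws)"
    then obtain xs where xs: "xs \<in> agendas ?ls" "\<omega> \<in> increasing_on (map ?z xs)"
      "\<omega> \<in> cylinder (slots m t xs) (slot_sets m t ws)" by blast
    have fst_xs: "map fst xs = ?ls" and set_xs: "set xs = Sigma V (\<lambda>v. {..<count_list ?ls v})"
      using xs(1) by (simp_all add: agendas_def)
    have m: "length xs = m" using fst_xs len \<open>m \<le> t\<close> by (metis length_map length_take min.absorb2)
    note cyl = xs(3)[unfolded mem_cylinder_slots[OF m \<open>m \<le> t\<close> len]]
    have "set (agenda V l \<omega>) = set xs"
      unfolding set_agenda(1)[OF finite_V] set_xs using cyl by (auto cong: Sigma_cong)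
    moreover have "sorted_wrt (<) (map ?T xs)" using xs(2) by (simp only: increasing_on_def mem_Collect_eq times)
    ultimately have ag: "agenda V l \<omega> = xs" using agenda_sorted[OF good] by (intro strictly_sorted_unique)
    have fx: "fst (xs ! i) = fst (ws ! i)" if "i < m" for i
      using arg_cong[OF fst_xs, of "\<lambda>ys. ys ! i"] that m len \<open>m \<le> t\<close> by simp
    have "W \<omega> i = ws ! i" if "i < t" for i
    proof (cases "i < m")
      case True
      then have "i < N \<omega>" using ag m by simp
      then show ?thesis unfolding int[OF \<open>i < N \<omega>\<close> that] unfolding ag using cyl fx True by blast
    next
      case False
      then have "\<not> i < N \<omega>" "i \<in> {m..<t}" using ag m that by simp_all
      then show ?thesis unfolding ext[OF \<open>\<not> i < N \<omega>\<close> that] using cyl by blast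
    qed
    then show "N \<omega> = m \<and> map (W \<omega>) [0..<t] = ws" using ag m W_map by simp
  qed
qed

end

section \<open>The law of the number of updates and of the proposals\<close>

lemma distinct_append_mod:
  fixes as bs :: "('a \<times> nat) list"
  assumes "distinct as" "distinct bs" "\<And>a. a \<in> set as \<Longrightarrow> snd a mod 5 = r" "\<And>b. b \<in> set bs \<Longrightarrow> snd b mod 5 \<noteq> r"
  shows "distinct (as @ bs)"
  using assms by auto

lemma prod_list_const:
  fixes f :: "'a \<Rightarrow> 'b::monoid_mult"
  shows "(\<And>y. y \<in> set ys \<Longrightarrow> f y = c) \<Longrightarrow> prod_list (map f ys) = c ^ length ys"
  by (induction ys) auto

context sampler
begin

lemma distinct_slots:
  assumes "distinct xs"
  shows "distinct (map (\<lambda>e. (fst e, 5 * snd e + 2)) xs @ slots m t xs)"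
proof -
  have inj: "distinct (map (\<lambda>e. (fst e, 5 * snd e + k)) xs)" for k
    using assms by (auto simp: distinct_map inj_on_def prod_eq_iff)
  have ext: "distinct (map (\<lambda>i. (v, 5 * i + k)) [m..<t])" for v k :: nat
    by (auto simp: distinct_map inj_on_def)
  have md: "snd a mod 5 = k mod 5" if "a \<in> set (map (\<lambda>e. (fst e, 5 * snd e + k)) xs)" for a :: "nat \<times> nat" and k
    using that by auto
  have me: "snd a mod 5 = k mod 5" if "a \<in> set (map (\<lambda>i. (v, 5 * i + k)) [m..<t])" for a :: "nat \<times> nat" and v k
    using that by auto
  have m0: "snd a mod 5 = 0" if "a \<in> set (map (\<lambda>v. (v, 0)) vs)" for a :: "nat \<times> nat"
    using that by auto
  have vs: "distinct (map (\<lambda>v. (v, 0::nat)) vs)" by (auto simp: distinct_map inj_on_def)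
  let ?e3 = "map (\<lambda>i. (Min V, 5 * i + 3)) [m..<t]" and ?e4 = "map (\<lambda>i. (Min V, 5 * i + 4)) [m..<t]"
  let ?c = "map (\<lambda>e. (fst e, 5 * snd e + 1)) xs"
  have s3: "snd a mod 5 = 3 \<or> snd a mod 5 = 4" if "a \<in> set (?e3 @ ?e4)" for a
    using that me[of a _ 3] me[of a _ 4] unfolding set_append by force
  have s2: "snd a mod 5 = 1 \<or> snd a mod 5 = 3 \<or> snd a mod 5 = 4" if "a \<in> set (?c @ ?e3 @ ?e4)" for a
    using that md[of a 1] s3[of a] unfolding set_append by force
  have s1: "snd a mod 5 = 0 \<or> snd a mod 5 = 1 \<or> snd a mod 5 = 3 \<or> snd a mod 5 = 4"
    if "a \<in> set (map (\<lambda>v. (v, 0)) vs @ ?c @ ?e3 @ ?e4)" for a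
    using that m0[of a] s2[of a] unfolding set_append by force
  have "distinct (?e3 @ ?e4)"
    by (rule distinct_append_mod[of _ _ 3, OF ext ext]) (use me[of _ _ 3] me[of _ _ 4] in force)+
  then have "distinct (?c @ ?e3 @ ?e4)"
    by (rule distinct_append_mod[of _ _ 1, OF inj]) (use md[of _ 1] s3 in force)+
  then have "distinct (map (\<lambda>v. (v, 0)) vs @ ?c @ ?e3 @ ?e4)"
    by (rule distinct_append_mod[of _ _ 0, OF vs]) (use m0 s2 in force)+
  then show ?thesis unfolding slots_def
    by (rule distinct_append_mod[of _ _ 2, OF inj]) (use md[of _ 2] s1 in force)+
qed

lemma slots_subset:
  "set xs \<subseteq> V \<times> UNIV \<Longrightarrow> set (map (\<lambda>e. (fst e, 5 * snd e + 2)) xs @ slots m t xs) \<subseteq> V \<times> UNIV"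
  using finite_V Min_in[OF finite_V V_nonempty] by (auto simp: slots_def)

lemma length_slot_sets: "length xs = m \<Longrightarrow> m \<le> t \<Longrightarrow> length ws = t \<Longrightarrow> length (slot_sets m t ws) = length (slots m t xs)"
  by (simp add: slots_def slot_sets_def)

lemma slot_sets_borel: "B \<in> set (slot_sets m t ws) \<Longrightarrow> B \<in> sets borel"
proof -
  have "{x. poisson_quantile l x = k} \<in> sets borel" "{x. pick j x = k} \<in> sets borel" for j k by measurable
  then show "B \<in> set (slot_sets m t ws) \<Longrightarrow> B \<in> sets borel" unfolding slot_sets_def by auto
qed

lemma prod_slot_sets:
  assumes ws: "ws \<in> seqs D t" and "m \<le> t"
  shows "prod_list (map (measure unif) (slot_sets m t ws)) =
    (\<Prod>v\<in>V. poisson_weight l (count_list (map fst (take m ws)) v)) * (1 / real q) ^ m * (1 / real (card V)) ^ (t - m) * (1 / real q) ^ (t - m)"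
proof -
  have len: "length ws = t" and sub: "set ws \<subseteq> D" using ws by (simp_all add: seqs_def)
  have nth: "ws ! i \<in> D" if "i < t" for i using sub that len nth_mem by blast
  have pk: "measure unif {x. pick q x = snd w - 1} = 1 / real q" if "w \<in> D" for w
    using that by (intro measure_pick) auto
  have p1: "prod_list (map (\<lambda>v. measure unif {x. poisson_quantile l x = count_list (map fst (take m ws)) v}) vs) =
      (\<Prod>v\<in>V. poisson_weight l (count_list (map fst (take m ws)) v))"
    using finite_V prod.distinct_set_conv_list[of vs "\<lambda>v. poisson_weight l (count_list (map fst (take m ws)) v)"]
    by (simp add: measure_poisson_quantile[OF l])
  have p2: "prod_list (map (\<lambda>w. measure unif {x. pick q x = snd w - 1}) (take m ws)) = (1 / real q) ^ m"
  proof (subst prod_list_const[where c = "1 / real q"])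
    show "measure unif {x. pick q x = snd w - 1} = 1 / real q" if "w \<in> set (take m ws)" for w
      using in_set_takeD[OF that] sub by (intro pk) (rule subsetD)
  qed (use len \<open>m \<le> t\<close> in simp)
  have p3: "prod_list (map (\<lambda>i. measure unif {x. pick (card V) x = position (fst (ws ! i))}) [m..<t]) = (1 / real (card V)) ^ (t - m)"
  proof (subst prod_list_const[where c = "1 / real (card V)"])
    fix i assume "i \<in> set [m..<t]"
    then have "fst (ws ! i) \<in> V" using nth[of i] by auto
    then show "measure unif {x. pick (card V) x = position (fst (ws ! i))} = 1 / real (card V)"
      by (intro measure_pick position)
  qed simp
  have p4: "prod_list (map (\<lambda>i. measure unif {x. pick q x = snd (ws ! i) - 1}) [m..<t]) = (1 / real q) ^ (t - m)"
  proof (subst prod_list_const[where c = "1 / real q"])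
    fix i assume "i \<in> set [m..<t]"
    then show "measure unif {x. pick q x = snd (ws ! i) - 1} = 1 / real q" using nth[of i] by (intro pk) simp
  qed simp
  show ?thesis unfolding slot_sets_def map_append prod_list.append map_map comp_def p1 p2 p3 p4
    by (simp only: mult.assoc)
qed

text \<open>For one agenda the cylinder has the product of the Poisson weights of the counts times
  the uniform picks, and the required order of the times costs 1 / m!. The number of agendas is the
  product of the factorials of the counts, which cancels those in the weights. What remains,
  \<open>exp (- l) ^ card V * l ^ m / fact m\<close>, is the Poisson weight of mean n l divided by n
  ^ m, and nothing depends on \<open>ws\<close>.\<close>

lemma joint_law_ge:
  assumes ws: "ws \<in> seqs D t" and mt: "m \<le> t"
  shows "prob (run_event m t ws) =
    poisson_weight (real (card V) * l) m / real (card V * q) ^ t"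
proof -
  let ?ls = "map fst (take m ws)"
  let ?z = "\<lambda>e. (fst e, 5 * snd e + 2)"
  let ?Q = "\<lambda>xs. increasing_on (map ?z xs) \<inter> cylinder (slots m t xs) (slot_sets m t ws)"
  let ?A = "agendas ?ls"
  let ?pr = "prod_list (map (measure unif) (slot_sets m t ws))"
  have len: "length ws = t" and sub: "set ws \<subseteq> D" using ws by (simp_all add: seqs_def)
  have lsV: "set ?ls \<subseteq> V" using sub by (auto dest: in_set_takeD)
  have xs: "distinct xs" "set xs \<subseteq> V \<times> UNIV" "length xs = m" if "xs \<in> ?A" for xs
  proof -
    show "distinct xs" "set xs \<subseteq> V \<times> UNIV" using that by (auto simp: agendas_def)
    have "length (map fst xs) = length ?ls" using that by (simp add: agendas_def)
    then show "length xs = m" using len mt by simp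
  qed
  have prQ: "prob (?Q xs) = ?pr / fact m" and evQ: "?Q xs \<in> events" if "xs \<in> ?A" for xs
  proof -
    note a = distinct_slots[OF xs(1)[OF that], of m t] slots_subset[OF xs(2)[OF that], of m t]
      length_slot_sets[OF xs(3)[OF that] mt len] slot_sets_borel[of _ m t ws]
    show "prob (?Q xs) = ?pr / fact m"
      using prob_increasing_cylinder[OF a] xs(3)[OF that] by simp
    show "?Q xs \<in> events" using prob_increasing_cylinder_eq(2)[OF a] .
  qed
  have "finite ?A"
  proof (rule finite_subset)
    let ?S = "Sigma V (\<lambda>v. {..<count_list ?ls v})"
    show "finite {xs. set xs \<subseteq> ?S \<and> length xs = m}" using finite_V by (intro finite_lists_length_eq) auto
    show "?A \<subseteq> {xs. set xs \<subseteq> ?S \<and> length xs = m}"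
    proof (rule subsetI, rule CollectI, rule conjI)
      fix x assume x: "x \<in> ?A"
      then have "set x = ?S" by (simp only: agendas_def mem_Collect_eq)
      then show "set x \<subseteq> ?S" by (rule equalityD1)
      show "length x = m" by (rule xs(3)[OF x])
    qed
  qed
  note fin = this
  have disj: "disjoint_family_on ?Q ?A"
    unfolding disjoint_family_on_def
  proof (intro ballI impI equals0I)
    fix x y \<omega> assume xy: "x \<in> ?A" "y \<in> ?A" "x \<noteq> y" and \<omega>: "\<omega> \<in> ?Q x \<inter> ?Q y"
    have "sorted_wrt (<) (map (\<lambda>e. coin_at (?z e) \<omega>) u)" if "\<omega> \<in> increasing_on (map ?z u)" for u
      using that unfolding increasing_on_def by (simp only: mem_Collect_eq map_map comp_def)
    from this[OF IntD1[OF IntD1[OF \<omega>]]] this[OF IntD1[OF IntD2[OF \<omega>]]]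
    have "x = y"
    proof (rule strictly_sorted_unique)
      show "set x = set y" using xy(1,2) unfolding agendas_def by (simp only: mem_Collect_eq)
    qed
    then show False using xy(3) by simp
  qed
  have "prob (run_event m t ws) = prob (\<Union>xs\<in>?A. ?Q xs)"
  proof (rule finite_measure_eq_AE)
    show "AE \<omega> in P. \<omega> \<in> run_event m t ws \<longleftrightarrow> \<omega> \<in> (\<Union>xs\<in>?A. ?Q xs)"
      using AE_good AE_space
    proof eventually_elim
      case (elim \<omega>)
      show ?case using agenda_iff[OF elim(1,2) ws mt] elim(2) by (simp only: mem_Collect_eq UN_iff simp_thms)
    qed
    show "run_event m t ws \<in> events"
      using joint_event[of m t "{ws}"] by simp
    show "(\<Union>xs\<in>?A. ?Q xs) \<in> events" using fin evQ by (rule sets.finite_UN)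
  qed
  also have "\<dots> = (\<Sum>xs\<in>?A. prob (?Q xs))"
    using fin evQ disj by (intro finite_measure_finite_Union) auto
  also have "\<dots> = real (card ?A) * (?pr / fact m)" using prQ by simp
  also have "card ?A = (\<Prod>v\<in>V. fact (count_list ?ls v))"
    unfolding agendas_def using finite_V lsV by (intro card_arrangements) auto
  also have "real (\<Prod>v\<in>V. fact (count_list ?ls v)) * (?pr / fact m) =
      (\<Prod>v\<in>V. fact (count_list ?ls v) * poisson_weight l (count_list ?ls v)) *
      ((1 / real q) ^ m * (1 / real (card V)) ^ (t - m) * (1 / real q) ^ (t - m) / fact m)"
    unfolding prod_slot_sets[OF ws mt] by (simp add: prod.distrib)
  also have "(\<Prod>v\<in>V. fact (count_list ?ls v) * poisson_weight l (count_list ?ls v)) = (\<Prod>v\<in>V. exp (- l) * l ^ count_list ?ls v)"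
    by (simp add: poisson_weight_def)
  also have "\<dots> = exp (- l) ^ card V * l ^ m"
  proof -
    have "(\<Sum>v\<in>V. count_list ?ls v) = length ?ls" using lsV finite_V by (rule sum_count_set)
    then show ?thesis using len mt by (simp add: prod.distrib flip: power_sum)
  qed
  also have "exp (- l) ^ card V = exp (- (real (card V) * l))" by (simp flip: exp_of_nat_mult)
  also have "exp (- (real (card V) * l)) * l ^ m * ((1 / real q) ^ m * (1 / real (card V)) ^ (t - m) * (1 / real q) ^ (t - m) / fact m) =
      poisson_weight (real (card V) * l) m / real (card V * q) ^ t"
  proof -
    have "real (card V * q) ^ t = real (card V) ^ m * real q ^ m * (real (card V) ^ (t - m) * real q ^ (t - m))"
    proof -
      have "c ^ t = c ^ m * c ^ (t - m)" for c :: real using mt by (simp flip: power_add)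
      then show ?thesis by (simp add: power_mult_distrib mult_ac)
    qed
    then show ?thesis using card_V q by (simp add: poisson_weight_def power_mult_distrib power_divide field_simps)
  qed
  finally show ?thesis .
qed

text \<open>For t below m the last proposals are summed out: downward induction from t = m, where
  each sequence has \<open>card V * q\<close> equally likely extensions.\<close>

lemma joint_law:
  assumes "ws \<in> seqs D t"
  shows "prob (run_event m t ws) =
    poisson_weight (real (card V) * l) m / real (card V * q) ^ t"
proof -
  have "\<forall>ws\<in>seqs D t. prob (run_event m t ws) =
      poisson_weight (real (card V) * l) m / real (card V * q) ^ t" if "t \<le> m" for t
    using that
  proof (induction t rule: inc_induct)
    case base
    show ?case using joint_law_ge[of _ m m] by blast
  next
    case (step t)
    show ?case
    proof
      fix ws assume ws: "ws \<in> seqs D t"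
      let ?E = "\<lambda>w. run_event m (Suc t) (ws @ [w])"
      have fin: "finite D" using finite_V by simp
      have len: "length ws = t" using ws by (simp add: seqs_def)
      have ev: "?E w \<in> events" for w using joint_event[of m "Suc t" "{ws @ [w]}"] by (simp only: singleton_iff)
      have "prob (run_event m t ws) = prob (\<Union>w\<in>D. ?E w)"
      proof (rule finite_measure_eq_AE)
        show "AE \<omega> in P. \<omega> \<in> run_event m t ws \<longleftrightarrow> \<omega> \<in> (\<Union>w\<in>D. ?E w)"
          using AE_good
        proof eventually_elim
          case (elim \<omega>)
          have "W \<omega> t \<in> D" by (rule good_proposal_in[OF elim])
          then show ?case by auto
        qed
        show "run_event m t ws \<in> events"
          using joint_event[of m t "{ws}"] by (simp only: singleton_iff)
        show "(\<Union>w\<in>D. ?E w) \<in> events" using fin ev by (rule sets.finite_UN)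
      qed
      also have "\<dots> = (\<Sum>w\<in>D. prob (?E w))"
        using fin ev by (intro finite_measure_finite_Union) (auto simp: disjoint_family_on_def)
      also have "\<dots> = (\<Sum>w\<in>D. poisson_weight (real (card V) * l) m / real (card V * q) ^ Suc t)"
      proof (rule sum.cong[OF refl])
        fix w assume "w \<in> D"
        then have "ws @ [w] \<in> seqs D (Suc t)" using ws by (auto simp: seqs_def)
        then show "prob (?E w) = poisson_weight (real (card V) * l) m / real (card V * q) ^ Suc t"
          by (rule bspec[OF step.IH])
      qed
      also have "\<dots> = poisson_weight (real (card V) * l) m / real (card V * q) ^ t"
        using card_V q by (simp add: card_cartesian_product)
      finally show "prob (run_event m t ws) =
        poisson_weight (real (card V) * l) m / real (card V * q) ^ t" .
    qed
  qed
  then show ?thesis using joint_law_ge[of ws t m] assms by (cases "m \<le> t") auto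
qed

lemma prob_N_proposals:
  "prob {\<omega> \<in> space P. N \<omega> = m \<and> map (W \<omega>) [0..<t] \<in> S} =
    poisson_weight (real (card V) * l) m * (real (card (S \<inter> seqs D t)) / real (card V * q) ^ t)"
proof -
  let ?E = "\<lambda>ws. run_event m t ws"
  have fin: "finite (S \<inter> seqs D t)" using finite_V by (intro finite_Int disjI2 finite_seqs) simp
  have ev: "?E w \<in> events" for w using joint_event[of m t "{w}"] by (simp only: singleton_iff)
  have "prob {\<omega> \<in> space P. N \<omega> = m \<and> map (W \<omega>) [0..<t] \<in> S} = prob (\<Union>ws\<in>S \<inter> seqs D t. ?E ws)"
  proof (rule finite_measure_eq_AE)
    show "AE \<omega> in P. \<omega> \<in> {\<omega> \<in> space P. N \<omega> = m \<and> map (W \<omega>) [0..<t] \<in> S} \<longleftrightarrow> \<omega> \<in> (\<Union>ws\<in>S \<inter> seqs D t. ?E ws)"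
      using AE_good
    proof eventually_elim
      case (elim \<omega>)
      have "map (W \<omega>) [0..<t] \<in> seqs D t" 
        using good_proposal_in[OF elim] unfolding seqs_def by (simp add: image_subset_iff)
      then show ?case by auto
    qed
    show "{\<omega> \<in> space P. N \<omega> = m \<and> map (W \<omega>) [0..<t] \<in> S} \<in> events" by (rule joint_event)
    show "(\<Union>ws\<in>S \<inter> seqs D t. ?E ws) \<in> events" using fin ev by (rule sets.finite_UN)
  qed
  also have "\<dots> = (\<Sum>ws\<in>S \<inter> seqs D t. prob (?E ws))"
    using fin ev by (intro finite_measure_finite_Union) (auto simp: disjoint_family_on_def)
  also have "\<dots> = (\<Sum>ws\<in>S \<inter> seqs D t. poisson_weight (real (card V) * l) m / real (card V * q) ^ t)"
    by (intro sum.cong refl joint_law) simp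
  finally show ?thesis by simp
qed

lemma prob_N: "prob {\<omega> \<in> space P. N \<omega> = m} = poisson_weight (real (card V) * l) m"
proof -
  have "UNIV \<inter> seqs D 0 = {[]}" by (auto simp: seqs_def)
  then show ?thesis using prob_N_proposals[of m 0 UNIV] by simp
qed

lemma prob_N_in_proposals:
  "prob {\<omega> \<in> space P. N \<omega> \<in> A \<and> map (W \<omega>) [0..<t] \<in> S} =
    prob {\<omega> \<in> space P. N \<omega> \<in> A} * (real (card (S \<inter> seqs D t)) / real (card V * q) ^ t)"
proof -
  let ?c = "real (card (S \<inter> seqs D t)) / real (card V * q) ^ t"
  let ?F = "\<lambda>m. if m \<in> A then poisson_weight (real (card V) * l) m else 0"
  have *: "(\<lambda>m. prob {\<omega> \<in> space P. m \<in> A \<and> N \<omega> = m \<and> map (W \<omega>) [0..<t] \<in> S}) sums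
      prob {\<omega> \<in> space P. N \<omega> \<in> A \<and> map (W \<omega>) [0..<t] \<in> S}" for t S
  proof -
    have "{\<omega> \<in> space P. N \<omega> \<in> A \<and> map (W \<omega>) [0..<t] \<in> S} =
        (\<Union>m. {\<omega> \<in> space P. m \<in> A \<and> N \<omega> = m \<and> map (W \<omega>) [0..<t] \<in> S})" by auto
    moreover have "{\<omega> \<in> space P. m \<in> A \<and> N \<omega> = m \<and> map (W \<omega>) [0..<t] \<in> S} \<in> events" for m
      using joint_event[of m t S] by (cases "m \<in> A") simp_all
    ultimately show ?thesis
      by (simp only:, intro finite_measure_UNION) (auto simp: disjoint_family_on_def)
  qed
  have each: "prob {\<omega> \<in> space P. m \<in> A \<and> N \<omega> = m \<and> map (W \<omega>) [0..<t] \<in> S} =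
      ?F m * (real (card (S \<inter> seqs D t)) / real (card V * q) ^ t)" for m t S
    using prob_N_proposals[of m t S] by (cases "m \<in> A") simp_all
  have "UNIV \<inter> seqs D 0 = {[]}" by (auto simp: seqs_def)
  then have F: "?F sums prob {\<omega> \<in> space P. N \<omega> \<in> A}"
    using *[of 0 UNIV] unfolding each by simp
  show ?thesis using *[of t S] sums_mult2[OF F, of ?c] unfolding each by (rule sums_unique2)
qed

lemma prob_proposals:
  "prob {\<omega> \<in> space P. map (W \<omega>) [0..<t] \<in> S} = real (card (S \<inter> seqs D t)) / real (card V * q) ^ t"
  using prob_N_in_proposals[of UNIV t S] by (simp add: prob_space)

end

section \<open>The trajectory as a Markov chain independent of N\<close>

context sampler
begin

lemma trajectory_proposals:
  "i \<le> t \<Longrightarrow> trajectory E x0 (W \<omega>) i = trajectory E x0 ((!) (map (W \<omega>) [0..<t])) i"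
  by (rule trajectory_cong) simp

lemma measurable_trajectory: "(\<lambda>\<omega>. trajectory E x0 (W \<omega>) t) \<in> measurable P (count_space UNIV)"
proof -
  have "(\<lambda>\<omega>. trajectory E x0 ((!) (map (W \<omega>) [0..<t])) t) \<in> measurable P (count_space UNIV)"
    by (rule measurable_compose[OF measurable_proposals]) simp
  then show ?thesis by (simp only: trajectory_proposals[of t t, symmetric] order_refl)
qed

lemma pmf_metropolis_step:
  "pmf (metropolis_step V E q x) y = real (card {w\<in>D. update E w x = y}) / real (card V * q)"
proof -
  have qs: "finite {1..q}" "{1..q} \<noteq> {}" using q by auto
  have D: "finite D" "D \<noteq> {}" using finite_V V_nonempty qs by auto
  have "pair_pmf (pmf_of_set V) (pmf_of_set {1..q}) = pmf_of_set D"
  proof (rule pmf_eqI)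
    fix w :: "nat \<times> nat"
    show "pmf (pair_pmf (pmf_of_set V) (pmf_of_set {1..q})) w = pmf (pmf_of_set D) w"
      using finite_V V_nonempty qs D by (cases w) (auto simp: pmf_pair indicator_def)
  qed
  moreover have "(\<lambda>(v, c). if c \<notin> x ` nbhd E v then x(v := c) else x) = (\<lambda>w. update E w x)"
    by (auto simp: update_def fun_eq_iff)
  ultimately have "pmf (metropolis_step V E q x) y = measure (pmf_of_set D) ((\<lambda>w. update E w x) -` {y})"
    unfolding metropolis_step_def by (simp only: pmf_map)
  also have "\<dots> = real (card (D \<inter> ((\<lambda>w. update E w x) -` {y}))) / real (card D)"
    by (rule measure_pmf_of_set[OF D(2,1)])
  also have "D \<inter> ((\<lambda>w. update E w x) -` {y}) = {w\<in>D. update E w x = y}" by blast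
  finally show ?thesis by (simp add: card_cartesian_product)
qed

text \<open>Which proposals lead from \<open>xs i\<close> to the next state does not depend on how
  \<open>xs i\<close> was reached, so the count factors step by step.\<close>

lemma card_paths:
  "card ({ws. \<forall>i\<le>t. trajectory E x0 ((!) ws) i = xs i} \<inter> seqs D t) =
     (if xs 0 = x0 then \<Prod>i<t. card {w\<in>D. update E w (xs i) = xs (Suc i)} else 0)"
proof (induction t)
  case 0
  have "{ws. \<forall>i\<le>0. trajectory E x0 ((!) ws) i = xs i} \<inter> seqs D 0 = (if xs 0 = x0 then {[]} else {})"
    by (auto simp: seqs_def)
  then show ?case by simp
next
  case (Suc t)
  let ?S = "\<lambda>t. {ws. \<forall>i\<le>t. trajectory E x0 ((!) ws) i = xs i} \<inter> seqs D t"
  let ?U = "{w\<in>D. update E w (xs t) = xs (Suc t)}"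
  let ?f = "\<lambda>(ws, w). ws @ [w]"
  have old: "trajectory E x0 ((!) (ws @ [w])) i = trajectory E x0 ((!) ws) i" if "i \<le> t" "ws \<in> seqs D t" for ws w i
    using that by (intro trajectory_cong) (simp add: seqs_def nth_append)
  have iff: "ws @ [w] \<in> ?S (Suc t) \<longleftrightarrow> ws \<in> ?S t \<and> w \<in> ?U" if ws: "ws \<in> seqs D t" and w: "w \<in> D" for ws w
  proof -
    have "ws @ [w] \<in> seqs D (Suc t)" using ws w by (auto simp: seqs_def)
    moreover have "(ws @ [w]) ! t = w" using ws by (simp add: seqs_def nth_append)
    ultimately have "ws @ [w] \<in> ?S (Suc t) \<longleftrightarrow> (\<forall>i\<le>t. trajectory E x0 ((!) ws) i = xs i) \<and>
        update E w (trajectory E x0 ((!) ws) t) = xs (Suc t)"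
      using old[OF _ ws] by (auto simp: le_Suc_eq)
    then show ?thesis using ws w by auto
  qed
  have "?S (Suc t) = ?f ` (?S t \<times> ?U)"
  proof (rule set_eqI)
    fix xs'
    show "xs' \<in> ?S (Suc t) \<longleftrightarrow> xs' \<in> ?f ` (?S t \<times> ?U)"
    proof
      assume x: "xs' \<in> ?S (Suc t)"
      then have "xs' \<in> seqs D (Suc t)" by (rule IntD2)
      then obtain ws w where w: "ws \<in> seqs D t" "w \<in> D" "xs' = ws @ [w]" unfolding seqs_Suc by auto
      have "ws \<in> ?S t \<and> w \<in> ?U" using x unfolding w(3) iff[OF w(1,2)] .
      then have "(ws, w) \<in> ?S t \<times> ?U" by (elim conjE) (rule SigmaI)
      then show "xs' \<in> ?f ` (?S t \<times> ?U)" by (rule rev_image_eqI) (simp only: w(3) prod.case)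
    next
      assume "xs' \<in> ?f ` (?S t \<times> ?U)"
      then obtain ws w where w: "ws \<in> ?S t" "w \<in> ?U" "xs' = ws @ [w]" by auto
      have "w \<in> D" using w(2) by simp
      then show "xs' \<in> ?S (Suc t)" using iff[OF IntD2[OF w(1)]] w by (simp only: simp_thms)
    qed
  qed
  moreover have "inj_on ?f (?S t \<times> ?U)" by (auto simp: inj_on_def)
  ultimately have "card (?S (Suc t)) = card (?S t) * card ?U"
    by (simp only: card_image card_cartesian_product)
  then show ?case by (simp only: Suc.IH lessThan_Suc) simp
qed

lemma markov_chain_trajectory: "markov_chain_from P (metropolis_step V E q) x0 (\<lambda>t \<omega>. trajectory E x0 (W \<omega>) t)"
  unfolding markov_chain_from_def
proof (intro conjI allI measurable_trajectory)
  fix t :: nat and xs :: "nat \<Rightarrow> nat \<Rightarrow> nat"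
  let ?S = "{ws. \<forall>i\<le>t. trajectory E x0 ((!) ws) i = xs i}"
  have "{\<omega> \<in> space P. \<forall>i\<le>t. trajectory E x0 (W \<omega>) i = xs i} = {\<omega> \<in> space P. map (W \<omega>) [0..<t] \<in> ?S}"
    using trajectory_proposals[of _ t] by auto
  then have "prob {\<omega> \<in> space P. \<forall>i\<le>t. trajectory E x0 (W \<omega>) i = xs i} = real (card (?S \<inter> seqs D t)) / real (card V * q) ^ t"
    by (simp only: prob_proposals)
  also have "\<dots> = (if xs 0 = x0 then \<Prod>i<t. pmf (metropolis_step V E q (xs i)) (xs (Suc i)) else 0)"
    unfolding card_paths pmf_metropolis_step by (simp add: prod_dividef)
  finally show "prob {\<omega> \<in> space P. \<forall>i\<le>t. trajectory E x0 (W \<omega>) i = xs i} =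
    (if xs 0 = x0 then \<Prod>i<t. pmf (metropolis_step V E q (xs i)) (xs (Suc i)) else 0)" .
qed

text \<open>Both sigma-algebras have intersection-stable generators. A cylinder event of the process
  fixes finitely many times, so it is decided by the first t proposals, and for these independence
  from N is known.\<close>

lemma indep_trajectory: "indep_of_process P N (\<lambda>t \<omega>. trajectory E x0 (W \<omega>) t)"
proof -
  let ?X = "\<lambda>\<omega> t. trajectory E x0 (W \<omega>) t"
  let ?M = "\<lambda>_::nat. count_space (UNIV :: (nat \<Rightarrow> nat) set)"
  let ?A = "{N -` A \<inter> space P | A. A \<in> sets (count_space UNIV)}"
  let ?B = "{?X -` A \<inter> space P | A. A \<in> prod_algebra UNIV ?M}"
  have setsA: "sets (vimage_algebra (space P) N (count_space UNIV)) = sigma_sets (space P) ?A"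
    by (rule sets_vimage_algebra)
  have setsB: "sets (vimage_algebra (space P) ?X (\<Pi>\<^sub>M t\<in>UNIV. count_space UNIV)) = sigma_sets (space P) ?B"
  proof -
    have X: "?X \<in> space P \<rightarrow> (\<Pi>\<^sub>E i\<in>UNIV. space (?M i))" by simp
    then have "sets (vimage_algebra (space P) ?X (\<Pi>\<^sub>M t\<in>UNIV. count_space UNIV)) =
        {?X -` A \<inter> space P | A. A \<in> sets (\<Pi>\<^sub>M t\<in>UNIV. count_space UNIV)}"
      by (intro sets_vimage_algebra2) (simp add: space_PiM)
    also have "\<dots> = sigma_sets (space P) ?B"
      unfolding sets_PiM by (rule sigma_sets_vimage_commute[OF X])
    finally show ?thesis .
  qed
  have stableA: "Int_stable ?A"
  proof (rule Int_stableI)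
    fix a b assume "a \<in> ?A" "b \<in> ?A"
    then obtain A B where "a = N -` A \<inter> space P" "b = N -` B \<inter> space P" by blast
    then have "a \<inter> b = N -` (A \<inter> B) \<inter> space P" by blast
    then show "a \<inter> b \<in> ?A" by (intro CollectI exI[of _ "A \<inter> B"] conjI) simp_all
  qed
  have stableB: "Int_stable ?B"
  proof (rule Int_stableI)
    fix a b assume "a \<in> ?B" "b \<in> ?B"
    then obtain A B where AB: "a = ?X -` A \<inter> space P" "A \<in> prod_algebra UNIV ?M"
      "b = ?X -` B \<inter> space P" "B \<in> prod_algebra UNIV ?M" by blast
    have "A \<inter> B \<in> prod_algebra UNIV ?M"
      using Int_stable_prod_algebra AB(2,4) by (rule Int_stableD)
    moreover have "a \<inter> b = ?X -` (A \<inter> B) \<inter> space P" using AB by blast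
    ultimately show "a \<inter> b \<in> ?B" by blast
  qed
  have cyl: "\<exists>t S. b = {\<omega> \<in> space P. map (W \<omega>) [0..<t] \<in> S}" if "b \<in> ?B" for b
  proof -
    obtain A where A: "b = ?X -` A \<inter> space P" "A \<in> prod_algebra UNIV ?M" using \<open>b \<in> ?B\<close> by blast
    from A(2) obtain J F where J: "A = prod_emb UNIV ?M J (\<Pi>\<^sub>E j\<in>J. F j)" "finite J"
      by (elim prod_algebraE)
    define t where "t = Max (insert 0 J)"
    have t: "j \<le> t" if "j \<in> J" for j unfolding t_def using J(2) that by simp
    have "?X \<omega> \<in> A \<longleftrightarrow> (\<forall>j\<in>J. trajectory E x0 ((!) (map (W \<omega>) [0..<t])) j \<in> F j)" for \<omega>
    proof -
      have "?X \<omega> \<in> A \<longleftrightarrow> (\<forall>j\<in>J. trajectory E x0 (W \<omega>) j \<in> F j)"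
        unfolding J(1) by (simp add: prod_emb_def PiE_iff)
      also have "\<dots> \<longleftrightarrow> (\<forall>j\<in>J. trajectory E x0 ((!) (map (W \<omega>) [0..<t])) j \<in> F j)"
        by (rule ball_cong[OF refl]) (simp only: trajectory_proposals[OF t])
      finally show ?thesis .
    qed
    then have "b = {\<omega> \<in> space P. map (W \<omega>) [0..<t] \<in> {ws. \<forall>j\<in>J. trajectory E x0 ((!) ws) j \<in> F j}}"
      unfolding A(1) by (simp only: vimage_def Int_def mem_Collect_eq conj_commute)
    then show ?thesis by blast
  qed
  have "indep_set ?A ?B"
  proof (rule indep_setI)
    show "?A \<subseteq> events" using measurable_N by (auto intro: measurable_sets)
    show "?B \<subseteq> events"
    proof
      fix b assume "b \<in> ?B"
      then obtain t S where "b = {\<omega> \<in> space P. map (W \<omega>) [0..<t] \<in> S}" using cyl by blast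
      moreover have "(\<lambda>\<omega>. map (W \<omega>) [0..<t]) -` S \<inter> space P \<in> events"
        using measurable_proposals by (rule measurable_sets) simp
      ultimately show "b \<in> events" by (simp only: vimage_def Int_def mem_Collect_eq conj_commute)
    qed
    fix a b assume a: "a \<in> ?A" and b: "b \<in> ?B"
    obtain t S where tS: "b = {\<omega> \<in> space P. map (W \<omega>) [0..<t] \<in> S}" using cyl[OF b] by (elim exE)
    obtain A where "a = N -` A \<inter> space P" using a by (elim CollectE exE conjE)
    note ab = this tS
    have "prob (a \<inter> b) = prob {\<omega> \<in> space P. N \<omega> \<in> A \<and> map (W \<omega>) [0..<t] \<in> S}"
      unfolding ab
      by (intro arg_cong[where f = prob] set_eqI)
        (simp only: vimage_eq Int_iff mem_Collect_eq conj_ac conj_absorb conj_left_absorb)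
    also have "\<dots> = prob {\<omega> \<in> space P. N \<omega> \<in> A} * prob b"
      unfolding ab prob_N_in_proposals prob_proposals ..
    also have "{\<omega> \<in> space P. N \<omega> \<in> A} = a" unfolding ab by blast
    finally show "prob (a \<inter> b) = prob a * prob b" .
  qed
  then show ?thesis
    unfolding indep_of_process_def setsA setsB using stableA stableB by (rule indep_set_sigma_sets)
qed

end

section \<open>The algorithm\<close>

definition local_info :: "local_input \<Rightarrow> coins \<Rightarrow> node_info" where
  "local_info inp c = (sorted_list_of_set (neighbors inp), init_color inp,
     map (\<lambda>j. (event_time c j, event_colour (num_colors inp) c j))
       (sort_key (event_time c) [0..<event_count (2 * horizon inp + 2) c]))"

definition gossip_algorithm :: algorithm where
  "gossip_algorithm inp c = gossip (self inp) (local_info inp c)"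

definition infos :: "nat set set \<Rightarrow> nat \<Rightarrow> real \<Rightarrow> (nat \<Rightarrow> nat) \<Rightarrow> (nat \<Rightarrow> coins) \<Rightarrow> nat \<Rightarrow> node_info" where
  "infos E q T x0 \<omega> v = local_info \<lparr>self = v, neighbors = nbhd E v, num_colors = q, horizon = T, init_color = x0 v\<rparr> (\<omega> v)"

lemma network_gossip: "network gossip_algorithm E q T x0 \<omega> = (\<lambda>v. gossip v (infos E q T x0 \<omega> v))"
  by (simp add: fun_eq_iff network_def gossip_algorithm_def infos_def)

lemma infos_simps:
  "nbs (infos E q T x0 \<omega>) v = sorted_list_of_set (nbhd E v)"
  "ini (infos E q T x0 \<omega>) v = x0 v"
  "evs (infos E q T x0 \<omega>) v = map (\<lambda>j. (event_time (\<omega> v) j, event_colour q (\<omega> v) j))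
     (sort_key (event_time (\<omega> v)) [0..<event_count (2 * T + 2) (\<omega> v)])"
  by (simp_all add: nbs_def ini_def evs_def infos_def local_info_def)

lemma length_gossip_message:
  assumes "(s, m) \<in> set (chan (run E (\<lambda>v. gossip v (I v)) \<sigma> i) u w)"
  shows "length m = 1" "w \<in> nbhd E u"
proof -
  let ?B = "\<lambda>v. gossip v (I v)"
  have "(s, m) \<in> set (sent_log E ?B \<sigma> i u w)"
    using assms chan_eq_drop[of E ?B \<sigma> i u w] in_set_dropD by metis
  then have "m \<in> set (map snd (sent_log E ?B \<sigma> i u w))" by force
  then have "m \<in> set (stream E ?B u w (hist (run E ?B \<sigma> i) u))" by (simp only: map_snd_sent_log)
  then obtain h where h: "m \<in> set (map snd (outgoing E ?B 0 u h w))" unfolding stream_def by auto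
  then show w: "w \<in> nbhd E u" by (auto simp: outgoing_def split: if_splits)
  from h have "m \<in> set (map snd (filter (\<lambda>e. fst e = w) (fst (?B u h))))" by (simp only: map_snd_outgoing_filter[OF w])
  then have "m \<in> set (block (to_nat (known u (I u) h)))" by (auto simp: gossip_def Let_def)
  then show "length m = 1" by (auto simp: block_def)
qed

lemma sort_key_map: "sort_key f (map g xs) = map g (sort_key (f \<circ> g) xs)"
proof -
  have "insort_key f (g x) (map g ys) = map g (insort_key (f \<circ> g) x ys)" for x ys
    by (induction ys) auto
  then show ?thesis by (induction xs) simp_all
qed

lemma filter_agenda:
  assumes "finite V" "v \<in> V"
  shows "filter (\<lambda>e. fst e = v) (agenda V l \<omega>) = map (Pair v) (sort_key (event_time (\<omega> v)) [0..<event_count l (\<omega> v)])"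
proof -
  have "filter (\<lambda>e. fst e = v) (concat (map (\<lambda>v. map (Pair v) (f v)) vs)) = (if v \<in> set vs then map (Pair v) (f v) else [])"
    if "distinct vs" for f :: "nat \<Rightarrow> nat list" and vs
    using that
  proof (induction vs)
    case (Cons u vs)
    then show ?case by (cases "u = v") (auto simp: filter_map comp_def)
  qed simp
  then show ?thesis unfolding agenda_def filter_sort using assms
    by (simp add: sort_key_map comp_def)
qed

text \<open>Serves almost sure termination, where any precision will do; the quantitative bound uses
  \<open>prob_tie\<close> instead.\<close>

lemma ex_separating_precision:
  fixes S :: "real set"
  assumes "finite S"
  shows "\<exists>p. \<forall>x\<in>S. \<forall>y\<in>S. x \<noteq> y \<longrightarrow> \<lfloor>2 ^ p * x\<rfloor> \<noteq> \<lfloor>2 ^ p * y\<rfloor>"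
proof -
  have "eventually (\<lambda>p. x \<noteq> y \<longrightarrow> \<lfloor>2 ^ p * x\<rfloor> \<noteq> \<lfloor>2 ^ p * y\<rfloor>) sequentially" for x y :: real
  proof (cases "x = y")
    case False
    obtain p where p: "1 / \<bar>x - y\<bar> < 2 ^ p" using real_arch_pow[of 2 "1 / \<bar>x - y\<bar>"] by auto
    have "\<lfloor>2 ^ k * x\<rfloor> \<noteq> \<lfloor>2 ^ k * y\<rfloor>" if "k \<ge> p" for k
    proof
      assume "\<lfloor>2 ^ k * x\<rfloor> = \<lfloor>2 ^ k * y\<rfloor>"
      then have "\<bar>2 ^ k * x - 2 ^ k * y\<bar> < 1" by linarith
      then have "2 ^ k * \<bar>x - y\<bar> < 1" by (simp add: abs_mult flip: right_diff_distrib)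
      moreover have "1 < 2 ^ p * \<bar>x - y\<bar>" using p False by (simp add: field_simps)
      moreover have "2 ^ p * \<bar>x - y\<bar> \<le> 2 ^ k * \<bar>x - y\<bar>" using that by (intro mult_right_mono power_increasing) auto
      ultimately show False by linarith
    qed
    then show ?thesis unfolding eventually_sequentially by blast
  qed simp
  then have "eventually (\<lambda>p. \<forall>x\<in>S. \<forall>y\<in>S. x \<noteq> y \<longrightarrow> \<lfloor>2 ^ p * x\<rfloor> \<noteq> \<lfloor>2 ^ p * y\<rfloor>) sequentially"
    using assms by (intro eventually_ball_finite ballI)
  then show ?thesis unfolding eventually_sequentially by blast
qed

lemma global_chain_length: "global_chain E x0 W n k \<Longrightarrow> n \<le> k"
  by (induction rule: global_chain.induct) auto

lemma global_chain_cong: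
  "global_chain E x0 W n k \<Longrightarrow> (\<And>i. i \<le> k \<Longrightarrow> W i = W' i) \<Longrightarrow> global_chain E x0 W' n k"
proof (induction rule: global_chain.induct)
  case (global_chain_Suc n j k)
  have "trajectory E x0 W j = trajectory E x0 W' j"
    using global_chain_Suc by (intro trajectory_cong) simp
  then show ?case using global_chain_Suc by (intro global_chain.global_chain_Suc[of _ _ _ _ j]) auto
qed (rule global_chain_0)

section \<open>From coins to terminating executions\<close>

locale coloring_sampler = sampler V "2 * T + 2" q for V :: "nat set" and T :: real and q :: nat +
  fixes E :: "nat set set" and x0 :: "nat \<Rightarrow> nat"
  assumes graph: "simple_graph V E" and T: "0 \<le> T"
begin

abbreviation "net \<equiv> network gossip_algorithm E q T x0"

definition untied :: "(nat \<Rightarrow> coins) \<Rightarrow> nat \<Rightarrow> bool" where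
  "untied \<omega> p \<longleftrightarrow> (\<forall>v\<in>V. \<forall>u\<in>V. \<forall>i<event_count (2 * T + 2) (\<omega> v). \<forall>j<event_count (2 * T + 2) (\<omega> u).
     v \<noteq> u \<longrightarrow> \<lfloor>2 ^ p * event_time (\<omega> v) i\<rfloor> \<noteq> \<lfloor>2 ^ p * event_time (\<omega> u) j\<rfloor>)"

abbreviation events_in_order :: "(nat \<Rightarrow> coins) \<Rightarrow> (real \<times> nat \<times> nat) list" where
  "events_in_order \<omega> \<equiv> map (\<lambda>(v, j). (event_time (\<omega> v) j, v, event_colour q (\<omega> v) j)) (agenda V (2 * T + 2) \<omega>)"

lemma timeline:
  assumes "good \<omega>"
  shows "timeline V E x0 (events_in_order \<omega>)
    (W \<omega>) (infos E q T x0 \<omega>)"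
proof
  show "simple_graph V E" by (rule graph)
  show "sorted_wrt (<) (map fst (events_in_order \<omega>))"
    using agenda_sorted[OF assms, of "2 * T + 2"] by (simp add: comp_def case_prod_unfold)
  show "W \<omega> k = snd (events_in_order \<omega> ! k)"
    if "k < length (events_in_order \<omega>)" for k
    using that by (simp add: proposal_def Let_def case_prod_unfold)
  show "evs (infos E q T x0 \<omega>) v = map (\<lambda>e. (fst e, snd (snd e))) (filter (\<lambda>e. fst (snd e) = v)
      (events_in_order \<omega>))" if "v \<in> V" for v
    using filter_agenda[OF finite_V that, of "2 * T + 2" \<omega>]
    by (simp add: infos_simps filter_map comp_def case_prod_unfold)
qed (simp_all add: infos_simps)

lemma separated_infos:
  assumes "untied \<omega> p"
  shows "separated (infos E q T x0 \<omega>) p"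
  unfolding separated_def
proof (intro allI ballI equals0I)
  fix v u z
  assume "u \<in> set (nbs (infos E q T x0 \<omega>) v)"
    and z: "z \<in> (\<lambda>e. \<lfloor>2 ^ p * fst e\<rfloor>) ` set (evs (infos E q T x0 \<omega>) v) \<inter> (\<lambda>e. \<lfloor>2 ^ p * fst e\<rfloor>) ` set (evs (infos E q T x0 \<omega>) u)"
  then have "u \<in> nbhd E v"
    using finite_subset[OF subsetI[OF nbhd_imp(1)[OF graph]] finite_V] by (simp add: infos_simps)
  then have "u \<in> V" "v \<in> V" "u \<noteq> v" using nbhd_imp[OF graph] by blast+
  moreover obtain i where "i < event_count (2 * T + 2) (\<omega> v)" "z = \<lfloor>2 ^ p * event_time (\<omega> v) i\<rfloor>"
    using z by (auto simp: infos_simps)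
  moreover obtain j where "j < event_count (2 * T + 2) (\<omega> u)" "z = \<lfloor>2 ^ p * event_time (\<omega> u) j\<rfloor>"
    using z by (auto simp: infos_simps)
  ultimately show False using assms unfolding untied_def by metis
qed

lemma all_nodes_return:
  assumes good: "good \<omega>" and p: "untied \<omega> p"
    and n: "\<And>k. k < N \<omega> \<Longrightarrow> \<not> global_chain E x0 (W \<omega>) (Suc n) k"
    and adm: "admissible E (net \<omega>) \<sigma>"
  shows "terminates_with V E (net \<omega>) \<sigma> (trajectory E x0 (W \<omega>) (N \<omega>))"
    and "real (p + Suc n) \<le> r \<Longrightarrow> terminates_within V E (net \<omega>) \<sigma> r"
proof -
  interpret tl: timeline V E x0 "events_in_order \<omega>"
    "W \<omega>" "infos E q T x0 \<omega>" by (rule timeline[OF good])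
  interpret ge: gossip_execution V E \<sigma> "infos E q T x0 \<omega>" tl.acc
    using graph adm tl.rule by unfold_locales (simp_all add: network_gossip infos_simps)
  have nochain: "\<not> chain (infos E q T x0 \<omega>) tl.acc (Suc n) v i" for v i
    using n by (intro tl.no_chain) simp
  let ?i = "ge.milestone (p + Suc n)"
  have ret: "returned (net \<omega>) (run E (net \<omega>) \<sigma> ?i) v \<noteq> None" for v
    unfolding network_gossip by (rule ge.all_returned[OF separated_infos[OF p] nochain])
  have "returned (net \<omega>) (run E (net \<omega>) \<sigma> ?i) v = Some (trajectory E x0 (W \<omega>) (N \<omega>) v)" if "v \<in> V" for v
    using ge.returned_value[of ?i v] ret[of v] tl.final_colour[OF that] unfolding network_gossip by simp
  then show "terminates_with V E (net \<omega>) \<sigma> (trajectory E x0 (W \<omega>) (N \<omega>))"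
    unfolding terminates_with_def by blast
  show "terminates_within V E (net \<omega>) \<sigma> r" if "real (p + Suc n) \<le> r"
    using ge.terminates_within_milestone[of "p + Suc n" r] ret that unfolding network_gossip by blast
qed

lemma ex_untied:
  assumes "good \<omega>"
  shows "\<exists>p. untied \<omega> p"
proof -
  let ?e = "\<lambda>(v, j). event_time (\<omega> v) j"
  let ?A = "Sigma V (\<lambda>v. {..<event_count (2 * T + 2) (\<omega> v)})"
  have "finite (?e ` ?A)" using finite_V by simp
  then obtain p where p: "\<forall>x\<in>?e ` ?A. \<forall>y\<in>?e ` ?A. x \<noteq> y \<longrightarrow> \<lfloor>2 ^ p * x\<rfloor> \<noteq> \<lfloor>2 ^ p * y\<rfloor>"
    using ex_separating_precision by blast
  have "untied \<omega> p"
    unfolding untied_def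
  proof (intro ballI allI impI)
    fix v u i j assume *: "v \<in> V" "u \<in> V" "i < event_count (2 * T + 2) (\<omega> v)" "j < event_count (2 * T + 2) (\<omega> u)" "v \<noteq> u"
    have "event_time (\<omega> v) i \<noteq> event_time (\<omega> u) j"
    proof
      assume "event_time (\<omega> v) i = event_time (\<omega> u) j"
      then have "?e (v, i) = ?e (u, j)" by simp
      then have "(v, i) = (u, j)" by (rule inj_onD[OF inj_event_time[OF assms]]) (use *(1,2) in auto)
      then show False using *(5) by simp
    qed
    moreover have "event_time (\<omega> v) i \<in> ?e ` ?A" by (rule rev_image_eqI[of "(v, i)"]) (use * in auto)
    moreover have "event_time (\<omega> u) j \<in> ?e ` ?A" by (rule rev_image_eqI[of "(u, j)"]) (use * in auto)
    ultimately show "\<lfloor>2 ^ p * event_time (\<omega> v) i\<rfloor> \<noteq> \<lfloor>2 ^ p * event_time (\<omega> u) j\<rfloor>" using p by blast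
  qed
  then show ?thesis ..
qed

lemma AE_terminates:
  "AE \<omega> in P. \<forall>\<sigma>. admissible E (net \<omega>) \<sigma> \<longrightarrow> terminates_with V E (net \<omega>) \<sigma> (trajectory E x0 (W \<omega>) (N \<omega>))"
  using AE_good
proof eventually_elim
  case (elim \<omega>)
  obtain p where p: "untied \<omega> p" using ex_untied[OF elim] ..
  \<comment> \<open>The step index strictly decreases along a chain, so N updates leave no room for
    N + 1 links. This crude bound is enough for almost sure termination.\<close>
  have "\<not> global_chain E x0 (W \<omega>) (Suc (N \<omega>)) k" if "k < N \<omega>" for k
    using global_chain_length[of E x0 "W \<omega>" "Suc (N \<omega>)" k] that by auto
  then show ?case using all_nodes_return(1)[OF elim p] by blast
qed

end

section \<open>Tail bounds\<close>

lemma half_le_ln_2: "1 / 2 \<le> ln (2 :: real)"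
  using ln_div[of 1 "2 :: real"] ln_le_minus_one[of "1 / 2 :: real"] by simp

context sampler
begin

lemma measurable_N_set: "{\<omega> \<in> space P. N \<omega> \<in> A} \<in> events"
  using measurable_sets[OF measurable_N, of A] by (simp add: vimage_def Int_def conj_commute)

text \<open>Chernoff's method: the right side is c times the expectation of r ^ N for N Poisson. It
  is applied with r = 1/2 for the lower tail and r = 2 for the upper tail.\<close>

lemma prob_N_le:
  assumes "0 < r" "0 \<le> c" "\<And>m. m \<in> A \<Longrightarrow> 1 \<le> c * r ^ m"
  shows "prob {\<omega> \<in> space P. N \<omega> \<in> A} \<le> c * exp (real (card V) * l * (r - 1))"
proof (rule sums_le)
  let ?\<mu> = "real (card V) * l"
  have mu: "0 \<le> ?\<mu>" using l by simp
  show "(\<lambda>m. if m \<in> A then poisson_weight ?\<mu> m else 0) sums prob {\<omega> \<in> space P. N \<omega> \<in> A}"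
  proof -
    have "{\<omega> \<in> space P. N \<omega> \<in> A} = (\<Union>m. {\<omega> \<in> space P. N \<omega> \<in> A \<inter> {m}})" by auto
    moreover have "(\<lambda>m. prob {\<omega> \<in> space P. N \<omega> \<in> A \<inter> {m}}) sums prob (\<Union>m. {\<omega> \<in> space P. N \<omega> \<in> A \<inter> {m}})"
      by (rule finite_measure_UNION[OF image_subsetI[OF measurable_N_set]]) (auto simp: disjoint_family_on_def)
    moreover have "prob {\<omega> \<in> space P. N \<omega> \<in> A \<inter> {m}} = (if m \<in> A then poisson_weight ?\<mu> m else 0)" for m
      using prob_N[of m] by (cases "m \<in> A") simp_all
    ultimately show ?thesis by simp
  qed
  have "(\<lambda>m. exp (- ?\<mu>) * ((?\<mu> * r) ^ m /\<^sub>R fact m)) sums (exp (- ?\<mu>) * exp (?\<mu> * r))"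
    by (intro sums_mult exp_converges)
  then have "(\<lambda>m. c * (exp (- ?\<mu>) * ((?\<mu> * r) ^ m /\<^sub>R fact m))) sums (c * (exp (- ?\<mu>) * exp (?\<mu> * r)))"
    by (rule sums_mult)
  moreover have "exp (- ?\<mu>) * exp (?\<mu> * r) = exp (?\<mu> * (r - 1))" by (simp add: algebra_simps flip: exp_add)
  moreover have "exp (- ?\<mu>) * ((?\<mu> * r) ^ m /\<^sub>R fact m) = poisson_weight ?\<mu> m * r ^ m" for m
    by (simp add: poisson_weight_def power_mult_distrib divide_inverse mult_ac)
  ultimately show "(\<lambda>m. c * (poisson_weight ?\<mu> m * r ^ m)) sums (c * exp (?\<mu> * (r - 1)))" by simp
  fix m
  show "(if m \<in> A then poisson_weight ?\<mu> m else 0) \<le> c * (poisson_weight ?\<mu> m * r ^ m)"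
  proof (cases "m \<in> A")
    case True
    have "poisson_weight ?\<mu> m * 1 \<le> poisson_weight ?\<mu> m * (c * r ^ m)"
      using poisson_weight_nonneg[OF mu] assms(3)[OF True] by (intro mult_left_mono)
    then show ?thesis using True by (simp add: mult_ac)
  next
    case False
    then show ?thesis using poisson_weight_nonneg[OF mu, of m] assms(1,2) by simp
  qed
qed

text \<open>\<open>card_chains_le\<close> divided by the number of sequences, with 1 + x \<le> exp x
  applied to the factor gained per step.\<close>

lemma prob_chain_le:
  assumes g: "simple_graph V E"
  shows "prob {\<omega> \<in> space P. \<exists>k<t. global_chain E x0 (W \<omega>) n k} \<le>
      real t * exp (4 * real (max_degree V E) * real t / real (card V * q)) / 2 ^ n"
    and "{\<omega> \<in> space P. \<exists>k<t. global_chain E x0 (W \<omega>) n k} \<in> events"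
proof -
  let ?S = "{ws. \<exists>k<t. global_chain E x0 ((!) ws) n k}"
  let ?x = "4 * real (max_degree V E) / real (card V * q)"
  have nq: "0 < real (card V * q)" using card_V q by simp
  have "global_chain E x0 (W \<omega>) n k \<longleftrightarrow> global_chain E x0 ((!) (map (W \<omega>) [0..<t])) n k" if "k < t" for \<omega> k
    using that by (intro iffI; elim global_chain_cong) simp_all
  then have eq: "{\<omega> \<in> space P. \<exists>k<t. global_chain E x0 (W \<omega>) n k} = {\<omega> \<in> space P. map (W \<omega>) [0..<t] \<in> ?S}"
    by blast
  show "{\<omega> \<in> space P. \<exists>k<t. global_chain E x0 (W \<omega>) n k} \<in> events"
  proof -
    have "(\<lambda>\<omega>. map (W \<omega>) [0..<t]) -` ?S \<inter> space P \<in> events"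
      using measurable_proposals by (rule measurable_sets) simp
    then show ?thesis unfolding eq by (simp only: vimage_def Int_def mem_Collect_eq conj_commute)
  qed
  have card_D: "real (card D) = real (card V * q)" by (simp add: card_cartesian_product)
  have "?S \<inter> seqs D t = {ws\<in>seqs D t. \<exists>k<t. global_chain E x0 ((!) ws) n k}" by blast
  then have "real (card (?S \<inter> seqs D t)) * 2 ^ n \<le> real t * (real (card V * q) + 4 * real (max_degree V E)) ^ t"
    using card_chains_le[OF g refl, of q t x0 n] unfolding card_D by simp
  also have "real (card V * q) + 4 * real (max_degree V E) = real (card V * q) * (1 + ?x)"
  proof -
    have "a + d = a * (1 + d / a)" if "0 < a" for a d :: real using that by (simp add: field_simps)
    from this[OF nq] show ?thesis .
  qed
  also have "real t * (real (card V * q) * (1 + ?x)) ^ t = real t * (1 + ?x) ^ t * real (card V * q) ^ t"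
    by (simp add: power_mult_distrib)
  also have "\<dots> \<le> real t * exp (?x * real t) * real (card V * q) ^ t"
  proof (intro mult_right_mono mult_left_mono)
    have "(1 + ?x) ^ t \<le> exp ?x ^ t" by (intro power_mono exp_ge_add_one_self) simp
    then show "(1 + ?x) ^ t \<le> exp (?x * real t)" by (simp add: mult.commute flip: exp_of_nat_mult)
  qed simp_all
  finally have "real (card (?S \<inter> seqs D t)) \<le> real t * exp (?x * real t) * real (card V * q) ^ t / 2 ^ n"
    by (simp add: pos_le_divide_eq)
  then have "real (card (?S \<inter> seqs D t)) / real (card V * q) ^ t \<le> real t * exp (?x * real t) / 2 ^ n"
    using nq by (simp add: pos_divide_le_eq)
  then show "prob {\<omega> \<in> space P. \<exists>k<t. global_chain E x0 (W \<omega>) n k} \<le>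
      real t * exp (4 * real (max_degree V E) * real t / real (card V * q)) / 2 ^ n"
    unfolding eq prob_proposals by simp
qed

definition tie :: "nat \<Rightarrow> nat \<Rightarrow> (nat \<Rightarrow> coins) set" where
  "tie p M = (\<Union>((v, u), (i, j))\<in>{(v, u). v \<in> V \<and> u \<in> V \<and> v \<noteq> u} \<times> ({..<M} \<times> {..<M}).
     {\<omega> \<in> space P. \<lfloor>2 ^ p * event_time (\<omega> v) i\<rfloor> = \<lfloor>2 ^ p * event_time (\<omega> u) j\<rfloor>})"

lemma prob_tie:
  shows "tie p M \<in> events" "prob (tie p M) \<le> (real (card V))\<^sup>2 * (real M)\<^sup>2 / 2 ^ p"
proof -
  let ?I = "{(v, u). v \<in> V \<and> u \<in> V \<and> v \<noteq> u} \<times> ({..<M} \<times> {..<M})"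
  let ?E = "\<lambda>((v, u), (i, j)). {\<omega> \<in> space P. \<lfloor>2 ^ p * event_time (\<omega> v) i\<rfloor> = \<lfloor>2 ^ p * event_time (\<omega> u) j\<rfloor>}"
  have sub: "?I \<subseteq> (V \<times> V) \<times> ({..<M} \<times> {..<M})" by auto
  have fin: "finite ?I" using finite_V by (intro finite_subset[OF sub]) auto
  have E: "?E x \<in> events \<and> prob (?E x) \<le> 1 / 2 ^ p" if "x \<in> ?I" for x
  proof -
    obtain v u i j where x: "x = ((v, u), (i, j))" by (metis surj_pair)
    have "?E x = {\<omega> \<in> space P. \<lfloor>2 ^ p * coin_at (v, 5 * i + 2) \<omega>\<rfloor> = \<lfloor>2 ^ p * coin_at (u, 5 * j + 2) \<omega>\<rfloor>}"
      by (simp add: x coin_at_def event_time_def)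
    moreover have "(v, 5 * i + 2) \<in> V \<times> UNIV" "(u, 5 * j + 2) \<in> V \<times> UNIV" "(v, 5 * i + 2) \<noteq> (u, 5 * j + 2)"
      using that x by auto
    ultimately show ?thesis using prob_tie_le[of "(v, 5 * i + 2)" "(u, 5 * j + 2)" p] by (simp only: simp_thms)
  qed
  have tie: "tie p M = (\<Union>x\<in>?I. ?E x)" unfolding tie_def by (rule arg_cong[where f = Union]) (auto simp: image_iff)
  show "tie p M \<in> events" unfolding tie using fin E by (intro sets.finite_UN) blast+
  have "prob (tie p M) \<le> (\<Sum>x\<in>?I. prob (?E x))"
    unfolding tie using fin E by (intro finite_measure_subadditive_finite) blast+
  also have "\<dots> \<le> (\<Sum>x\<in>?I. 1 / 2 ^ p)" using E by (intro sum_mono) blast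
  also have "\<dots> = real (card ?I) / 2 ^ p" by simp
  also have "\<dots> \<le> real (card ((V \<times> V) \<times> ({..<M} \<times> {..<M}))) / 2 ^ p"
    using finite_V by (intro divide_right_mono of_nat_mono card_mono[OF _ sub]) auto
  also have "\<dots> = (real (card V))\<^sup>2 * (real M)\<^sup>2 / 2 ^ p" by (simp add: card_cartesian_product power2_eq_square)
  finally show "prob (tie p M) \<le> (real (card V))\<^sup>2 * (real M)\<^sup>2 / 2 ^ p" .
qed

end

section \<open>Failure probabilities\<close>

context coloring_sampler
begin

abbreviation "n \<equiv> real (card V)"

text \<open>The reason for the mean 2 T + 2 per node: the exponent is n T ln 2 - n (T + 1), which is
  at most - n even when T = 0.\<close>

lemma prob_N_few: "prob {\<omega> \<in> space P. N \<omega> \<in> {m. real m < n * T}} \<le> exp (- n)"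
proof -
  have "prob {\<omega> \<in> space P. N \<omega> \<in> {m. real m < n * T}} \<le> 2 powr (n * T) * exp (n * (2 * T + 2) * (1 / 2 - 1))"
  proof (rule prob_N_le)
    fix m assume "m \<in> {m. real m < n * T}"
    then have "2 powr real m \<le> 2 powr (n * T)" by (intro powr_mono) auto
    then show "1 \<le> 2 powr (n * T) * (1 / 2) ^ m" by (simp add: powr_realpow power_one_over field_simps)
  qed simp_all
  also have "\<dots> = exp (n * T * ln 2 + n * (2 * T + 2) * (1 / 2 - 1))"
    unfolding exp_add by (simp add: powr_def)
  also have "\<dots> \<le> exp (- n)"
  proof -
    have "n * T * ln 2 \<le> n * T * 1" using T ln_2_less_1 by (intro mult_left_mono) auto
    then show ?thesis by (simp add: algebra_simps)
  qed
  finally show ?thesis .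
qed

text \<open>Four times the mean n (2 T + 2) of N. With ln 2 \<ge> 1/2 the exponent of the upper tail
  is then at most - 2 n (T + 1). A fixed horizon is wanted because the bounds on chains and ties are
  for a fixed number of steps.\<close>

definition cap :: nat where "cap = nat \<lceil>8 * n * (T + 1)\<rceil>"

lemma cap: "8 * n * (T + 1) \<le> real cap" "real cap \<le> 9 * n * (T + 1)"
proof -
  have n: "1 \<le> n" using card_V by simp
  show "8 * n * (T + 1) \<le> real cap" unfolding cap_def by linarith
  have "1 * 1 \<le> n * (T + 1)" using n T by (intro mult_mono) auto
  moreover have "real cap \<le> 8 * n * (T + 1) + 1"
  proof -
    have "0 \<le> 8 * n * (T + 1)" using calculation by linarith
    then have "real cap = real_of_int \<lceil>8 * n * (T + 1)\<rceil>" unfolding cap_def by (intro of_nat_nat) linarith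
    then show ?thesis by linarith
  qed
  ultimately show "real cap \<le> 9 * n * (T + 1)" by simp
qed

lemma prob_N_many: "prob {\<omega> \<in> space P. N \<omega> \<in> {m. cap < m}} \<le> exp (- n)"
proof -
  have n: "1 \<le> n" using card_V by simp
  have "prob {\<omega> \<in> space P. N \<omega> \<in> {m. cap < m}} \<le> (1 / 2) ^ cap * exp (n * (2 * T + 2) * (2 - 1))"
  proof (rule prob_N_le)
    fix m assume "m \<in> {m. cap < m}"
    then have "(2 :: real) ^ cap \<le> 2 ^ m" by (intro power_increasing) auto
    then show "1 \<le> (1 / 2) ^ cap * (2 :: real) ^ m" by (simp add: power_one_over field_simps)
  qed simp_all
  also have "(1 / 2 :: real) ^ cap = exp (- real cap * ln 2)"
    by (simp add: exp_minus power_one_over exp_of_nat_mult inverse_eq_divide)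
  also have "exp (- real cap * ln 2) * exp (n * (2 * T + 2) * (2 - 1)) = exp (n * (2 * T + 2) - real cap * ln 2)"
    by (simp flip: exp_add)
  also have "\<dots> \<le> exp (- n)"
  proof -
    have "8 * n * (T + 1) * (1 / 2) \<le> real cap * ln 2"
      using cap(1) half_le_ln_2 n T by (intro mult_mono) auto
    moreover have "0 \<le> n * T" using T by simp
    ultimately show ?thesis using n by (simp add: algebra_simps)
  qed
  finally show ?thesis .
qed

text \<open>The summands pay for N being too small or too large, for a chain with L + 1 links within
  the first \<open>cap\<close> steps, and for a tie at precision p among the first
  \<open>cap\<close> events of different nodes.\<close>

abbreviation failure :: "nat \<Rightarrow> nat \<Rightarrow> real" where
  "failure L p \<equiv> 2 * exp (- n) +
     real cap * exp (4 * real (max_degree V E) * real cap / (n * real q)) / 2 ^ Suc L +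
     n\<^sup>2 * (real cap)\<^sup>2 / 2 ^ p"

lemma success_event:
  shows "\<exists>A\<in>events. prob A \<ge> 1 - failure L p \<and>
    (\<forall>\<omega>\<in>A. n * T \<le> real (N \<omega>) \<and>
      (\<forall>\<sigma> r. admissible E (net \<omega>) \<sigma> \<longrightarrow> real (p + Suc L) \<le> r \<longrightarrow> terminates_within V E (net \<omega>) \<sigma> r))"
proof -
  \<comment> \<open>\<open>good\<close> is only known to hold almost everywhere, so a null event
    covering its complement is removed.\<close>
  obtain Z where Z: "{\<omega> \<in> space P. \<not> good \<omega>} \<subseteq> Z" "emeasure P Z = 0" "Z \<in> events"
    using AE_good by (rule AE_E)
  let ?B1 = "{\<omega> \<in> space P. N \<omega> \<in> {m. real m < n * T}}" and ?B2 = "{\<omega> \<in> space P. N \<omega> \<in> {m. cap < m}}"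
  let ?B3 = "{\<omega> \<in> space P. \<exists>k<cap. global_chain E x0 (W \<omega>) (Suc L) k}"
  let ?bad = "Z \<union> ?B1 \<union> ?B2 \<union> ?B3 \<union> tie p cap"
  note ev = Z(3) measurable_N_set prob_chain_le(2)[OF graph] prob_tie(1)
  have bad: "?bad \<in> events" by (intro sets.Un ev)
  have union: "prob (A \<union> B) \<le> a + b" if "A \<in> events" "B \<in> events" "prob A \<le> a" "prob B \<le> b" for A B a b
    using measure_Un_le[OF that(1,2)] that(3,4) by linarith
  have "prob Z \<le> 0" using Z(2) by (simp add: measure_def)
  then have "prob ?bad \<le> 0 + exp (- n) + exp (- n) + real cap * exp (4 * real (max_degree V E) * real cap / real (card V * q)) / 2 ^ Suc L +
      n\<^sup>2 * (real cap)\<^sup>2 / 2 ^ p"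
    by (intro union sets.Un ev prob_N_few prob_N_many prob_chain_le(1)[OF graph] prob_tie(2))
  then have pb: "prob ?bad \<le> failure L p" by simp
  show ?thesis
  proof (intro bexI conjI ballI allI impI)
    show "space P - ?bad \<in> events" using bad by (rule sets.compl_sets)
    show "prob (space P - ?bad) \<ge> 1 - failure L p" using pb prob_compl[OF bad] by simp
    fix \<omega> assume \<omega>: "\<omega> \<in> space P - ?bad"
    then have sp: "\<omega> \<in> space P" and nZ: "\<omega> \<notin> Z" and nB1: "\<omega> \<notin> ?B1" and nB2: "\<omega> \<notin> ?B2" and nB3: "\<omega> \<notin> ?B3"
      and nt: "\<omega> \<notin> tie p cap" by simp_all
    show "n * T \<le> real (N \<omega>)" using sp nB1 by simp
    have good: "good \<omega>" using sp nZ Z(1) by blast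
    have le: "N \<omega> \<le> cap" using sp nB2 by simp
    have chain: "\<not> global_chain E x0 (W \<omega>) (Suc L) k" if "k < N \<omega>" for k
    proof
      assume c: "global_chain E x0 (W \<omega>) (Suc L) k"
      have "k < cap" using that le by (rule less_le_trans)
      then have "\<omega> \<in> ?B3" using sp c by blast
      with nB3 show False by contradiction
    qed
    have cnt: "event_count (2 * T + 2) (\<omega> v) \<le> cap" if "v \<in> V" for v
    proof -
      have "event_count (2 * T + 2) (\<omega> v) = length (filter (\<lambda>e. fst e = v) (agenda V (2 * T + 2) \<omega>))"
        by (simp add: filter_agenda[OF finite_V that])
      also have "\<dots> \<le> N \<omega>" by (rule length_filter_le)
      finally show ?thesis using le by simp
    qed
    have untied: "untied \<omega> p"
      unfolding untied_def
    proof (intro ballI allI impI notI)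
      fix v u i j assume *: "v \<in> V" "u \<in> V" "i < event_count (2 * T + 2) (\<omega> v)" "j < event_count (2 * T + 2) (\<omega> u)" "v \<noteq> u"
        and eq: "\<lfloor>2 ^ p * event_time (\<omega> v) i\<rfloor> = \<lfloor>2 ^ p * event_time (\<omega> u) j\<rfloor>"
      have "i < cap" "j < cap" using * cnt less_le_trans by blast+
      then have "\<omega> \<in> tie p cap" unfolding tie_def
        using * eq sp by (intro UN_I[of "((v, u), (i, j))"]) simp_all
      then show False using nt by blast
    qed
    fix \<sigma> r assume "admissible E (net \<omega>) \<sigma>" "real (p + Suc L) \<le> r"
    then show "terminates_within V E (net \<omega>) \<sigma> r" using all_nodes_return(2)[OF good untied chain] by blast
  qed
qed

end

section \<open>Choice of the constants\<close>

lemma exp_le_powr: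
  fixes n g :: real
  assumes "1 \<le> n" "0 < g"
  shows "exp (- n) \<le> exp (g * ln g) * n powr (- g)"
proof -
  have "ln (n / g) \<le> n / g - 1" using assms by (intro ln_le_minus_one) simp
  then have "ln n - ln g \<le> n / g" using assms by (simp add: ln_div)
  then have "g * (ln n - ln g) \<le> g * (n / g)" using assms by (intro mult_left_mono) auto
  then have "- n \<le> g * ln g + - g * ln n" using assms by (simp add: algebra_simps)
  then have "exp (- n) \<le> exp (g * ln g + - g * ln n)" by simp
  also have "\<dots> = exp (g * ln g) * n powr (- g)" unfolding exp_add using assms by (simp add: powr_def)
  finally show ?thesis .
qed

lemma exp_half_le_power2: "exp (real k / 2) \<le> 2 ^ k"
proof -
  have "exp (real k / 2) \<le> exp (real k * ln 2)" using half_le_ln_2 mult_left_mono[of "1 / 2" "ln 2" "real k"] by simp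
  also have "\<dots> = 2 ^ k" by (simp add: exp_of_nat_mult)
  finally show ?thesis .
qed

text \<open>One constant serves both bounds, as the sum of what they need: 90 + 2 g ^ g for the
  failure probability (9 from chains, 81 from ties, 2 g ^ g from the tails of N, where ln x \<le> x
  - 1 at x = n / g is used) and 16 + 144 / \<alpha> + 4 g for the time.\<close>

definition time_constant :: "real \<Rightarrow> real \<Rightarrow> real" where
  "time_constant \<alpha> g = 106 + 144 / \<alpha> + 4 * g + 2 * exp (g * ln g)"

context coloring_sampler
begin

lemma whp:
  assumes \<alpha>: "0 < \<alpha>" "\<alpha> * real (max_degree V E) \<le> real q" and g: "0 < g"
  shows "\<exists>A\<in>events. prob A \<ge> 1 - time_constant \<alpha> g * n powr (- g) \<and>
    (\<forall>\<omega>\<in>A. n * T \<le> real (N \<omega>) \<and>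
      (\<forall>\<sigma>. admissible E (net \<omega>) \<sigma> \<longrightarrow> terminates_within V E (net \<omega>) \<sigma> (time_constant \<alpha> g * (T + ln n))))"
proof (cases "card V = 1")
  case True
  \<comment> \<open>For one vertex ln n = 0, so with T = 0 the time bound would be 0. But
    \<open>n powr (- g)\<close> is 1, the required probability is at most 0, and the empty event
    will do.\<close>
  have "1 \<le> time_constant \<alpha> g" using \<alpha>(1) g by (simp add: time_constant_def)
  then show ?thesis using True by (intro bexI[of _ "{}"]) simp_all
next
  case False
  then have n2: "2 \<le> n" using card_V by linarith
  define \<Lambda> where "\<Lambda> = T + ln n"
  have "1 / 2 \<le> ln (2 :: real)" by (rule half_le_ln_2)
  also have "ln 2 \<le> ln n" using n2 by simp
  finally have ln_n: "1 / 2 \<le> ln n" .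
  have \<Lambda>: "1 / 2 \<le> \<Lambda>" "T + 1 \<le> 2 * \<Lambda>" using ln_n T by (simp_all add: \<Lambda>_def)
  \<comment> \<open>The factor 2 offsets \<open>exp (k / 2) \<le> 2 ^ k\<close>. In L, the 1 absorbs
    \<open>cap\<close>, which is at most 9 exp \<Lambda>, the 72 / \<alpha> absorbs the exponent of
    the chain bound, and g leaves the decay \<open>n powr (- g)\<close>. In p, the 4 absorbs n and
    \<open>cap\<close>, both squared.\<close>
  define L where "L = nat \<lceil>2 * (1 + 72 / \<alpha> + g) * \<Lambda>\<rceil>"
  define p where "p = nat \<lceil>2 * (4 + g) * \<Lambda>\<rceil>"
  have pos: "0 \<le> 2 * (1 + 72 / \<alpha> + g) * \<Lambda>" "0 \<le> 2 * (4 + g) * \<Lambda>" using \<alpha>(1) g \<Lambda> by simp_all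
  have L: "(1 + 72 / \<alpha> + g) * \<Lambda> \<le> real L / 2" "real L \<le> 2 * (1 + 72 / \<alpha> + g) * \<Lambda> + 1"
    using pos(1) unfolding L_def by linarith+
  have p: "(4 + g) * \<Lambda> \<le> real p / 2" "real p \<le> 2 * (4 + g) * \<Lambda> + 1"
    using pos(2) unfolding p_def by linarith+
  have decay: "exp (- g * \<Lambda>) \<le> n powr (- g)"
    using g T n2 by (simp add: powr_def \<Lambda>_def)
  have cap_le: "real cap \<le> 9 * exp \<Lambda>"
  proof -
    have "T + 1 \<le> exp T" using exp_ge_add_one_self[of T] by linarith
    then have "n * (T + 1) \<le> n * exp T" using n2 by (intro mult_left_mono) auto
    also have "\<dots> = exp \<Lambda>" using n2 by (simp add: \<Lambda>_def exp_add)
    finally show ?thesis using cap(2) by simp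
  qed
  \<comment> \<open>72 is the product of the 4 of the chain bound, the 9 of \<open>cap\<close> and
    the 2 of T + 1 \<le> 2 \<Lambda>; the last holds since n \<ge> 2 gives ln n \<ge> 1/2.\<close>
  have chain_exponent: "4 * real (max_degree V E) * real cap / (n * real q) \<le> 72 / \<alpha> * \<Lambda>"
  proof -
    have "real (max_degree V E) / real q \<le> 1 / \<alpha>"
      using \<alpha> q by (simp add: field_simps)
    moreover have "real cap / n \<le> 9 * (T + 1)" using cap(2) n2 by (simp add: field_simps)
    ultimately have "4 * ((real (max_degree V E) / real q) * (real cap / n)) \<le> 4 * (1 / \<alpha> * (9 * (T + 1)))"
      using \<alpha>(1) T by (intro mult_left_mono mult_mono) auto
    also have "\<dots> = 36 / \<alpha> * (T + 1)" by simp
    also have "\<dots> \<le> 36 / \<alpha> * (2 * \<Lambda>)" using \<Lambda>(2) \<alpha>(1) by (intro mult_left_mono) auto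
    finally show ?thesis by (simp add: mult_ac)
  qed
  have chain: "real cap * exp (4 * real (max_degree V E) * real cap / (n * real q)) / 2 ^ Suc L \<le> 9 * n powr (- g)"
  proof -
    have "real cap * exp (4 * real (max_degree V E) * real cap / (n * real q)) / 2 ^ Suc L \<le>
        9 * exp \<Lambda> * exp (72 / \<alpha> * \<Lambda>) / exp ((1 + 72 / \<alpha> + g) * \<Lambda>)"
    proof (intro frac_le mult_mono cap_le)
      have "exp ((1 + 72 / \<alpha> + g) * \<Lambda>) \<le> exp (real L / 2)" using L(1) by simp
      also have "\<dots> \<le> 2 ^ L" by (rule exp_half_le_power2)
      also have "\<dots> \<le> 2 ^ Suc L" by simp
      finally show "exp ((1 + 72 / \<alpha> + g) * \<Lambda>) \<le> 2 ^ Suc L" .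
    qed (use chain_exponent in simp_all)
    also have "\<dots> = 9 * exp (\<Lambda> + 72 / \<alpha> * \<Lambda> - (1 + 72 / \<alpha> + g) * \<Lambda>)" by (simp only: exp_add exp_diff times_divide_eq_right mult.assoc)
    also have "\<Lambda> + 72 / \<alpha> * \<Lambda> - (1 + 72 / \<alpha> + g) * \<Lambda> = - g * \<Lambda>" by (simp add: algebra_simps)
    finally show ?thesis using decay by simp
  qed
  have ties: "n\<^sup>2 * (real cap)\<^sup>2 / 2 ^ p \<le> 81 * n powr (- g)"
  proof -
    have "n \<le> exp \<Lambda>" using n2 T by (simp add: \<Lambda>_def exp_add)
    then have "n\<^sup>2 * (real cap)\<^sup>2 / 2 ^ p \<le> (exp \<Lambda>)\<^sup>2 * (9 * exp \<Lambda>)\<^sup>2 / exp ((4 + g) * \<Lambda>)"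
    proof (intro frac_le mult_mono power_mono cap_le)
      have "exp ((4 + g) * \<Lambda>) \<le> exp (real p / 2)" using p(1) by simp
      also have "\<dots> \<le> 2 ^ p" by (rule exp_half_le_power2)
      finally show "exp ((4 + g) * \<Lambda>) \<le> 2 ^ p" .
    qed simp_all
    also have "\<dots> = 81 * (exp \<Lambda> ^ 4 / exp ((4 + g) * \<Lambda>))" by (simp add: power_mult_distrib flip: power_add)
    also have "exp \<Lambda> ^ 4 = exp (4 * \<Lambda>)" by (simp flip: exp_of_nat_mult)
    also have "exp (4 * \<Lambda>) / exp ((4 + g) * \<Lambda>) = exp (- g * \<Lambda>)" by (simp add: algebra_simps flip: exp_diff)
    finally show ?thesis using decay by simp
  qed
  have "2 * exp (- n) \<le> 2 * exp (g * ln g) * n powr (- g)" using exp_le_powr[of n g] n2 g by simp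
  then have "failure L p \<le> (2 * exp (g * ln g) + 90) * n powr (- g)"
    using chain ties by (simp add: algebra_simps)
  also have "\<dots> \<le> time_constant \<alpha> g * n powr (- g)"
    using \<alpha>(1) g by (intro mult_right_mono) (simp_all add: time_constant_def)
  finally have fail: "failure L p \<le> time_constant \<alpha> g * n powr (- g)" .
  have time: "real (p + Suc L) \<le> time_constant \<alpha> g * (T + ln n)"
  proof -
    have "real (p + Suc L) \<le> 2 * (4 + g) * \<Lambda> + 2 * (1 + 72 / \<alpha> + g) * \<Lambda> + 6 * \<Lambda>"
      using L(2) p(2) \<Lambda>(1) by simp
    also have "\<dots> = (16 + 144 / \<alpha> + 4 * g) * \<Lambda>" by (simp add: algebra_simps)
    also have "\<dots> \<le> time_constant \<alpha> g * \<Lambda>"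
      using \<Lambda>(1) by (intro mult_right_mono) (simp_all add: time_constant_def)
    finally show ?thesis by (simp add: \<Lambda>_def)
  qed
  obtain A where A: "A \<in> events" "prob A \<ge> 1 - failure L p"
    "\<And>\<omega>. \<omega> \<in> A \<Longrightarrow> n * T \<le> real (N \<omega>)"
    "\<And>\<omega> \<sigma> r. \<omega> \<in> A \<Longrightarrow> admissible E (net \<omega>) \<sigma> \<Longrightarrow> real (p + Suc L) \<le> r \<Longrightarrow> terminates_within V E (net \<omega>) \<sigma> r"
    using success_event[of L p] by blast
  show ?thesis
  proof (intro bexI[OF _ A(1)] conjI ballI allI impI)
    show "1 - time_constant \<alpha> g * n powr (- g) \<le> prob A" using A(2) fail by linarith
  qed (use A(3) A(4)[OF _ _ time] in blast)+
qed

text \<open>Every message is one bit long. A message requires an edge, so n \<ge> 2 and ln n \<ge>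
  ln 2, which explains the factor 1 / ln 2.\<close>

lemma message_bound:
  "messages_at_most E (net \<omega>) \<sigma> (1 / ln 2 * (ln n + ln (real_of_int \<lceil>T\<rceil>) + ln (real q)))"
  unfolding messages_at_most_def
proof (intro allI ballI, clarify)
  fix i u v s m assume sm: "(s, m) \<in> set (chan (run E (net \<omega>) \<sigma> i) u v)"
  note msg = length_gossip_message[OF sm[unfolded network_gossip]]
  have "{u, v} \<subseteq> V" "u \<noteq> v" using nbhd_imp[OF graph msg(2)] by auto
  then have "2 \<le> card V" using card_mono[OF finite_V, of "{u, v}"] by simp
  then have "ln 2 \<le> ln n" by simp
  moreover have "0 \<le> ln (real q)" using q by simp
  \<comment> \<open>For T = 0 this is ln 0, which is 0 by the convention of HOL.\<close>
  moreover have "0 \<le> ln (real_of_int \<lceil>T\<rceil>)"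
  proof (cases "T = 0")
    case False
    then have "1 \<le> \<lceil>T\<rceil>" using T by linarith
    then show ?thesis by simp
  qed simp
  ultimately have "ln 2 \<le> ln n + ln (real_of_int \<lceil>T\<rceil>) + ln (real q)" by linarith
  then have "1 / ln 2 * ln 2 \<le> 1 / ln 2 * (ln n + ln (real_of_int \<lceil>T\<rceil>) + ln (real q))"
    by (intro mult_left_mono) auto
  then show "real (length m) \<le> 1 / ln 2 * (ln n + ln (real_of_int \<lceil>T\<rceil>) + ln (real q))"
    using msg(1) by simp
qed

end

theorem theorem1p1:
  fixes \<alpha> :: real
  assumes "\<alpha> > 0"
  shows "\<exists>(alg :: algorithm) (b :: real) (C :: real \<Rightarrow> real). b > 0 \<and> (\<forall>\<gamma>>0. C \<gamma> > 0) \<and>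
    (\<forall>(V :: nat set) (E :: nat set set) (q :: nat) (T :: real) (x0 :: nat \<Rightarrow> nat).
       simple_graph V E \<longrightarrow> real q \<ge> \<alpha> * real (max_degree V E) \<longrightarrow> T \<ge> 0 \<longrightarrow>
       x0 \<in> V \<rightarrow>\<^sub>E {1..q} \<longrightarrow>
       (let n = real (card V);
            P = coin_space V;
            net = network alg E q T x0
        in
          (\<forall>\<omega>\<in>space P. \<forall>\<sigma>. admissible E (net \<omega>) \<sigma> \<longrightarrow>
             messages_at_most E (net \<omega>) \<sigma> (b * (ln n + ln (real_of_int \<lceil>T\<rceil>) + ln (real q)))) \<and>
          (\<exists>(X :: nat \<Rightarrow> (nat \<Rightarrow> coins) \<Rightarrow> nat \<Rightarrow> nat) (N :: (nat \<Rightarrow> coins) \<Rightarrow> nat).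
             markov_chain_from P (metropolis_step V E q) x0 X \<and>
             N \<in> measurable P (count_space UNIV) \<and>
             indep_of_process P N X \<and>
             (AE \<omega> in P. \<forall>\<sigma>. admissible E (net \<omega>) \<sigma> \<longrightarrow>
                terminates_with V E (net \<omega>) \<sigma> (X (N \<omega>) \<omega>)) \<and>
             (\<forall>\<gamma>>0. \<exists>A\<in>sets P. measure P A \<ge> 1 - C \<gamma> * n powr (- \<gamma>) \<and>
                (\<forall>\<omega>\<in>A. real (N \<omega>) \<ge> n * T \<and>
                   (\<forall>\<sigma>. admissible E (net \<omega>) \<sigma> \<longrightarrow>
                      terminates_within V E (net \<omega>) \<sigma> (C \<gamma> * (T + ln n))))))))"
proof (intro exI[of _ gossip_algorithm] exI[of _ "1 / ln 2"] exI[of _ "time_constant \<alpha>"] conjI allI impI, goal_cases)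
  case 1
  show ?case by simp
next
  case (2 g)
  have "0 < 144 / \<alpha>" using assms by simp
  moreover have "0 < exp (g * ln g)" by simp
  ultimately show ?case using 2 unfolding time_constant_def by linarith
next
  case (3 V E q T x0)
  have V: "finite V" "V \<noteq> {}" using 3(1) by (simp_all add: simple_graph_def)
  \<comment> \<open>Positivity of q comes from the initial color of any vertex.\<close>
  then obtain v where "v \<in> V" by blast
  then have "x0 v \<in> {1..q}" using 3(4) by (rule PiE_mem[rotated])
  then have "0 < q" by simp
  then interpret coloring_sampler V T q E x0
    using 3 V by unfold_locales simp_all
  show ?case
    unfolding Let_def
    by (intro conjI ballI allI impI exI[of _ "\<lambda>t \<omega>. trajectory E x0 (W \<omega>) t"] exI[of _ N] message_bound
        markov_chain_trajectory measurable_N indep_trajectory AE_terminates whp assms 3(2))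
qed

end
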